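(* Let $n\ge 2$, $q\ge 2$ and $N=\binom{n+q}{q}-1$. A germ $X$ of smooth complex analytic variety of dimension $n$ at $0\in\mathbb C^N$ has property (P) if and only if it is equivalent, modulo $\mathrm{Aut}\,\mathbb P^N$, to a germ at $0\in\mathbb C^N$ defined by a parametrization of the form $$x_\alpha = s^\alpha + s^\alpha R_{|\alpha|}(s),\qquad 1\le|\alpha|\le q,$$ where $s=(s_1,\dots,s_n)$ is near $0\in\mathbb C^n$ and $R_1,\dots,R_q$ are germs of holomorphic functions at $0\in\mathbb C^n$ with $R_k(0)=0$ for $k=1,\dots,q$. Moreover, in this characterization one can in addition require that $R_1(s)\equiv 0$ and that $s^\alpha R_{|\alpha|}(s)=O(|s|^{q+3})$ for all $\alpha$ with $2\le|\alpha|\le q$.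
   Context: For $\alpha\in\mathbb N^n$, $|\alpha|=\alpha_1+\dots+\alpha_n$ and $s^\alpha=s_1^{\alpha_1}\cdots s_n^{\alpha_n}$. The coordinates of $x\in\mathbb C^N$ are indexed by the multi-indices $\alpha\in\mathbb N^n$ with $1\le|\alpha|\le q$: $x=(x_\alpha)_{1\le|\alpha|\le q}$. $\mathbb C^N$ is viewed as an affine chart of $\mathbb P^N$; equivalence modulo $\mathrm{Aut}\,\mathbb P^N$ of two germs at $0$ means that one is the image of the other by some $\phi\in\mathrm{Aut}\,\mathbb P^N$ (a homography) with $\phi(0)=0$. The germ $X$ (smooth, of dimension $n$ at $0\in\mathbb C^N$) is $q$-regular at $0$ if the osculating space of order $q$ at $0$, i.e. the span of the derivatives at $0$ of orders $1,\dots,q$ of germs of parametrized curves in $X$ through $0$, has the maximal dimension $\binom{n+q}{q}-1$ (here $=N$). A distinguished curve of $X$ is a germ of smooth curve at $0\in\mathbb C^N$ contained in the intersection of $X$ with a (affine, equivalently projective) subspace of dimension $q$. $X$ has property (P) if $X$ is $q$-regular at $0$ and for every direction $v\in\mathbb P(T_0X)$ there is a distinguished curve of $X$ tangent to $v$. *)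

theory Defs
  imports "HOL-Complex_Analysis.Complex_Analysis" "HOL-Library.Landau_Symbols"
begin

section \<open>Holomorphic functions of several complex variables\<close>

text \<open>
  Complex Frechet differentiability at every point of an open set \<open>U\<close>: the (real) derivative
  is required to be a complex linear form.
\<close>

definition holomorphic_fun_on :: "(complex^'a::finite \<Rightarrow> complex) \<Rightarrow> (complex^'a) set \<Rightarrow> bool" where
  "holomorphic_fun_on f U \<longleftrightarrow> open U \<and>
     (\<forall>z\<in>U. \<exists>a::complex^'a. (f has_derivative (\<lambda>h. \<Sum>i\<in>UNIV. a $ i * h $ i)) (at z))"

definition holomorphic_map_on ::
    "(complex^'a::finite \<Rightarrow> complex^'b::finite) \<Rightarrow> (complex^'a) set \<Rightarrow> bool" where
  "holomorphic_map_on F U \<longleftrightarrow> (\<forall>j. holomorphic_fun_on (\<lambda>z. F z $ j) U)"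

definition holomorphic_germ :: "(complex^'a::finite \<Rightarrow> complex) \<Rightarrow> bool" where
  "holomorphic_germ f \<longleftrightarrow> (\<exists>U. 0 \<in> U \<and> holomorphic_fun_on f U)"


section \<open>Germs at the origin\<close>

text \<open>
  A germ of a set at \<open>0\<close> is given by any representative; every notion below depends on it
  only through its germ. In this theory \<open>vec.span\<close>, \<open>vec.subspace\<close> and
  \<open>vec.dim\<close> on \<open>complex^'m\<close> are the notions over the complex field.
\<close>

definition germ_eq :: "(complex^'m::finite) set \<Rightarrow> (complex^'m) set \<Rightarrow> bool" where
  "germ_eq X Y \<longleftrightarrow> (\<forall>\<^sub>F x in nhds 0. x \<in> X \<longleftrightarrow> x \<in> Y)"

definition germ_subset :: "(complex^'m::finite) set \<Rightarrow> (complex^'m) set \<Rightarrow> bool" where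
  "germ_subset X Y \<longleftrightarrow> (\<forall>\<^sub>F x in nhds 0. x \<in> X \<longrightarrow> x \<in> Y)"

text \<open>
  Complex submanifold of dimension \<open>d\<close> through \<open>0\<close>: some biholomorphism \<open>\<Phi>\<close> between
  open neighbourhoods of \<open>0\<close> straightens \<open>X\<close> to a linear subspace.
\<close>

definition smooth_germ :: "nat \<Rightarrow> (complex^'m::finite) set \<Rightarrow> bool" where
  "smooth_germ d X \<longleftrightarrow>
     (\<exists>U V (\<Phi> :: complex^'m \<Rightarrow> complex^'m) \<Psi> L. 0 \<in> U \<and> holomorphic_map_on \<Phi> U \<and> holomorphic_map_on \<Psi> V \<and>
        homeomorphism U V \<Phi> \<Psi> \<and> \<Phi> 0 = 0 \<and>
        vec.subspace L \<and> vec.dim L = d \<and> \<Phi> ` (X \<inter> U) = L \<inter> V)"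

text \<open>
  The germ of the image of \<open>\<gamma>\<close>: the set \<open>\<gamma> ` ball 0 r\<close> has the germ \<open>Y\<close> for all small \<open>r\<close>.
\<close>

definition parametrizes :: "(complex^'n::finite \<Rightarrow> complex^'m::finite) \<Rightarrow> (complex^'m) set \<Rightarrow> bool" where
  "parametrizes \<gamma> Y \<longleftrightarrow> (\<forall>\<^sub>F r in at_right 0. germ_eq (\<gamma> ` ball 0 r) Y)"


section \<open>Equivalence modulo projective automorphisms\<close>

text \<open>
  Homogeneous coordinates on projective space are indexed by \<open>'m option\<close>, and
  \<open>complex^'m\<close> is the chart where the coordinate \<open>None\<close> does not vanish.
\<close>

definition homogenize :: "complex^'m::finite \<Rightarrow> complex^('m option)" where
  "homogenize x = (\<chi> j. case j of None \<Rightarrow> 1 | Some i \<Rightarrow> x $ i)"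

definition dehomogenize :: "complex^('m::finite option) \<Rightarrow> complex^'m" where
  "dehomogenize y = (\<chi> i. y $ Some i / y $ None)"

definition homography ::
    "complex^('m::finite option)^('m option) \<Rightarrow> complex^'m \<Rightarrow> complex^'m" where
  "homography M x = dehomogenize (M *v homogenize x)"

definition homography_defined_at ::
    "complex^('m::finite option)^('m option) \<Rightarrow> complex^'m \<Rightarrow> bool" where
  "homography_defined_at M x \<longleftrightarrow> (M *v homogenize x) $ None \<noteq> 0"

text \<open>
  A homography is injective where it is defined, so the choice of \<open>U\<close> is immaterial.
\<close>

definition projectively_equivalent :: "(complex^'m::finite) set \<Rightarrow> (complex^'m) set \<Rightarrow> bool" where
  "projectively_equivalent X Y \<longleftrightarrow>
     (\<exists>M U. invertible M \<and> open U \<and> 0 \<in> U \<and> (\<forall>x\<in>U. homography_defined_at M x) \<and>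
        homography M 0 = 0 \<and> germ_eq (homography M ` (X \<inter> U)) Y)"


section \<open>Curves, osculating spaces and property (P)\<close>

definition curve_germ_in :: "(complex^'m::finite) set \<Rightarrow> (complex \<Rightarrow> complex^'m) \<Rightarrow> bool" where
  "curve_germ_in X c \<longleftrightarrow>
     (\<forall>i. (\<lambda>t. c t $ i) analytic_on {0}) \<and> c 0 = 0 \<and> (\<forall>\<^sub>F t in nhds 0. c t \<in> X)"

definition curve_deriv :: "nat \<Rightarrow> (complex \<Rightarrow> complex^'m::finite) \<Rightarrow> complex^'m" where
  "curve_deriv k c = (\<chi> i. (deriv ^^ k) (\<lambda>t. c t $ i) 0)"

definition tangent_space :: "(complex^'m::finite) set \<Rightarrow> (complex^'m) set" where
  "tangent_space X = {curve_deriv 1 c | c. curve_germ_in X c}"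

definition osculating_space :: "nat \<Rightarrow> (complex^'m::finite) set \<Rightarrow> (complex^'m) set" where
  "osculating_space q X =
     vec.span {curve_deriv k c | k c. 1 \<le> k \<and> k \<le> q \<and> curve_germ_in X c}"

definition q_regular :: "nat \<Rightarrow> nat \<Rightarrow> (complex^'m::finite) set \<Rightarrow> bool" where
  "q_regular n q X \<longleftrightarrow> vec.dim (osculating_space q X) = ((n + q) choose q) - 1"

definition affine_subspace_of_dim :: "nat \<Rightarrow> (complex^'m::finite) set \<Rightarrow> bool" where
  "affine_subspace_of_dim d A \<longleftrightarrow>
     (\<exists>p L. vec.subspace L \<and> vec.dim L = d \<and> A = (\<lambda>x. p + x) ` L)"

definition distinguished_curve :: "nat \<Rightarrow> (complex^'m::finite) set \<Rightarrow> (complex^'m) set \<Rightarrow> bool" where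
  "distinguished_curve q X C \<longleftrightarrow>
     smooth_germ 1 C \<and> (\<exists>A. affine_subspace_of_dim q A \<and> germ_subset C (X \<inter> A))"

text \<open>
  A direction in the projectivized tangent space is represented by a nonzero tangent vector.
\<close>

definition property_P :: "nat \<Rightarrow> nat \<Rightarrow> (complex^'m::finite) set \<Rightarrow> bool" where
  "property_P n q X \<longleftrightarrow> q_regular n q X \<and>
     (\<forall>v\<in>tangent_space X. v \<noteq> 0 \<longrightarrow>
        (\<exists>C. distinguished_curve q X C \<and> tangent_space C = vec.span {v}))"


section \<open>Multi-indices and the normal form\<close>

definition mdeg :: "('n::finite \<Rightarrow> nat) \<Rightarrow> nat" where
  "mdeg \<alpha> = (\<Sum>i\<in>UNIV. \<alpha> i)"

definition mpow :: "complex^'n::finite \<Rightarrow> ('n \<Rightarrow> nat) \<Rightarrow> complex" where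
  "mpow s \<alpha> = (\<Prod>i\<in>UNIV. (s $ i) ^ \<alpha> i)"

definition multi_indices :: "nat \<Rightarrow> ('n::finite \<Rightarrow> nat) set" where
  "multi_indices q = {\<alpha>. 1 \<le> mdeg \<alpha> \<and> mdeg \<alpha> \<le> q}"

text \<open>
  The coordinates of \<open>complex^'m\<close> are labelled by multi-indices through a bijection
  \<open>idx\<close> from \<open>'m\<close> onto \<open>multi_indices q\<close>.
\<close>

definition normal_form_param ::
    "('m::finite \<Rightarrow> 'n::finite \<Rightarrow> nat) \<Rightarrow> (nat \<Rightarrow> complex^'n \<Rightarrow> complex) \<Rightarrow> complex^'n \<Rightarrow> complex^'m" where
  "normal_form_param idx R s =
     (\<chi> j. mpow s (idx j) + mpow s (idx j) * R (mdeg (idx j)) s)"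

definition admissible_remainders :: "nat \<Rightarrow> (nat \<Rightarrow> complex^'n::finite \<Rightarrow> complex) \<Rightarrow> bool" where
  "admissible_remainders q R \<longleftrightarrow> (\<forall>k\<in>{1..q}. holomorphic_germ (R k) \<and> R k 0 = 0)"

end

(*
  In terms of a parametrization g, property (P) says that no nonzero linear form vanishes on g to
  order q + 1, and that for every direction u some curve s(t) = t u + ... has a flat image: g(s(t))
  stays in a linear space of dimension q.  A linear change of coordinates gives
  x_alpha = s^alpha + O(|s|^(q+1)).  The main tool is that a linear form that vanishes to order
  q + 1 along a flat curve vanishes on it identically.

  Applied to s(t) = t u + t^(r+1) w + ..., this yields linear equations for w whose coefficients
  are polynomial in u.  As n >= 2, w can be computed by dividing by powers of two different
  coordinates of u, so w is polynomial in u and a change of the parameter s removes it.  Finitely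
  many steps turn the curves s(t) into lines to order q + 1.  Then the relations
  x_alpha s^beta = x_beta s^alpha, |alpha| = |beta|, hold, and divisibility gives
  x_alpha = s^alpha f_|alpha|(s).

  Homographies that are unipotent with respect to the degree replace f_k by
  f_k + Q_(k,1) f_(k+1) + Q_(k,2) f_(k+2) + ..., with Q_(k,i) homogeneous of degree i.  Dividing
  by the component of degree 0 and taking the components of degree 1 as the new parameters, one
  solves linear systems for the Q_(k,i), degree by degree, until s^alpha R_|alpha| = O(|s|^(q+3)).
*)
theory Submission
  imports Defs
begin

text \<open>Two counts shape the proof. Along s(t) = t u + t^(r+1) w + ... a coordinate of degree p
  starts with u^alpha t^p and feels w first at order p + r, while the error left by the linear
  normalization starts at order q + 1. Only for p = q + 1 - r do both meet, and w then enters
  linearly. A change of the curve parameter alters w by a multiple of u; this freedom is spent on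
  the unknown factor of proportionality. Each change of s spoils the linear normalization, which is
  redone after every step; regularity and flatness survive reparametrizations and linear maps. The
  exponent q + 3 comes from the second count. In a degree D from 2 to q the free coefficients are
  the Q_(k,D) with 0 <= k <= q - D, exactly as many as the indices 2 <= k <= q + 2 - D whose defect
  is to be removed. Removing the defect of index k through degree q + 2 - k gives s^alpha R_k the
  order q + 3. Germs in several variables are studied on the lines t s, where Taylor coefficients
  are homogeneous polynomials in s; exact division by a coordinate comes from Cauchy's
  integral.\<close>

no_notation fps_nth (infixl \<open>$\<close> 75)

section \<open>Calculus of germs of holomorphic functions, maps and curves\<close>

section \<open>Complex differentiability and germs\<close>

text \<open>Homogeneity over the complex numbers replaces an explicit coefficient vector: additivity
  is part of being a derivative, and the condition passes through sums, products and chain rules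
  without coordinates.\<close>

definition cdiff_at :: "(complex^'a::finite \<Rightarrow> complex) \<Rightarrow> complex^'a \<Rightarrow> bool" where
  "cdiff_at f z \<longleftrightarrow> (\<exists>D. (f has_derivative D) (at z) \<and> (\<forall>c h. D (c *s h) = c * D h))"

lemma cdiff_atI:
  "(f has_derivative D) (at z) \<Longrightarrow> (\<And>c h. D (c *s h) = c * D h) \<Longrightarrow> cdiff_at f z"
  unfolding cdiff_at_def by blast

lemma clinear_form_expand:
  fixes D :: "complex^'a::finite \<Rightarrow> complex"
  assumes "linear D" "\<And>c h. D (c *s h) = c * D h"
  shows "D h = (\<Sum>i\<in>UNIV. D (axis i 1) * h $ i)"
proof -
  have "D h = D (\<Sum>i\<in>UNIV. h $ i *s axis i 1)"
    by (simp add: basis_expansion)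
  also have "\<dots> = (\<Sum>i\<in>UNIV. D (h $ i *s axis i 1))"
    by (rule linear_sum[OF assms(1)])
  also have "\<dots> = (\<Sum>i\<in>UNIV. D (axis i 1) * h $ i)"
    by (simp add: assms(2) mult.commute)
  finally show ?thesis .
qed

lemma cdiff_at_iff:
  "cdiff_at f z \<longleftrightarrow> (\<exists>a::complex^'a::finite. (f has_derivative (\<lambda>h. \<Sum>i\<in>UNIV. a $ i * h $ i)) (at z))"
proof
  assume "cdiff_at f z"
  then obtain D where D: "(f has_derivative D) (at z)" "\<And>c h. D (c *s h) = c * D h"
    unfolding cdiff_at_def by blast
  have "linear D" using D(1) by (rule has_derivative_linear)
  then have "D = (\<lambda>h. \<Sum>i\<in>UNIV. (\<chi> i. D (axis i 1)) $ i * h $ i)"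
    unfolding vec_lambda_beta using clinear_form_expand[of D, OF _ D(2)] by (intro ext) blast
  with D(1) show "\<exists>a::complex^'a. (f has_derivative (\<lambda>h. \<Sum>i\<in>UNIV. a $ i * h $ i)) (at z)"
    by metis
next
  assume "\<exists>a::complex^'a. (f has_derivative (\<lambda>h. \<Sum>i\<in>UNIV. a $ i * h $ i)) (at z)"
  then show "cdiff_at f z"
    unfolding cdiff_at_def by (force simp: sum_distrib_left algebra_simps)
qed

lemma holomorphic_germ_iff: "holomorphic_germ f \<longleftrightarrow> (\<forall>\<^sub>F z in nhds 0. cdiff_at f z)"
  unfolding holomorphic_germ_def holomorphic_fun_on_def eventually_nhds cdiff_at_iff by blast

lemma holomorphic_fun_on_iff: "holomorphic_fun_on f U \<longleftrightarrow> open U \<and> (\<forall>z\<in>U. cdiff_at f z)"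
  unfolding holomorphic_fun_on_def cdiff_at_iff by blast

lemma cdiff_at_const [simp]: "cdiff_at (\<lambda>z. c) z"
  by (rule cdiff_atI[where D="\<lambda>h. 0"]) auto

lemma cdiff_at_nth [simp]: "cdiff_at (\<lambda>z. z $ i) z"
  by (rule cdiff_atI[where D="\<lambda>h. h $ i"])
     (auto intro!: bounded_linear_imp_has_derivative bounded_linear_vec_nth)

lemma cdiff_at_add: "cdiff_at f z \<Longrightarrow> cdiff_at g z \<Longrightarrow> cdiff_at (\<lambda>z. f z + g z) z"
  unfolding cdiff_at_def
  by (elim exE conjE, rule exI, rule conjI, erule (1) has_derivative_add) (simp add: algebra_simps)

lemma cdiff_at_mult: "cdiff_at f z \<Longrightarrow> cdiff_at g z \<Longrightarrow> cdiff_at (\<lambda>z. f z * g z) z"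
  unfolding cdiff_at_def
  by (elim exE conjE, rule exI, rule conjI, erule (1) has_derivative_mult) (simp add: algebra_simps)

lemma cdiff_at_uminus: "cdiff_at f z \<Longrightarrow> cdiff_at (\<lambda>z. - f z) z"
  using cdiff_at_mult[of "\<lambda>z. -1" z f] by simp

lemma cdiff_at_diff: "cdiff_at f z \<Longrightarrow> cdiff_at g z \<Longrightarrow> cdiff_at (\<lambda>z. f z - g z) z"
  using cdiff_at_add[of f z "\<lambda>z. - g z"] cdiff_at_uminus[of g z] by simp

lemma cdiff_at_power: "cdiff_at f z \<Longrightarrow> cdiff_at (\<lambda>z. f z ^ k) z"
  by (induction k) (auto intro: cdiff_at_mult)

lemma has_derivative_vecI:
  fixes F :: "'a::euclidean_space \<Rightarrow> complex^'b::finite"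
  assumes "\<And>j. ((\<lambda>z. F z $ j) has_derivative (\<lambda>h. D h $ j)) (at z within S)"
  shows "(F has_derivative D) (at z within S)"
proof -
  have lin: "linear (\<lambda>h. D h $ j)" for j using assms by (rule has_derivative_linear)
  have "linear D"
    by (rule linearI; simp add: vec_eq_iff linear_add[OF lin] linear_scale[OF lin])
  then have bl: "bounded_linear D" by (simp add: linear_conv_bounded_linear)
  show ?thesis
    unfolding has_derivative_def
  proof (rule conjI[OF bl], rule vec_tendstoI)
    fix j
    have "((\<lambda>y. ((F y $ j - F (Lim (at z within S) (\<lambda>x. x)) $ j) - D (y - Lim (at z within S) (\<lambda>x. x)) $ j)
            /\<^sub>R norm (y - Lim (at z within S) (\<lambda>x. x))) \<longlongrightarrow> 0) (at z within S)"
      using assms[of j] unfolding has_derivative_def by auto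
    then show "((\<lambda>y. (((F y - F (Lim (at z within S) (\<lambda>x. x))) - D (y - Lim (at z within S) (\<lambda>x. x)))
            /\<^sub>R norm (y - Lim (at z within S) (\<lambda>x. x))) $ j) \<longlongrightarrow> 0 $ j) (at z within S)"
      by simp
  qed
qed

lemma cdiff_at_map:
  fixes G :: "complex^'a::finite \<Rightarrow> complex^'b::finite"
  assumes "\<And>j. cdiff_at (\<lambda>z. G z $ j) z"
  shows "\<exists>D. (G has_derivative D) (at z) \<and> (\<forall>c h. D (c *s h) = c *s D h)"
proof -
  obtain D where D: "\<And>j. ((\<lambda>z. G z $ j) has_derivative D j) (at z)"
      "\<And>j c h. D j (c *s h) = c * D j h"
    using assms unfolding cdiff_at_def by metis
  have "(G has_derivative (\<lambda>h. \<chi> j. D j h)) (at z)"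
    by (rule has_derivative_vecI) (use D(1) in simp)
  moreover have "(\<lambda>h. \<chi> j. D j h) (c *s h) = c *s (\<lambda>h. \<chi> j. D j h) h" for c h
    by (simp add: vec_eq_iff D(2))
  ultimately show ?thesis by blast
qed

lemma cdiff_at_compose:
  fixes G :: "complex^'a::finite \<Rightarrow> complex^'b::finite"
  assumes "cdiff_at f (G z)" "\<And>j. cdiff_at (\<lambda>z. G z $ j) z"
  shows "cdiff_at (\<lambda>z. f (G z)) z"
proof -
  obtain D where D: "(G has_derivative D) (at z)" "\<And>c h. D (c *s h) = c *s D h"
    using cdiff_at_map[OF assms(2)] by blast
  obtain E where E: "(f has_derivative E) (at (G z))" "\<And>c h. E (c *s h) = c * E h"
    using assms(1) unfolding cdiff_at_def by blast
  show ?thesis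
    by (rule cdiff_atI[OF has_derivative_compose[OF D(1) E(1)]]) (simp add: D E)
qed

lemma cdiff_at_inverse:
  assumes "cdiff_at f z" "f z \<noteq> 0"
  shows "cdiff_at (\<lambda>z. inverse (f z)) z"
proof -
  obtain D where D: "(f has_derivative D) (at z)" "\<And>c h. D (c *s h) = c * D h"
    using assms(1) unfolding cdiff_at_def by blast
  show ?thesis
    by (rule cdiff_atI[OF Deriv.has_derivative_inverse[OF assms(2) D(1)]]) (simp add: D)
qed

lemma cdiff_at_divide:
  "cdiff_at f z \<Longrightarrow> cdiff_at g z \<Longrightarrow> g z \<noteq> 0 \<Longrightarrow> cdiff_at (\<lambda>z. f z / g z) z"
  unfolding divide_inverse by (intro cdiff_at_mult cdiff_at_inverse)

lemma cdiff_at_isCont: "cdiff_at f z \<Longrightarrow> isCont f z"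
  unfolding cdiff_at_def using has_derivative_continuous by blast

lemma cdiff_at_cong_ev:
  assumes "\<forall>\<^sub>F x in nhds z. f x = g x"
  shows "cdiff_at f z \<longleftrightarrow> cdiff_at g z"
proof -
  obtain S where S: "open S" "z \<in> S" "\<And>x. x \<in> S \<Longrightarrow> f x = g x"
    using assms unfolding eventually_nhds by blast
  have "(f has_derivative D) (at z) \<longleftrightarrow> (g has_derivative D) (at z)" for D
    using has_derivative_transform_within_open[OF _ S(1,2), of f D UNIV g]
      has_derivative_transform_within_open[OF _ S(1,2), of g D UNIV f] S(3) by auto
  then show ?thesis unfolding cdiff_at_def by simp
qed

text \<open>Bridge to one variable: along a coordinatewise differentiable curve the derivative is
  multiplication by one complex number, so one-variable function theory applies to restrictions of
  germs.\<close>

lemma cdiff_at_curve: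
  fixes c :: "complex \<Rightarrow> complex^'b::finite"
  assumes "cdiff_at f (c t)" "\<And>j. (\<lambda>t. c t $ j) field_differentiable (at t)"
  shows "(\<lambda>t. f (c t)) field_differentiable (at t)"
proof -
  obtain E where E: "(f has_derivative E) (at (c t))" "\<And>c h. E (c *s h) = c * E h"
    using assms(1) unfolding cdiff_at_def by blast
  obtain d where d: "\<And>j. ((\<lambda>t. c t $ j) has_field_derivative d j) (at t)"
    using assms(2) unfolding field_differentiable_def by metis
  have "(c has_derivative (\<lambda>h. h *s (\<chi> j. d j))) (at t)"
    by (rule has_derivative_vecI) (use d in \<open>simp add: has_field_derivative_def mult_commute_abs\<close>)
  from has_derivative_compose[OF this E(1)]
  have "((\<lambda>t. f (c t)) has_derivative (\<lambda>h. E (\<chi> j. d j) * h)) (at t)"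
    by (simp add: E(2) mult.commute)
  then show ?thesis unfolding field_differentiable_def has_field_derivative_def by blast
qed

subsection \<open>Germs of maps and of curves\<close>

definition hol_map :: "(complex^'a::finite \<Rightarrow> complex^'b::finite) \<Rightarrow> bool" where
  "hol_map F \<longleftrightarrow> (\<forall>j. holomorphic_germ (\<lambda>z. F z $ j))"

definition hol_curve :: "(complex \<Rightarrow> complex^'b::finite) \<Rightarrow> bool" where
  "hol_curve c \<longleftrightarrow> (\<forall>j. (\<lambda>t. c t $ j) analytic_on {0})"

lemma analytic_0_iff: "f analytic_on {0} \<longleftrightarrow> (\<forall>\<^sub>F t in nhds 0. f field_differentiable at t)"
proof
  assume "f analytic_on {0}"
  then obtain S where "open S" "0 \<in> S" "f holomorphic_on S" by (auto simp: analytic_at)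
  then show "\<forall>\<^sub>F t in nhds 0. f field_differentiable at t"
    unfolding eventually_nhds using holomorphic_on_imp_differentiable_at by blast
next
  assume "\<forall>\<^sub>F t in nhds 0. f field_differentiable at t"
  then obtain S where "open S" "0 \<in> S" "\<And>t. t \<in> S \<Longrightarrow> f field_differentiable at t"
    unfolding eventually_nhds by blast
  then show "f analytic_on {0}"
    unfolding analytic_at by (meson field_differentiable_at_within holomorphic_on_def)
qed

lemma hol_mapD: "hol_map F \<Longrightarrow> \<forall>\<^sub>F z in nhds 0. \<forall>j. cdiff_at (\<lambda>z. F z $ j) z"
  unfolding hol_map_def holomorphic_germ_iff by (simp add: eventually_all_finite)

lemma hol_mapI: "(\<And>j. holomorphic_germ (\<lambda>z. F z $ j)) \<Longrightarrow> hol_map F"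
  unfolding hol_map_def by blast

lemma hol_curveD: "hol_curve F \<Longrightarrow> \<forall>\<^sub>F z in nhds 0. \<forall>j. (\<lambda>z. F z $ j) field_differentiable at z"
  unfolding hol_curve_def analytic_0_iff by (simp add: eventually_all_finite)

lemma isCont_vecI:
  fixes F :: "'c::t2_space \<Rightarrow> complex^'b::finite"
  assumes "\<And>j. isCont (\<lambda>z. F z $ j) z" shows "isCont F z"
  unfolding isCont_def by (rule vec_tendstoI) (use assms in \<open>simp add: isCont_def\<close>)

lemma isCont_0_filterlim:
  fixes F :: "'a::t2_space \<Rightarrow> 'b::t1_space"
  shows "isCont F z \<Longrightarrow> F z = w \<Longrightarrow> filterlim F (nhds w) (nhds z)"
  by (simp add: isCont_def tendsto_nhds_iff)

lemma hol_map_isCont: "hol_map F \<Longrightarrow> isCont F 0"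
  by (rule isCont_vecI) (use hol_mapD eventually_nhds_x_imp_x cdiff_at_isCont in blast)

lemma hol_curve_isCont: "hol_curve F \<Longrightarrow> isCont F 0"
  by (rule isCont_vecI)
     (use hol_curveD eventually_nhds_x_imp_x field_differentiable_imp_continuous_at in blast)

lemma hol_map_lim: "hol_map F \<Longrightarrow> F 0 = 0 \<Longrightarrow> filterlim F (nhds 0) (nhds 0)"
  by (rule isCont_0_filterlim[OF hol_map_isCont])

lemma hol_curve_lim: "hol_curve F \<Longrightarrow> F 0 = 0 \<Longrightarrow> filterlim F (nhds 0) (nhds 0)"
  by (rule isCont_0_filterlim[OF hol_curve_isCont])

text \<open>Substitution rule for germs: what holds near 0 still holds after composition with a germ
  fixing 0. Full neighbourhoods \<open>nhds 0\<close> are used because the inner map may take the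
  value 0 away from 0.\<close>

lemma eventually_hol_map:
  "hol_map F \<Longrightarrow> F 0 = 0 \<Longrightarrow> \<forall>\<^sub>F x in nhds 0. P x \<Longrightarrow> \<forall>\<^sub>F x in nhds 0. P (F x)"
  using hol_map_lim unfolding filterlim_iff by blast

lemma eventually_hol_curve:
  "hol_curve F \<Longrightarrow> F 0 = 0 \<Longrightarrow> \<forall>\<^sub>F x in nhds 0. P x \<Longrightarrow> \<forall>\<^sub>F x in nhds 0. P (F x)"
  using hol_curve_lim unfolding filterlim_iff by blast

named_theorems hol_intros

lemma hg_const [hol_intros]: "holomorphic_germ (\<lambda>z. c)"
  and hg_nth [hol_intros]: "holomorphic_germ (\<lambda>z. z $ i)"
  by (simp_all add: holomorphic_germ_iff)

lemma hg_add [hol_intros]: "holomorphic_germ f \<Longrightarrow> holomorphic_germ g \<Longrightarrow> holomorphic_germ (\<lambda>z. f z + g z)"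
  unfolding holomorphic_germ_iff by (erule (1) eventually_elim2) (rule cdiff_at_add)

lemma hg_diff [hol_intros]: "holomorphic_germ f \<Longrightarrow> holomorphic_germ g \<Longrightarrow> holomorphic_germ (\<lambda>z. f z - g z)"
  unfolding holomorphic_germ_iff by (erule (1) eventually_elim2) (rule cdiff_at_diff)

lemma hg_mult [hol_intros]: "holomorphic_germ f \<Longrightarrow> holomorphic_germ g \<Longrightarrow> holomorphic_germ (\<lambda>z. f z * g z)"
  unfolding holomorphic_germ_iff by (erule (1) eventually_elim2) (rule cdiff_at_mult)

lemma hg_power [hol_intros]: "holomorphic_germ f \<Longrightarrow> holomorphic_germ (\<lambda>z. f z ^ k)"
  unfolding holomorphic_germ_iff by (erule eventually_mono) (rule cdiff_at_power)

lemma hg_sum [hol_intros]: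
  "(\<And>i. i \<in> I \<Longrightarrow> holomorphic_germ (f i)) \<Longrightarrow> holomorphic_germ (\<lambda>z. \<Sum>i\<in>I. f i z)"
  by (induction I rule: infinite_finite_induct) (auto intro!: hol_intros)

lemma hg_prod [hol_intros]:
  "(\<And>i. i \<in> I \<Longrightarrow> holomorphic_germ (f i)) \<Longrightarrow> holomorphic_germ (\<lambda>z. \<Prod>i\<in>I. f i z)"
  by (induction I rule: infinite_finite_induct) (auto intro!: hol_intros)

lemma hg_isCont: "holomorphic_germ f \<Longrightarrow> isCont f 0"
  unfolding holomorphic_germ_iff using eventually_nhds_x_imp_x cdiff_at_isCont by blast

lemma hg_eventually_nonzero:
  assumes "holomorphic_germ f" "f 0 \<noteq> 0"
  shows "\<forall>\<^sub>F z in nhds 0. f z \<noteq> 0"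
proof -
  have "filterlim f (nhds (f 0)) (nhds 0)"
    by (rule isCont_0_filterlim[OF hg_isCont[OF assms(1)]]) simp
  then show ?thesis using assms(2) by (rule tendsto_imp_eventually_ne)
qed

lemma hg_divide [hol_intros]:
  assumes "holomorphic_germ f" "holomorphic_germ g" "g 0 \<noteq> 0"
  shows "holomorphic_germ (\<lambda>z. f z / g z)"
  using assms(1,2) hg_eventually_nonzero[OF assms(2,3)] unfolding holomorphic_germ_iff
  by eventually_elim (rule cdiff_at_divide)

lemma hg_compose:
  assumes "holomorphic_germ f" "hol_map G" "G 0 = 0"
  shows "holomorphic_germ (\<lambda>z. f (G z))"
  using hol_mapD[OF assms(2)] eventually_hol_map[OF assms(2,3) assms(1)[unfolded holomorphic_germ_iff]]
  unfolding holomorphic_germ_iff by eventually_elim (rule cdiff_at_compose; blast)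

lemma hol_map_compose:
  "hol_map F \<Longrightarrow> hol_map G \<Longrightarrow> G 0 = 0 \<Longrightarrow> hol_map (\<lambda>z. F (G z))"
  using hg_compose unfolding hol_map_def by blast

lemma hg_cong:
  assumes "\<forall>\<^sub>F z in nhds 0. f z = g z"
  shows "holomorphic_germ f \<longleftrightarrow> holomorphic_germ g"
proof -
  \<comment> \<open>Differentiability at a nearby \<open>z\<close> depends on a whole neighbourhood
    of \<open>z\<close>, so equality near 0 is first spread to neighbourhoods of all nearby
    points.\<close>
  have "\<forall>\<^sub>F z in nhds 0. \<forall>\<^sub>F x in nhds z. f x = g x"
    using assms by (simp add: eventually_eventually)
  then have "\<forall>\<^sub>F z in nhds 0. cdiff_at f z \<longleftrightarrow> cdiff_at g z"
    by eventually_elim (rule cdiff_at_cong_ev)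
  then show ?thesis unfolding holomorphic_germ_iff by (rule eventually_subst)
qed

lemma analytic_compose_curve:
  assumes "holomorphic_germ f" "hol_curve c" "c 0 = 0"
  shows "(\<lambda>t. f (c t)) analytic_on {0}"
  using hol_curveD[OF assms(2)] eventually_hol_curve[OF assms(2,3) assms(1)[unfolded holomorphic_germ_iff]]
  unfolding analytic_0_iff by eventually_elim (rule cdiff_at_curve; blast)

lemma hol_curve_compose:
  "hol_map F \<Longrightarrow> hol_curve c \<Longrightarrow> c 0 = 0 \<Longrightarrow> hol_curve (\<lambda>t. F (c t))"
  unfolding hol_map_def using analytic_compose_curve by (fastforce simp: hol_curve_def)

lemma hol_curve_line [simp]: "hol_curve (\<lambda>t. t *s u)"
  unfolding hol_curve_def by (auto intro!: analytic_intros)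

lemma hol_curve_reparam:
  assumes "hol_curve c" "f analytic_on {0}" "f 0 = 0"
  shows "hol_curve (\<lambda>t. c (f t))"
  unfolding hol_curve_def
proof
  fix j
  have "(\<lambda>t. c t $ j) analytic_on {0}" using assms(1) by (simp add: hol_curve_def)
  then have "((\<lambda>t. c t $ j) \<circ> f) analytic_on {0}"
    using assms by (intro analytic_on_compose) auto
  then show "(\<lambda>t. c (f t) $ j) analytic_on {0}" by (simp add: o_def)
qed

lemma hol_map_matrix: "hol_map F \<Longrightarrow> hol_map (\<lambda>z. A *v F z)"
  unfolding hol_map_def matrix_vector_mult_def by (auto intro!: hol_intros)

lemma hol_map_id: "hol_map (\<lambda>z. z)"
  by (auto intro!: hol_mapI hol_intros)

section \<open>Orders of vanishing and restriction to lines through the origin\<close>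

section \<open>Order of vanishing at the origin\<close>

text \<open>Big-O on full neighbourhoods: since \<open>0 ^ 0 = 1\<close>, order 0 means local
  boundedness, while a positive order forces the value 0 at the origin. Orders then add up in
  products without a special case at 0.\<close>

definition vanish :: "nat \<Rightarrow> ('a::real_normed_vector \<Rightarrow> 'b::real_normed_vector) \<Rightarrow> bool" where
  "vanish K f \<longleftrightarrow> (\<exists>C. \<forall>\<^sub>F s in nhds 0. norm (f s) \<le> C * norm s ^ K)"

lemma vanishI: "\<forall>\<^sub>F s in nhds 0. norm (f s) \<le> C * norm s ^ K \<Longrightarrow> vanish K f"
  unfolding vanish_def by blast

lemma vanishE:
  assumes "vanish K f"
  obtains C where "C > 0" "\<forall>\<^sub>F s in nhds 0. norm (f s) \<le> C * norm s ^ K"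
proof -
  obtain C where C: "\<forall>\<^sub>F s in nhds 0. norm (f s) \<le> C * norm s ^ K"
    using assms unfolding vanish_def by blast
  have "\<forall>\<^sub>F s in nhds 0. norm (f s) \<le> max C 1 * norm s ^ K"
    using C by eventually_elim (smt (verit) mult_right_mono norm_ge_zero zero_le_power)
  then show ?thesis by (intro that[of "max C 1"]) auto
qed

lemma vanish_cong:
  assumes "\<forall>\<^sub>F s in nhds 0. f s = g s" shows "vanish K f \<longleftrightarrow> vanish K g"
proof -
  have "vanish K g" if v: "vanish K f" and e: "\<forall>\<^sub>F s in nhds 0. f s = g s" for f g :: "'a \<Rightarrow> 'b"
  proof -
    obtain C where C: "\<forall>\<^sub>F s in nhds 0. norm (f s) \<le> C * norm s ^ K"
      using v unfolding vanish_def by blast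
    have "\<forall>\<^sub>F s in nhds 0. norm (g s) \<le> C * norm s ^ K"
      using C e by eventually_elim simp
    then show ?thesis by (rule vanishI)
  qed
  then show ?thesis using assms by (metis (mono_tags, lifting) eventually_mono)
qed

lemma vanish_zero [simp]: "vanish K (\<lambda>s. 0)"
  by (rule vanishI[of _ 0]) simp

lemma vanish_add: assumes "vanish K f" "vanish K g" shows "vanish K (\<lambda>s. f s + g s)"
proof -
  obtain C D where "\<forall>\<^sub>F s in nhds 0. norm (f s) \<le> C * norm s ^ K"
    "\<forall>\<^sub>F s in nhds 0. norm (g s) \<le> D * norm s ^ K"
    using assms unfolding vanish_def by blast
  then have "\<forall>\<^sub>F s in nhds 0. norm (f s + g s) \<le> (C + D) * norm s ^ K"
    by eventually_elim (smt (verit) distrib_right norm_triangle_ineq)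
  then show ?thesis by (rule vanishI)
qed

lemma vanish_minus: "vanish K f \<Longrightarrow> vanish K (\<lambda>s. - f s)"
  unfolding vanish_def by simp

lemma vanish_diff: "vanish K f \<Longrightarrow> vanish K g \<Longrightarrow> vanish K (\<lambda>s. f s - g s)"
  using vanish_add[of K f "\<lambda>s. - g s"] vanish_minus[of K g] by simp

lemma vanish_sum: "(\<And>i. i \<in> I \<Longrightarrow> vanish K (f i)) \<Longrightarrow> vanish K (\<lambda>s. \<Sum>i\<in>I. f i s)"
  by (induction I rule: infinite_finite_induct) (auto intro: vanish_add)

lemma vanish_mono: assumes "vanish L f" "K \<le> L" shows "vanish K f"
proof -
  obtain C where C: "C > 0" "\<forall>\<^sub>F s in nhds 0. norm (f s) \<le> C * norm s ^ L"
    using assms(1) by (rule vanishE)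
  have "\<forall>\<^sub>F s in nhds (0::'a). s \<in> ball 0 1" by (rule eventually_nhds_in_open) auto
  with C(2) have "\<forall>\<^sub>F s in nhds 0. norm (f s) \<le> C * norm s ^ K"
  proof eventually_elim
    case (elim s)
    have "norm s ^ L \<le> norm s ^ K" using elim(2) assms(2) by (intro power_decreasing) auto
    then show ?case using elim(1) C(1) by (smt (verit) mult_left_mono)
  qed
  then show ?thesis by (rule vanishI)
qed

lemma vanish_mult:
  fixes f g :: "'a::real_normed_vector \<Rightarrow> 'b::real_normed_algebra"
  assumes "vanish K f" "vanish L g" shows "vanish (K + L) (\<lambda>s. f s * g s)"
proof -
  obtain C where C: "C > 0" "\<forall>\<^sub>F s in nhds 0. norm (f s) \<le> C * norm s ^ K"
    using assms(1) by (rule vanishE)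
  obtain D where D: "D > 0" "\<forall>\<^sub>F s in nhds 0. norm (g s) \<le> D * norm s ^ L"
    using assms(2) by (rule vanishE)
  have "\<forall>\<^sub>F s in nhds 0. norm (f s * g s) \<le> (C * D) * norm s ^ (K + L)"
    using C(2) D(2)
  proof eventually_elim
    case (elim s)
    have "norm (f s * g s) \<le> norm (f s) * norm (g s)" by (rule norm_mult_ineq)
    also have "\<dots> \<le> (C * norm s ^ K) * (D * norm s ^ L)"
      using elim C(1) by (intro mult_mono) auto
    finally show ?case by (simp add: power_add algebra_simps)
  qed
  then show ?thesis by (rule vanishI)
qed

lemma norm_smult [simp]: "norm (c *s v) = cmod c * norm (v :: complex^'n::finite)"
  by (simp add: norm_vec_def norm_mult L2_set_right_distrib)

lemma vanish_smult:
  fixes f :: "'a::real_normed_vector \<Rightarrow> complex" and g :: "'a \<Rightarrow> complex^'n::finite"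
  assumes "vanish K f" "vanish L g" shows "vanish (K + L) (\<lambda>s. f s *s g s)"
proof -
  have "vanish (K + L) (\<lambda>s. complex_of_real (norm (f s)) * complex_of_real (norm (g s)))"
    by (rule vanish_mult) (use assms in \<open>simp_all add: vanish_def\<close>)
  then show ?thesis by (simp add: vanish_def norm_mult)
qed

lemma vanish_0_isCont: assumes "isCont f 0" shows "vanish 0 f"
proof -
  have "filterlim f (nhds (f 0)) (nhds 0)" using assms by (auto intro: isCont_0_filterlim)
  then have "\<forall>\<^sub>F s in nhds 0. dist (f s) (f 0) < 1" by (rule tendstoD) simp
  then have "\<forall>\<^sub>F s in nhds 0. norm (f s) \<le> (norm (f 0) + 1) * norm s ^ 0"
  proof eventually_elim
    case (elim s)
    then show ?case using norm_triangle_ineq[of "f s - f 0" "f 0"] by (simp add: dist_norm)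
  qed
  then show ?thesis by (rule vanishI)
qed

lemma vanish_0_const [simp]: "vanish 0 (\<lambda>s. c)" by (rule vanish_0_isCont) simp

lemma vanish_cmult: "vanish K f \<Longrightarrow> vanish K (\<lambda>s. c * f s :: 'b::real_normed_algebra)"
  using vanish_mult[OF vanish_0_const, of K f c] by simp

lemma vanish_mult0:
  fixes f g :: "'a::real_normed_vector \<Rightarrow> 'b::real_normed_algebra"
  shows "vanish K f \<Longrightarrow> vanish 0 g \<Longrightarrow> vanish K (\<lambda>s. f s * g s)"
  using vanish_mult[of K f 0 g] by simp

lemma vanish_id [simp]: "vanish (Suc 0) (\<lambda>s. s)"
  by (rule vanishI[of _ 1]) simp

lemma vanish_power: "vanish k (\<lambda>t::'a::real_normed_field. t ^ k)"
  by (rule vanishI[of _ 1]) (simp add: norm_power)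

lemma vanish_pow:
  fixes f :: "'a::real_normed_vector \<Rightarrow> 'b::{real_normed_algebra_1}"
  assumes "vanish K f" shows "vanish (k * K) (\<lambda>s. f s ^ k)"
  by (induction k) (use assms vanish_mult in auto)

lemma vanish_prod:
  fixes f :: "'i \<Rightarrow> 'a::real_normed_vector \<Rightarrow> 'b::{real_normed_algebra_1,comm_monoid_mult}"
  assumes "\<And>i. i \<in> I \<Longrightarrow> vanish (k i) (f i)"
  shows "vanish (\<Sum>i\<in>I. k i) (\<lambda>s. \<Prod>i\<in>I. f i s)"
  using assms by (induction I rule: infinite_finite_induct) (auto intro: vanish_mult)

lemma vanish_lim:
  fixes g :: "'a::real_normed_vector \<Rightarrow> 'b::real_normed_vector"
  assumes "vanish (Suc K) g" shows "filterlim g (nhds 0) (nhds 0)"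
proof -
  have "vanish 1 g" using assms by (rule vanish_mono) simp
  then obtain C where C: "\<forall>\<^sub>F s in nhds 0. norm (g s) \<le> C * norm s" unfolding vanish_def by auto
  have "filterlim (\<lambda>s::'a. norm s) (nhds 0) (nhds 0)"
    using isCont_0_filterlim[where F="\<lambda>s::'a. norm s" and z=0 and w=0] by (simp add: continuous_intros)
  then have "((\<lambda>s::'a. C * norm s) \<longlongrightarrow> 0) (nhds 0)" by (rule tendsto_mult_right_zero)
  then show ?thesis using C by (rule Lim_null_comparison[rotated])
qed

lemma vanish_compose: assumes "vanish K f" "vanish 1 g" shows "vanish K (\<lambda>s. f (g s))"
proof -
  obtain C where C: "C > 0" "\<forall>\<^sub>F s in nhds 0. norm (f s) \<le> C * norm s ^ K"
    using assms(1) by (rule vanishE)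
  obtain D where D: "D > 0" "\<forall>\<^sub>F s in nhds 0. norm (g s) \<le> D * norm s ^ 1"
    using assms(2) by (rule vanishE)
  have "\<forall>\<^sub>F s in nhds 0. norm (f (g s)) \<le> C * norm (g s) ^ K"
    using eventually_compose_filterlim[OF C(2) vanish_lim[of 0 g]] assms(2) by simp
  with D(2) have "\<forall>\<^sub>F s in nhds 0. norm (f (g s)) \<le> (C * D ^ K) * norm s ^ K"
  proof eventually_elim
    case (elim s)
    have "norm (g s) ^ K \<le> (D * norm s) ^ K" using elim(1) by (intro power_mono) auto
    then have "C * norm (g s) ^ K \<le> C * (D * norm s) ^ K" using C(1) by simp
    then show ?case using elim(2) by (simp add: power_mult_distrib algebra_simps)
  qed
  then show ?thesis by (rule vanishI)
qed

lemma vanish_vec_iff: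
  fixes F :: "'a::real_normed_vector \<Rightarrow> complex^'n::finite"
  shows "vanish K F \<longleftrightarrow> (\<forall>j. vanish K (\<lambda>s. F s $ j))"
proof
  assume "vanish K F"
  then obtain C where C: "\<forall>\<^sub>F s in nhds 0. norm (F s) \<le> C * norm s ^ K" unfolding vanish_def by blast
  have "\<forall>\<^sub>F s in nhds 0. norm (F s $ j) \<le> C * norm s ^ K" for j
    using C by eventually_elim (meson Finite_Cartesian_Product.norm_nth_le order_trans)
  then show "\<forall>j. vanish K (\<lambda>s. F s $ j)" by (blast intro: vanishI)
next
  assume "\<forall>j. vanish K (\<lambda>s. F s $ j)"
  then obtain C where C: "\<And>j. \<forall>\<^sub>F s in nhds 0. norm (F s $ j) \<le> C j * norm s ^ K"
    unfolding vanish_def by metis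
  then have "\<forall>\<^sub>F s in nhds 0. \<forall>j. norm (F s $ j) \<le> C j * norm s ^ K" by (simp add: eventually_all_finite)
  then have "\<forall>\<^sub>F s in nhds 0. norm (F s) \<le> (\<Sum>j\<in>UNIV. C j) * norm s ^ K"
  proof eventually_elim
    case (elim s)
    have "norm (F s) \<le> (\<Sum>j\<in>UNIV. norm (F s $ j))"
      unfolding norm_vec_def by (rule L2_set_le_sum) simp
    also have "\<dots> \<le> (\<Sum>j\<in>UNIV. C j * norm s ^ K)" using elim by (intro sum_mono) auto
    finally show ?case by (simp add: sum_distrib_right)
  qed
  then show "vanish K F" by (rule vanishI)
qed

lemma vanish_1_cdiff: assumes "cdiff_at f 0" "f 0 = 0" shows "vanish 1 f"
proof -
  obtain D where D: "(f has_derivative D) (at 0)" using assms(1) unfolding cdiff_at_def by blast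
  then obtain d where d: "d > 0" "\<And>y. norm y < d \<Longrightarrow> norm (f y - D y) \<le> 1 * norm y"
    unfolding has_derivative_at_alt using assms(2) by (metis diff_zero zero_less_one)
  obtain B where B: "\<And>y. norm (D y) \<le> norm y * B"
    using bounded_linear.bounded[OF has_derivative_bounded_linear[OF D]] by blast
  have "\<forall>\<^sub>F y in nhds 0. y \<in> ball 0 d" by (rule eventually_nhds_in_open) (use d in auto)
  then have "\<forall>\<^sub>F y in nhds 0. norm (f y) \<le> (1 + B) * norm y ^ 1"
  proof eventually_elim
    case (elim y)
    have "norm (f y) \<le> norm (f y - D y) + norm (D y)" by (metis diff_add_cancel norm_triangle_ineq)
    also have "\<dots> \<le> 1 * norm y + norm y * B" using d(2)[of y] B[of y] elim by simp
    finally show ?case by (simp add: algebra_simps)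
  qed
  then show ?thesis by (rule vanishI)
qed

lemma vanish_1_hol_map: assumes "hol_map F" "F 0 = 0" shows "vanish 1 F"
  unfolding vanish_vec_iff
proof
  fix j
  have "cdiff_at (\<lambda>z. F z $ j) 0"
    using hol_mapD[OF assms(1)] eventually_nhds_x_imp_x by blast
  then show "vanish 1 (\<lambda>s. F s $ j)" by (rule vanish_1_cdiff) (simp add: assms)
qed

lemma vanish_0_hg: "holomorphic_germ f \<Longrightarrow> vanish 0 f"
  by (rule vanish_0_isCont[OF hg_isCont])

subsection \<open>One variable\<close>

lemma analytic_has_fps: "f analytic_on {0} \<Longrightarrow> f has_fps_expansion fps_expansion f 0"
  unfolding analytic_at by (auto intro: has_fps_expansion_fps_expansion)

text \<open>The expansion is divisible by \<open>fps_X ^ K\<close>; the shifted series still has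
  positive radius of convergence, and its sum is the cofactor. Its value at 0 is the first
  coefficient that may survive.\<close>

lemma analytic_factor:
  assumes "f analytic_on {0}" "\<And>d. d < K \<Longrightarrow> (deriv ^^ d) f 0 = 0"
  shows "\<exists>g. g analytic_on {0} \<and> (\<forall>\<^sub>F t in nhds 0. f t = t ^ K * g t) \<and> g 0 = (deriv ^^ K) f 0 / fact K"
proof -
  define F where "F = fps_expansion f 0"
  define G where "G = fps_shift K F"
  have fF: "f has_fps_expansion F" unfolding F_def by (rule analytic_has_fps[OF assms(1)])
  have "fps_nth F d = 0" if "d < K" for d
    using assms(2)[OF that] by (simp add: F_def fps_expansion_def)
  then have FG: "F = fps_X ^ K * G"
    unfolding G_def by (intro fps_ext) (simp add: fps_X_power_mult_nth)
  have "fps_conv_radius F > 0" using fF by (simp add: has_fps_expansion_def)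
  then have "fps_conv_radius G > 0" unfolding G_def by simp
  then have gG: "eval_fps G has_fps_expansion G" by (rule eval_fps_has_fps_expansion)
  have "(\<lambda>t. t ^ K * eval_fps G t) has_fps_expansion fps_X ^ K * G"
    by (intro has_fps_expansion_mult gG has_fps_expansion_power has_fps_expansion_fps_X)
  then have "(\<lambda>t. f t - t ^ K * eval_fps G t) has_fps_expansion F - F"
    using fF FG by (intro has_fps_expansion_diff) auto
  then have "\<forall>\<^sub>F t in nhds 0. f t - t ^ K * eval_fps G t = 0"
    by (simp add: has_fps_expansion_0_iff)
  then have 1: "\<forall>\<^sub>F t in nhds 0. f t = t ^ K * eval_fps G t" by simp
  have 2: "eval_fps G analytic_on {0}" using gG by (rule has_fps_expansion_imp_analytic_0)
  have "eval_fps G 0 = fps_nth G 0" by (simp add: eval_fps_at_0)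
  then have "eval_fps G 0 = (deriv ^^ K) f 0 / fact K" by (simp add: G_def F_def fps_expansion_def)
  with 1 2 show ?thesis by blast
qed

lemma analytic_isCont: "f analytic_on {0::complex} \<Longrightarrow> isCont f 0"
  by (simp add: analytic_at_imp_isCont)

text \<open>To get the derivatives from the bound, the coefficients are killed one after another: if
  those below \<open>d\<close> are zero, then f = t^d g, and a bound of order d + 1 makes g(t) tend
  to 0, hence \<open>g 0 = 0\<close>.\<close>

lemma vanish_analytic_iff:
  assumes "f analytic_on {0}"
  shows "vanish K f \<longleftrightarrow> (\<forall>d<K. (deriv ^^ d) f 0 = 0)"
proof
  assume "\<forall>d<K. (deriv ^^ d) f 0 = 0"
  then obtain g where g: "g analytic_on {0}" "\<forall>\<^sub>F t in nhds 0. f t = t ^ K * g t"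
    using analytic_factor[OF assms] by blast
  have "vanish 0 g" using g(1) by (intro vanish_0_isCont analytic_isCont)
  then show "vanish K f"
    using vanish_mult0[OF vanish_power] vanish_cong[OF g(2)] by blast
next
  assume v: "vanish K f"
  show "\<forall>d<K. (deriv ^^ d) f 0 = 0"
  proof (intro allI impI)
    fix d assume "d < K"
    then show "(deriv ^^ d) f 0 = 0"
    proof (induction d rule: less_induct)
      case (less d)
      then obtain g where g: "g analytic_on {0}" "\<forall>\<^sub>F t in nhds 0. f t = t ^ d * g t"
          "g 0 = (deriv ^^ d) f 0 / fact d"
        using analytic_factor[OF assms, of d] by (meson order.strict_trans)
      have "vanish (Suc d) f" using v less.prems by (auto intro: vanish_mono)
      then obtain C where "\<forall>\<^sub>F t in nhds 0. norm (f t) \<le> C * norm t ^ Suc d"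
        unfolding vanish_def by blast
      with g(2) have "\<forall>\<^sub>F t in nhds 0. t \<noteq> 0 \<longrightarrow> norm (g t) \<le> C * norm t"
        by eventually_elim (auto simp: norm_mult norm_power field_simps)
      then have "\<forall>\<^sub>F t in at 0. norm (g t) \<le> C * norm t" by (simp add: eventually_at_filter)
      moreover have "((\<lambda>t::complex. C * norm t) \<longlongrightarrow> 0) (at 0)"
        by (auto intro!: tendsto_eq_intros)
      ultimately have "(g \<longlongrightarrow> 0) (at 0)" by (rule Lim_null_comparison)
      moreover have "(g \<longlongrightarrow> g 0) (at 0)" using analytic_isCont[OF g(1)] by (simp add: isCont_def)
      ultimately have "g 0 = 0" using tendsto_unique trivial_limit_at by blast
      then show ?case using g(3) by simp
    qed
  qed
qed

lemma analytic_flat_zero: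
  assumes "f analytic_on {0}" "\<And>K. vanish K f" shows "\<forall>\<^sub>F t in nhds 0. f t = 0"
proof -
  have z: "(deriv ^^ n) f 0 = 0" for n using vanish_analytic_iff[OF assms(1)] assms(2) lessI by blast
  obtain e where e: "e > 0" "f holomorphic_on ball 0 e" using assms(1) by (auto simp: analytic_at_ball)
  have "\<forall>\<^sub>F t in nhds 0. t \<in> ball 0 e" by (rule eventually_nhds_in_open) (use e in auto)
  then show ?thesis by eventually_elim (use holomorphic_fun_eq_0_on_ball[OF e(2) _ z] in auto)
qed

lemma higher_deriv_power_0:
  "(deriv ^^ d) (\<lambda>t::complex. c * t ^ k) 0 = (if d = k then c * fact k else 0)"
proof -
  have "(\<lambda>t::complex. c * t ^ k) has_fps_expansion fps_const c * fps_X ^ k"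
    by (intro has_fps_expansion_mult has_fps_expansion_power has_fps_expansion_fps_X has_fps_expansion_const)
  then have "fps_nth (fps_const c * fps_X ^ k) d = (deriv ^^ d) (\<lambda>t. c * t ^ k) 0 / fact d"
    by (rule fps_nth_fps_expansion)
  then show ?thesis by (auto simp: fps_X_power_nth field_simps split: if_splits)
qed

lemma vanish_monomial_zero: "vanish (Suc k) (\<lambda>t::complex. c * t ^ k) \<Longrightarrow> c = 0"
  by (subst (asm) vanish_analytic_iff) (auto intro!: analytic_intros simp: higher_deriv_power_0)

lemma analytic_leading_term:
  assumes "f analytic_on {0}" "vanish K f"
  shows "vanish (Suc K) (\<lambda>t. f t - (deriv ^^ K) f 0 / fact K * t ^ K)"
proof -
  have an: "(\<lambda>t. (deriv ^^ K) f 0 / fact K * t ^ K) analytic_on {0}" by (auto intro!: analytic_intros)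
  show ?thesis
  proof (subst vanish_analytic_iff)
    show "(\<lambda>t. f t - (deriv ^^ K) f 0 / fact K * t ^ K) analytic_on {0}"
      by (intro analytic_intros assms)
    show "\<forall>d<Suc K. (deriv ^^ d) (\<lambda>t. f t - (deriv ^^ K) f 0 / fact K * t ^ K) 0 = 0"
      using assms(2) unfolding vanish_analytic_iff[OF assms(1)] higher_deriv_diff_at[OF assms(1) an]
        higher_deriv_power_0 by (auto simp: less_Suc_eq)
  qed
qed

lemma vanish_deriv_eq:
  assumes "f analytic_on {0}" "g analytic_on {0}" "vanish (Suc K) (\<lambda>t. f t - g t)"
  shows "(deriv ^^ K) f 0 = (deriv ^^ K) g 0"
proof -
  have "(\<lambda>t. f t - g t) analytic_on {0}" by (intro analytic_intros assms)
  then have "(deriv ^^ K) (\<lambda>t. f t - g t) 0 = 0" using assms(3) vanish_analytic_iff by blast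
  then show ?thesis using higher_deriv_diff_at[OF assms(1,2)] by simp
qed

subsection \<open>Homogeneous components\<close>

text \<open>The coefficient of degree d is the homogeneous part of degree d of \<open>f\<close>,
  evaluated at \<open>s\<close>. Series in several variables are thus replaced by series in one
  variable that depend on a point.\<close>

definition jet :: "(complex^'a::finite \<Rightarrow> complex) \<Rightarrow> complex^'a \<Rightarrow> complex fps" where
  "jet f s = fps_expansion (\<lambda>t. f (t *s s)) 0"

lemma analytic_line: "holomorphic_germ f \<Longrightarrow> (\<lambda>t. f (t *s s)) analytic_on {0}"
  by (rule analytic_compose_curve) auto

lemma jet_expansion: "holomorphic_germ f \<Longrightarrow> (\<lambda>t. f (t *s s)) has_fps_expansion jet f s"
  unfolding jet_def by (rule analytic_has_fps[OF analytic_line])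

lemma jetI: "(\<lambda>t. f (t *s s)) has_fps_expansion F \<Longrightarrow> jet f s = F"
  unfolding jet_def by (rule fps_expansion_eqI)

lemma jet_const: "jet (\<lambda>z. c) s = fps_const c"
  by (rule jetI) (rule has_fps_expansion_const)

lemma jet_add: "holomorphic_germ f \<Longrightarrow> holomorphic_germ g \<Longrightarrow> jet (\<lambda>z. f z + g z) s = jet f s + jet g s"
  by (rule jetI) (intro has_fps_expansion_add jet_expansion)

lemma jet_diff: "holomorphic_germ f \<Longrightarrow> holomorphic_germ g \<Longrightarrow> jet (\<lambda>z. f z - g z) s = jet f s - jet g s"
  by (rule jetI) (intro has_fps_expansion_diff jet_expansion)

lemma jet_mult: "holomorphic_germ f \<Longrightarrow> holomorphic_germ g \<Longrightarrow> jet (\<lambda>z. f z * g z) s = jet f s * jet g s"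
  by (rule jetI) (intro has_fps_expansion_mult jet_expansion)

lemma jet_power: "holomorphic_germ f \<Longrightarrow> jet (\<lambda>z. f z ^ k) s = jet f s ^ k"
  by (rule jetI) (intro has_fps_expansion_power jet_expansion)

lemma jet_sum: "(\<And>i. i \<in> I \<Longrightarrow> holomorphic_germ (f i)) \<Longrightarrow> jet (\<lambda>z. \<Sum>i\<in>I. f i z) s = (\<Sum>i\<in>I. jet (f i) s)"
proof (induction I rule: infinite_finite_induct)
  case (insert x F)
  then show ?case by (simp add: jet_add hg_sum)
qed (use jet_const[of 0] in auto)

lemma jet_nth: "fps_nth (jet f s) d = (deriv ^^ d) (\<lambda>t. f (t *s s)) 0 / fact d"
  by (simp add: jet_def fps_expansion_def)

lemma vanish_line: "vanish 1 (\<lambda>t::complex. t *s (s::complex^'a::finite))"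
  by (rule vanishI[of _ "norm s"]) simp

lemma vanish_jet:
  assumes "holomorphic_germ f" "vanish K f" "d < K" shows "fps_nth (jet f s) d = 0"
proof -
  have "vanish K (\<lambda>t. f (t *s s))" using assms(2) vanish_line by (rule vanish_compose)
  then show ?thesis using vanish_analytic_iff[OF analytic_line[OF assms(1)]] assms(3) by (simp add: jet_nth)
qed

text \<open>A ball is star-shaped: for \<open>s\<close> in it the restriction of \<open>f\<close> to
  the line through \<open>s\<close> is holomorphic on a disc that contains 1, and the identity
  theorem on that disc gives f(s) = 0.\<close>

lemma jet_all_zero:
  assumes "holomorphic_germ f" "\<And>s d. fps_nth (jet f s) d = 0"
  shows "\<forall>\<^sub>F s in nhds 0. f s = 0"
proof -
  obtain U where U: "open U" "0 \<in> U" "\<And>z. z \<in> U \<Longrightarrow> cdiff_at f z"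
    using assms(1) unfolding holomorphic_germ_iff eventually_nhds by blast
  then obtain r where r: "r > 0" "ball 0 r \<subseteq> U" using open_contains_ball_eq by blast
  have "f s = 0" if s: "s \<in> ball 0 r" for s
  proof (cases "s = 0")
    case True
    have "f (0 *s s) = 0" using assms(2)[of s 0] by (simp add: jet_nth)
    then show ?thesis using True by simp
  next
    case False
    let ?g = "\<lambda>t::complex. f (t *s s)"
    have "?g holomorphic_on ball 0 (r / norm s)"
      unfolding holomorphic_on_def
    proof
      fix t :: complex assume "t \<in> ball 0 (r / norm s)"
      then have "cmod t < r / norm s" by simp
      then have "cmod t * norm s < r" using False by (simp add: pos_less_divide_eq)
      then have "t *s s \<in> ball 0 r" by simp
      then have "cdiff_at f (t *s s)" using U(3) r(2) by blast
      moreover have "(\<lambda>t. t * s $ j) field_differentiable at t" for j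
        by (rule field_differentiable_mult[OF field_differentiable_ident field_differentiable_const])
      ultimately have "?g field_differentiable at t"
        using cdiff_at_curve[where c="\<lambda>t. t *s s" and f=f and t=t] by simp
      then show "?g field_differentiable at t within ball 0 (r / norm s)"
        by (rule field_differentiable_at_within)
    qed
    moreover have "(1::complex) \<in> ball 0 (r / norm s)" using s False by (simp add: field_simps)
    moreover have "(deriv ^^ n) ?g 0 = 0" for n using assms(2)[of s n] by (simp add: jet_nth)
    ultimately have "?g 1 = 0" by (rule holomorphic_fun_eq_0_on_ball)
    then show ?thesis by simp
  qed
  then show ?thesis unfolding eventually_nhds using r(1) by (metis centre_in_ball open_ball)
qed

lemma vanish_cong_imp: "vanish K f \<Longrightarrow> \<forall>\<^sub>F s in nhds 0. f s = g s \<Longrightarrow> vanish K g"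
  using vanish_cong by blast

lemma norm_axis_complex [simp]: "norm (axis i c :: complex^'a::finite) = cmod c"
  by (simp add: norm_eq_sqrt_inner inner_axis_axis)

section \<open>Local inverses and exact division of holomorphic germs\<close>

section \<open>Partial derivatives and the inverse function theorem\<close>

definition pd :: "(complex^'a::finite \<Rightarrow> complex) \<Rightarrow> 'a \<Rightarrow> complex^'a \<Rightarrow> complex" where
  "pd f i z = deriv (\<lambda>\<zeta>. f (z + \<zeta> *s axis i 1)) 0"

lemma has_derivative_affine_line:
  "((\<lambda>\<zeta>::complex. z + \<zeta> *s (v::complex^'a::finite)) has_derivative (\<lambda>h. h *s v)) (at \<zeta>0)"
proof (rule has_derivative_vecI)
  fix j
  have "((\<lambda>\<zeta>::complex. z $ j + \<zeta> * v $ j) has_derivative (\<lambda>h. h * v $ j)) (at \<zeta>0)"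
    by (auto intro!: derivative_eq_intros)
  then show "((\<lambda>\<zeta>. (z + \<zeta> *s v) $ j) has_derivative (\<lambda>h. (h *s v) $ j)) (at \<zeta>0)" by simp
qed

lemma field_differentiable_affine_line:
  assumes "cdiff_at f (z + t *s v)"
  shows "(\<lambda>\<zeta>. f (z + \<zeta> *s v)) field_differentiable (at t)"
proof -
  obtain E where E: "(f has_derivative E) (at (z + t *s v))" "\<And>c h. E (c *s h) = c * E h"
    using assms unfolding cdiff_at_def by blast
  from has_derivative_compose[OF has_derivative_affine_line E(1)]
  have "((\<lambda>\<zeta>. f (z + \<zeta> *s v)) has_derivative (\<lambda>h. E v * h)) (at t)"
    by (simp add: E(2) mult.commute)
  then show ?thesis unfolding field_differentiable_def has_field_derivative_def by blast
qed

lemma has_derivative_pd: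
  assumes "cdiff_at f z"
  shows "(f has_derivative (\<lambda>h. \<Sum>i\<in>UNIV. pd f i z * h $ i)) (at z)"
proof -
  obtain a where a: "(f has_derivative (\<lambda>h. \<Sum>i\<in>UNIV. a $ i * h $ i)) (at z)"
    using assms unfolding cdiff_at_iff by blast
  have "pd f i z = a $ i" for i
  proof -
    have a': "(f has_derivative (\<lambda>h. \<Sum>i\<in>UNIV. a $ i * h $ i)) (at (z + 0 *s axis i 1))"
      using a by simp
    have "((\<lambda>\<zeta>. f (z + \<zeta> *s axis i 1)) has_derivative (\<lambda>h. \<Sum>k\<in>UNIV. a $ k * (h *s axis i 1) $ k)) (at 0)"
      using has_derivative_compose[OF has_derivative_affine_line a'] .
    moreover have "(\<lambda>h. \<Sum>k\<in>UNIV. a $ k * (h *s axis i 1) $ k) = (*) (a $ i)"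
    proof
      fix h
      have "(\<Sum>k\<in>UNIV. a $ k * (h *s axis i 1) $ k) = (\<Sum>k\<in>UNIV. if k = i then a $ i * h else 0)"
        by (rule sum.cong) (auto simp: axis_def)
      then show "(\<Sum>k\<in>UNIV. a $ k * (h *s axis i 1) $ k) = a $ i * h" by simp
    qed
    ultimately have "((\<lambda>\<zeta>. f (z + \<zeta> *s axis i 1)) has_field_derivative a $ i) (at 0)"
      by (simp add: has_field_derivative_def)
    then show ?thesis unfolding pd_def by (rule DERIV_imp_deriv)
  qed
  then show ?thesis using a by simp
qed

text \<open>Continuity of the derivative is not part of the definition of holomorphy. Uniform
  continuity on a compact ball makes the slices of \<open>f\<close> along a coordinate axis converge
  uniformly as the base point moves, and derivatives of holomorphic functions follow uniform
  limits.\<close>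

lemma continuous_on_pd:
  assumes U: "open U" and f: "\<And>z. z \<in> U \<Longrightarrow> cdiff_at f z"
  shows "continuous_on U (pd f i)"
proof (rule continuous_at_imp_continuous_on, rule ballI)
  fix z0 assume "z0 \<in> U"
  then obtain e where e: "e > 0" "cball z0 e \<subseteq> U" using U open_contains_cball by blast
  \<comment> \<open>Half of \<open>e\<close> is reserved for the base point and half for the
    displacement along the axis.\<close>
  define r where "r = e / 2"
  have r: "r > 0" using e by (simp add: r_def)
  let ?e = "axis i 1 :: complex^'a"
  have ne: "norm ?e = 1" by simp
  have inU: "z + \<zeta> *s ?e \<in> cball z0 e" if "dist z z0 < r" "\<zeta> \<in> ball 0 r" for z \<zeta>
  proof -
    have "norm (z0 - (z + \<zeta> *s ?e)) \<le> norm (z0 - z) + norm (\<zeta> *s ?e)"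
      using norm_triangle_ineq4[of "z0 - z" "\<zeta> *s ?e"] by (simp add: algebra_simps)
    then show ?thesis using that ne by (simp add: dist_norm norm_minus_commute r_def)
  qed
  have near: "\<forall>\<^sub>F z in at z0. dist z z0 < r" using r by (auto simp: eventually_at)
  have "continuous_on (cball z0 e) f"
    using e(2) f cdiff_at_isCont continuous_at_imp_continuous_on by (metis subsetD)
  then have uc: "uniformly_continuous_on (cball z0 e) f" by (simp add: compact_uniformly_continuous)
  have "((\<lambda>z. (deriv ^^ 1) (\<lambda>\<zeta>. f (z + \<zeta> *s ?e)) 0) \<longlongrightarrow> (deriv ^^ 1) (\<lambda>\<zeta>. f (z0 + \<zeta> *s ?e)) 0) (at z0)"
  proof (rule higher_deriv_complex_uniform_limit[where A="ball 0 r"])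
    show "uniform_limit (ball 0 r) (\<lambda>z \<zeta>. f (z + \<zeta> *s ?e)) (\<lambda>\<zeta>. f (z0 + \<zeta> *s ?e)) (at z0)"
    proof (rule uniform_limitI)
      fix \<epsilon> :: real assume "\<epsilon> > 0"
      then obtain d where d: "d > 0" "\<And>x y. x \<in> cball z0 e \<Longrightarrow> y \<in> cball z0 e \<Longrightarrow> dist x y < d \<Longrightarrow> dist (f x) (f y) < \<epsilon>"
        using uc unfolding uniformly_continuous_on_def by metis
      have "\<forall>\<^sub>F z in at z0. dist z z0 < d" using d by (auto simp: eventually_at)
      with near show "\<forall>\<^sub>F z in at z0. \<forall>\<zeta>\<in>ball 0 r. dist (f (z + \<zeta> *s ?e)) (f (z0 + \<zeta> *s ?e)) < \<epsilon>"
      proof eventually_elim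
        case (elim z)
        show ?case
        proof
          fix \<zeta> :: complex assume "\<zeta> \<in> ball 0 r"
          then show "dist (f (z + \<zeta> *s ?e)) (f (z0 + \<zeta> *s ?e)) < \<epsilon>"
            using inU[OF elim(1)] inU[of z0] r elim(2) by (intro d(2)) auto
        qed
      qed
    qed
    show "\<forall>\<^sub>F z in at z0. (\<lambda>\<zeta>. f (z + \<zeta> *s ?e)) holomorphic_on ball 0 r"
      using near
    proof eventually_elim
      case (elim z)
      show ?case unfolding holomorphic_on_def
        using field_differentiable_affine_line[OF f] inU[OF elim] e(2) field_differentiable_at_within by blast
    qed
  qed (use r in auto)
  then show "isCont (pd f i) z0" by (simp add: isCont_def pd_def[abs_def])
qed

text \<open>The real inverse function theorem applies: \<open>vanish 2\<close> makes the derivative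
  at 0 the identity, and the derivative is continuous by \<open>continuous_on_pd\<close>. The
  inverse is holomorphic because a bijective complex-linear map has a complex-linear
  inverse.\<close>

theorem hol_map_local_inverse:
  fixes F :: "complex^'n::finite \<Rightarrow> complex^'n"
  assumes F: "hol_map F" and F0: "F 0 = 0" and v: "vanish 2 (\<lambda>s. F s - s)"
  obtains U V G where "open U" "open V" "0 \<in> U" "0 \<in> V" "homeomorphism U V F G"
    "holomorphic_map_on F U" "holomorphic_map_on G V" "G 0 = 0"
proof -
  obtain W where W: "open W" "0 \<in> W" "\<And>z j. z \<in> W \<Longrightarrow> cdiff_at (\<lambda>z. F z $ j) z"
    using hol_mapD[OF F] unfolding eventually_nhds by blast
  define D where "D = (\<lambda>x h. \<chi> j. \<Sum>i\<in>UNIV. pd (\<lambda>z. F z $ j) i x * h $ i)"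
  have D: "(F has_derivative D x) (at x)" if "x \<in> W" for x
    by (rule has_derivative_vecI) (use has_derivative_pd[OF W(3)[OF that]] in \<open>simp add: D_def\<close>)
  have Dc: "D x (c *s h) = c *s D x h" for x c h
    by (simp add: D_def vec_eq_iff sum_distrib_left algebra_simps)
  have bl: "bounded_linear (D x)" if "x \<in> W" for x using D[OF that] by (rule has_derivative_bounded_linear)
  define f' where "f' = (\<lambda>x. Blinfun (D x))"
  have f': "blinfun_apply (f' x) = D x" if "x \<in> W" for x
    unfolding f'_def by (rule bounded_linear_Blinfun_apply[OF bl[OF that]])
  have cont: "continuous_on W f'"
  proof (rule continuous_on_blinfun_componentwise)
    fix b :: "complex^'n" assume "b \<in> Basis"
    have "continuous_on W (\<lambda>x. D x b)"
      unfolding D_def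
      by (intro continuous_intros continuous_on_vec_lambda continuous_on_pd W)
    then show "continuous_on W (\<lambda>x. blinfun_apply (f' x) b)"
      by (rule continuous_on_cong[THEN iffD1, rotated -1]) (simp_all add: f')
  qed
  have "(F has_derivative (\<lambda>h. h)) (at 0)"
  proof -
    obtain C where C: "C > 0" "\<forall>\<^sub>F s in nhds 0. norm (F s - s) \<le> C * norm s ^ 2" using v by (rule vanishE)
    show ?thesis
      unfolding has_derivative_at_alt
    proof (intro conjI allI impI)
      fix e :: real assume e: "e > 0"
      have "\<forall>\<^sub>F s in nhds (0::complex^'n). s \<in> ball 0 (e / C)"
        by (rule eventually_nhds_in_open) (use e C in auto)
      with C(2) have "\<forall>\<^sub>F s in nhds 0. norm (F s - s) \<le> e * norm s"
      proof eventually_elim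
        case (elim s)
        have "C * norm s \<le> e" using elim(2) C(1) by (simp add: field_simps)
        then have "C * norm s * norm s \<le> e * norm s" by (intro mult_right_mono) auto
        then show ?case using elim(1) by (simp add: power2_eq_square)
      qed
      then show "\<exists>d>0. \<forall>y. norm (y - 0) < d \<longrightarrow> norm (F y - F 0 - (y - 0)) \<le> e * norm (y - 0)"
        unfolding eventually_nhds_metric by (auto simp: F0 dist_norm)
    qed simp
  qed
  then have D0: "D 0 = (\<lambda>h. h)" using D[OF W(2)] has_derivative_unique by blast
  have inv0: "id_blinfun o\<^sub>L f' 0 = id_blinfun"
    by (rule blinfun_eqI) (simp add: f'[OF W(2)] D0)
  have der: "(F has_derivative blinfun_apply (f' x)) (at x)" if "x \<in> W" for x using D f' that by simp
  obtain U V G g' where G: "open U" "U \<subseteq> W" "0 \<in> U" "open V" "F 0 \<in> V" "homeomorphism U V F G"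
    "\<And>y. y \<in> V \<Longrightarrow> (G has_derivative (g' y)) (at y)"
    "\<And>y. y \<in> V \<Longrightarrow> g' y = inv (blinfun_apply (f' (G y)))"
    "\<And>y. y \<in> V \<Longrightarrow> bij (blinfun_apply (f' (G y)))"
    using inverse_function_theorem[OF W(1) der cont W(2) inv0] by metis
  have GV: "cdiff_at (\<lambda>y. G y $ j) y" if y: "y \<in> V" for y j
  proof -
    have Gy: "G y \<in> W" using G(2,6) y by (auto simp: homeomorphism_def)
    have bij: "bij (D (G y))" and g': "g' y = inv (D (G y))" using G(8,9)[OF y] f'[OF Gy] by auto
    have "g' y (c *s h) = c *s g' y h" for c h
    proof -
      have "D (G y) (c *s g' y h) = c *s h" using Dc bij g' by (simp add: bij_is_surj surj_f_inv_f)
      then show ?thesis using bij g' by (metis bij_inv_eq_iff)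
    qed
    then show ?thesis
      using bounded_linear.has_derivative[OF bounded_linear_vec_nth G(7)[OF y], of j]
      by (intro cdiff_atI) auto
  qed
  show ?thesis
  proof (rule that[of U V G])
    show "holomorphic_map_on F U" "holomorphic_map_on G V"
      using G W GV unfolding holomorphic_map_on_def holomorphic_fun_on_iff by auto
    show "G 0 = 0" using G(3,6) F0 by (metis homeomorphism_apply1)
  qed (use G F0 in auto)
qed

lemma holomorphic_map_on_germ: "holomorphic_map_on F U \<Longrightarrow> 0 \<in> U \<Longrightarrow> hol_map F"
  unfolding holomorphic_map_on_def hol_map_def holomorphic_germ_def by blast

lemma hol_map_inverse_germ:
  fixes F :: "complex^'n::finite \<Rightarrow> complex^'n"
  assumes F: "hol_map F" and F0: "F 0 = 0" and v: "vanish 2 (\<lambda>s. F s - s)"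
  obtains G where "hol_map G" "G 0 = 0" "\<forall>\<^sub>F z in nhds 0. F (G z) = z" "\<forall>\<^sub>F z in nhds 0. G (F z) = z"
    "\<And>K. vanish K (\<lambda>s. F s - s) \<Longrightarrow> vanish K (\<lambda>s. G s - s)"
proof -
  obtain U V G where G: "open U" "open V" "0 \<in> U" "0 \<in> V" "homeomorphism U V F G"
    "holomorphic_map_on F U" "holomorphic_map_on G V" "G 0 = 0"
    using hol_map_local_inverse[OF assms] by blast
  have hG: "hol_map G" using holomorphic_map_on_germ G by blast
  have FG: "\<forall>\<^sub>F z in nhds 0. F (G z) = z"
    using eventually_nhds_in_open[OF G(2,4)] by eventually_elim (use G(5) in \<open>auto simp: homeomorphism_def\<close>)
  have GF: "\<forall>\<^sub>F z in nhds 0. G (F z) = z"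
    using eventually_nhds_in_open[OF G(1,3)] by eventually_elim (use G(5) in \<open>auto simp: homeomorphism_def\<close>)
  \<comment> \<open>Orders carry over because \<open>G s - s\<close> is minus the displacement F(z)
    - z at z = G(s).\<close>
  have "vanish K (\<lambda>s. G s - s)" if "vanish K (\<lambda>s. F s - s)" for K
  proof -
    have "vanish K (\<lambda>s. - (F (G s) - G s))"
      using vanish_compose[OF that vanish_1_hol_map[OF hG G(8)]] by (rule vanish_minus)
    moreover have "\<forall>\<^sub>F s in nhds 0. - (F (G s) - G s) = G s - s" using FG by eventually_elim simp
    ultimately show ?thesis by (rule vanish_cong_imp)
  qed
  with that hG G FG GF show ?thesis by blast
qed

section \<open>Division by a coordinate\<close>

definition upd :: "'a::finite \<Rightarrow> complex \<Rightarrow> complex^'a \<Rightarrow> complex^'a" where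
  "upd i c s = s + (c - s $ i) *s axis i 1"

lemma upd_nth: "upd i c s $ j = (if j = i then c else s $ j)"
  by (simp add: upd_def axis_def)

lemma upd_eq: "upd i c s = (\<chi> j. if j = i then c else s $ j)"
  by (simp add: vec_eq_iff upd_nth)

lemma norm_upd: "norm (upd i c s) \<le> 2 * norm s + cmod c"
proof -
  have "norm (upd i c s) \<le> norm s + norm ((c - s $ i) *s axis i 1 :: complex^'a)"
    unfolding upd_def by (rule norm_triangle_ineq)
  also have "norm ((c - s $ i) *s axis i 1 :: complex^'a) \<le> cmod c + norm s"
    using norm_triangle_ineq4[of c "s $ i"] Finite_Cartesian_Product.norm_nth_le[of s i]
    unfolding norm_smult norm_axis_complex norm_one by linarith
  finally show ?thesis by simp
qed

text \<open>Cauchy's formula in the i-th variable alone. With h the slice of \<open>f\<close>, the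
  difference h(w) - h(0) is a circle integral of h(c) (1/(c - w) - 1/c), which contains the factor
  w. The remaining integral is the quotient; differentiation under the integral sign makes it
  holomorphic in all variables.\<close>

theorem hg_divide_coordinate:
  assumes f: "holomorphic_germ f" and z: "\<forall>\<^sub>F s in nhds 0. s $ i = 0 \<longrightarrow> f s = 0"
  obtains g where "holomorphic_germ g" "\<forall>\<^sub>F s in nhds 0. f s = s $ i * g s"
proof -
  obtain S where S: "open S" "0 \<in> S" "\<And>s. s \<in> S \<Longrightarrow> cdiff_at f s"
    using f unfolding holomorphic_germ_iff eventually_nhds by blast
  obtain T where T: "open T" "0 \<in> T" "\<And>s. s \<in> T \<Longrightarrow> s $ i = 0 \<Longrightarrow> f s = 0"
    using z unfolding eventually_nhds by blast
  have "open (S \<inter> T)" "0 \<in> S \<inter> T" using S T by auto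
  then obtain R where R: "R > 0" "ball 0 R \<subseteq> S \<inter> T" using open_contains_ball_eq by blast
  \<comment> \<open>By \<open>norm_upd\<close>, a contribution below \<open>2 * r\<close> from the
    point and one below \<open>2 * r\<close> from the new coordinate stay within
    \<open>R\<close>.\<close>
  define r where "r = R / 4"
  have r: "r > 0" using R by (simp add: r_def)
  have upd_in: "upd i c s \<in> ball 0 R" if "s \<in> ball 0 r" "cmod c < 2 * r" for s c
    using norm_upd[of i c s] that by (simp add: r_def)
  define \<gamma> where "\<gamma> = (\<lambda>t::real. r * exp (2 * pi * \<i> * t))"
  have n\<gamma>: "cmod (\<gamma> t) = r" for t
    using r by (simp add: \<gamma>_def norm_mult norm_exp_eq_Re)
  have c\<gamma>: "continuous_on A (\<lambda>x. \<gamma> (h x))" if "continuous_on A h" for A h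
    unfolding \<gamma>_def by (intro continuous_intros that)
  have nz: "\<gamma> t - s $ i \<noteq> 0" if "s \<in> ball 0 r" for s t
  proof
    assume "\<gamma> t - s $ i = 0"
    then have "cmod (s $ i) = r" using n\<gamma>[of t] by simp
    then show False using that Finite_Cartesian_Product.norm_nth_le[of s i] by simp
  qed
  have in1: "upd i (\<gamma> t) s \<in> ball 0 R" if "s \<in> ball 0 r" for s t
    using upd_in[OF that] n\<gamma> r by simp
  define k where "k = (\<lambda>s t. f (upd i (\<gamma> t) s) / (\<gamma> t - s $ i))"
  define g where "g = (\<lambda>s. integral (cbox 0 1) (k s))"
  \<comment> \<open>The partial derivatives of the integrand \<open>k\<close>. The i-th one sees
    only the denominator, because \<open>upd\<close> has overwritten the coordinate
    \<open>s $ i\<close> in the argument of \<open>f\<close>.\<close>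
  define p where "p = (\<lambda>j s t. if j = i then f (upd i (\<gamma> t) s) / (\<gamma> t - s $ i)\<^sup>2
     else pd f j (upd i (\<gamma> t) s) / (\<gamma> t - s $ i))"
  have cf: "continuous_on (ball 0 R) f"
    using R(2) S(3) cdiff_at_isCont continuous_at_imp_continuous_on by (metis IntD1 subsetD)
  have cpd: "continuous_on (ball 0 R) (pd f j)" for j
    by (rule continuous_on_pd) (use R(2) S(3) in auto)
  have cupd: "continuous_on (ball 0 r \<times> cbox 0 1) (\<lambda>x. upd i (\<gamma> (snd x)) (fst x))"
    unfolding upd_eq
  proof (rule continuous_on_vec_lambda)
    show "continuous_on (ball 0 r \<times> cbox 0 1) (\<lambda>x. if j = i then \<gamma> (snd x) else fst x $ j)" for j
      by (cases "j = i") (auto intro!: continuous_intros c\<gamma>)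
  qed
  have cden: "continuous_on (ball 0 r \<times> cbox 0 1) (\<lambda>x. \<gamma> (snd x) - fst x $ i)"
    by (intro continuous_intros c\<gamma>)
  have cfu: "continuous_on (ball 0 r \<times> cbox 0 1) (\<lambda>x. f (upd i (\<gamma> (snd x)) (fst x)))"
    by (rule continuous_on_compose2[OF cf cupd]) (use in1 in auto)
  have cpu: "continuous_on (ball 0 r \<times> cbox 0 1) (\<lambda>x. pd f j (upd i (\<gamma> (snd x)) (fst x)))" for j
    by (rule continuous_on_compose2[OF cpd cupd]) (use in1 in auto)
  have cp: "continuous_on (ball 0 r \<times> cbox 0 1) (\<lambda>x. p j (fst x) (snd x))" for j
  proof (cases "j = i")
    case True
    show ?thesis unfolding p_def if_P[OF True]
      by (intro continuous_on_divide continuous_on_power cden cfu) (use nz in auto)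
  next
    case False
    show ?thesis unfolding p_def if_not_P[OF False]
      by (intro continuous_on_divide cden cpu) (use nz in auto)
  qed
  have ck: "continuous_on (ball 0 r \<times> cbox 0 1) (\<lambda>x. k (fst x) (snd x))"
    unfolding k_def by (intro continuous_on_divide cden cfu) (use nz in auto)
  have ck1: "continuous_on (cbox 0 1) (k s)" if "s \<in> ball 0 r" for s
  proof -
    have "continuous_on (cbox 0 1) (\<lambda>t. k (fst (s, t)) (snd (s, t)))"
      by (rule continuous_on_compose2[OF ck]) (use that in \<open>auto intro!: continuous_intros\<close>)
    then show ?thesis by simp
  qed
  define D where "D = (\<lambda>s t h. \<Sum>j\<in>UNIV. p j s t * h $ j)"
  have bl: "bounded_linear (D s t)" for s t
    unfolding D_def
    by (intro bounded_linear_sum bounded_linear_compose[OF bounded_linear_mult_right] bounded_linear_vec_nth)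
  have derk: "((\<lambda>s. k s t) has_derivative D s t) (at s)" if s: "s \<in> ball 0 r" for s t
  proof -
    have u: "((\<lambda>s. upd i (\<gamma> t) s) has_derivative (\<lambda>h. upd i 0 h)) (at s)"
    proof (rule has_derivative_vecI)
      fix j
      show "((\<lambda>s. upd i (\<gamma> t) s $ j) has_derivative (\<lambda>h. upd i 0 h $ j)) (at s)"
        by (cases "j = i") (auto simp: upd_nth intro!: bounded_linear_imp_has_derivative bounded_linear_vec_nth)
    qed
    have f1: "(f has_derivative (\<lambda>h. \<Sum>j\<in>UNIV. pd f j (upd i (\<gamma> t) s) * h $ j)) (at (upd i (\<gamma> t) s))"
      by (rule has_derivative_pd) (use in1[OF s] R(2) S(3) in blast)
    have d: "((\<lambda>s. \<gamma> t - s $ i) has_derivative (\<lambda>h. - h $ i)) (at s)"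
      by (auto intro!: derivative_eq_intros bounded_linear_imp_has_derivative bounded_linear_vec_nth)
    have "((\<lambda>s. k s t) has_derivative (\<lambda>h. - f (upd i (\<gamma> t) s) * (inverse (\<gamma> t - s $ i) * (- h $ i) * inverse (\<gamma> t - s $ i))
        + (\<Sum>j\<in>UNIV. pd f j (upd i (\<gamma> t) s) * upd i 0 h $ j) / (\<gamma> t - s $ i))) (at s)"
      unfolding k_def by (rule has_derivative_divide[OF has_derivative_compose[OF u f1] d nz[OF s]])
    moreover have "- f (upd i (\<gamma> t) s) * (inverse (\<gamma> t - s $ i) * (- h $ i) * inverse (\<gamma> t - s $ i))
        + (\<Sum>j\<in>UNIV. pd f j (upd i (\<gamma> t) s) * upd i 0 h $ j) / (\<gamma> t - s $ i) = D s t h" for h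
    proof -
      have "D s t h = p i s t * h $ i + (\<Sum>j\<in>UNIV - {i}. p j s t * h $ j)"
        unfolding D_def by (subst sum.remove[of UNIV i]) auto
      also have "(\<Sum>j\<in>UNIV - {i}. p j s t * h $ j) = (\<Sum>j\<in>UNIV - {i}. pd f j (upd i (\<gamma> t) s) * upd i 0 h $ j / (\<gamma> t - s $ i))"
        by (rule sum.cong) (auto simp: p_def upd_nth)
      also have "\<dots> = (\<Sum>j\<in>UNIV. pd f j (upd i (\<gamma> t) s) * upd i 0 h $ j / (\<gamma> t - s $ i))"
        by (rule sum.mono_neutral_left) (auto simp: upd_nth)
      finally show ?thesis
        unfolding sum_divide_distrib[symmetric]
        by (simp add: p_def power2_eq_square divide_inverse mult_ac)
    qed
    ultimately show ?thesis by (rule has_derivative_eq_rhs[OF _ ext])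
  qed
  have cB: "continuous_on (ball 0 r \<times> cbox 0 1) (\<lambda>(s, t). Blinfun (D s t))"
  proof (rule continuous_on_blinfun_componentwise)
    fix b :: "complex^'a"
    have "continuous_on (ball 0 r \<times> cbox 0 1) (\<lambda>x. D (fst x) (snd x) b)"
      unfolding D_def by (intro continuous_intros cp)
    then show "continuous_on (ball 0 r \<times> cbox 0 1) (\<lambda>x. blinfun_apply (case x of (s, t) \<Rightarrow> Blinfun (D s t)) b)"
      by (simp add: case_prod_unfold bounded_linear_Blinfun_apply[OF bl])
  qed
  have cg: "cdiff_at g s" if s: "s \<in> ball 0 r" for s
  proof -
    have B: "(g has_derivative blinfun_apply (integral (cbox 0 1) (\<lambda>t. Blinfun (D s t)))) (at s within ball 0 r)"
      unfolding g_def
    proof (rule leibniz_rule[where fx="\<lambda>s t. Blinfun (D s t)"])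
      show "((\<lambda>s. k s t) has_derivative blinfun_apply (Blinfun (D x t))) (at x within ball 0 r)"
        if "x \<in> ball 0 r" for x t
        using derk[OF that] by (simp add: bounded_linear_Blinfun_apply[OF bl] has_derivative_at_withinI)
      show "k x integrable_on cbox 0 1" if "x \<in> ball 0 r" for x
        by (rule integrable_continuous[OF ck1[OF that]])
      show "continuous_on (ball 0 r \<times> cbox 0 1) (\<lambda>(x, t). Blinfun (D x t))" by (rule cB)
    qed (use s in auto)
    then have B1: "(g has_derivative blinfun_apply (integral (cbox 0 1) (\<lambda>t. Blinfun (D s t)))) (at s)"
      using s by (simp add: at_within_open[OF s])
    have "continuous_on (cbox 0 1) (\<lambda>t. case (s, t) of (s, t) \<Rightarrow> Blinfun (D s t))"
      by (rule continuous_on_compose2[OF cB]) (use s in \<open>auto intro!: continuous_intros\<close>)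
    then have int: "(\<lambda>t. Blinfun (D s t)) integrable_on cbox 0 1"
      by (intro integrable_continuous) simp
    have ap: "blinfun_apply (integral (cbox 0 1) (\<lambda>t. Blinfun (D s t))) h = integral (cbox 0 1) (\<lambda>t. D s t h)" for h
      using blinfun_apply_integral[OF int, of h] by (simp add: bounded_linear_Blinfun_apply[OF bl])
    have Dc: "D s t (c *s h) = c * D s t h" for t c h
      by (simp add: D_def sum_distrib_left algebra_simps)
    show ?thesis
      by (rule cdiff_atI[OF B1]) (simp only: ap Dc integral_mult_right)
  qed
  have eq: "f s = s $ i * g s" if s: "s \<in> ball 0 r" for s
  proof -
    let ?h = "\<lambda>c. f (upd i c s)"
    have "?h holomorphic_on ball 0 (2 * r)"
      unfolding holomorphic_on_def
    proof
      fix c :: complex assume "c \<in> ball 0 (2 * r)"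
      then have "cdiff_at f (upd i c s)" using upd_in[OF s, of c] R(2) S(3) by auto
      moreover have "upd i c s = (s - s $ i *s axis i 1) + c *s axis i 1" for c
        by (simp add: upd_def vec_eq_iff algebra_simps)
      ultimately have "?h field_differentiable at c"
        using field_differentiable_affine_line[of f "s - s $ i *s axis i 1" c "axis i 1"] by simp
      then show "?h field_differentiable at c within ball 0 (2 * r)" by (rule field_differentiable_at_within)
    qed
    then have hol: "?h holomorphic_on cball 0 r" by (rule holomorphic_on_subset) (use r in auto)
    have I: "((\<lambda>t. ?h (\<gamma> t) / (\<gamma> t - w) * (2 * pi * \<i> * \<gamma> t)) has_integral (2 * pi * \<i> * ?h w)) (cbox 0 1)"
      if w: "cmod w < r" for w
    proof -
      have "((\<lambda>u. ?h u / (u - w)) has_contour_integral (2 * of_real pi * \<i> * ?h w)) (circlepath 0 r)"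
        by (rule Cauchy_integral_circlepath_simple[OF hol]) (use w in simp)
      then have "((\<lambda>t. ?h (circlepath 0 r t) / (circlepath 0 r t - w) * vector_derivative (circlepath 0 r) (at t within {0..1}))
          has_integral (2 * of_real pi * \<i> * ?h w)) {0..1}"
        by (simp add: has_contour_integral_def)
      moreover have "?h (circlepath 0 r t) / (circlepath 0 r t - w) * vector_derivative (circlepath 0 r) (at t within {0..1})
          = ?h (\<gamma> t) / (\<gamma> t - w) * (2 * pi * \<i> * \<gamma> t)" if "t \<in> {0..1}" for t
      proof -
        have "circlepath 0 r t = \<gamma> t" by (simp add: circlepath \<gamma>_def)
        moreover have "vector_derivative (circlepath 0 r) (at t within {0..1}) = 2 * pi * \<i> * \<gamma> t"
          using that by (simp add: vector_derivative_circlepath01 \<gamma>_def)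
        ultimately show ?thesis by simp
      qed
      ultimately have "((\<lambda>t. ?h (\<gamma> t) / (\<gamma> t - w) * (2 * pi * \<i> * \<gamma> t))
          has_integral (2 * of_real pi * \<i> * ?h w)) {0..1}"
        by (rule has_integral_eq[rotated])
      then show ?thesis by simp
    qed
    have w: "cmod (s $ i) < r" using s Finite_Cartesian_Product.norm_nth_le[of s i] by simp
    \<comment> \<open>Here the vanishing of \<open>f\<close> on the hyperplane enters: Cauchy's
      formula at 0 has value 0, and subtracting it from the one at \<open>s $ i\<close> brings out
      the factor \<open>s $ i\<close>.\<close>
    have "?h 0 = 0" using upd_in[OF s, of 0] r R(2) T(3) by (auto simp: upd_nth)
    then have "((\<lambda>t. ?h (\<gamma> t) / (\<gamma> t - s $ i) * (2 * pi * \<i> * \<gamma> t) - ?h (\<gamma> t) / (\<gamma> t - 0) * (2 * pi * \<i> * \<gamma> t))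
        has_integral (2 * pi * \<i> * ?h (s $ i) - 0)) (cbox 0 1)"
      using has_integral_diff[OF I[OF w] I[of 0]] r by simp
    moreover have "?h (\<gamma> t) / (\<gamma> t - s $ i) * (2 * pi * \<i> * \<gamma> t) - ?h (\<gamma> t) / (\<gamma> t - 0) * (2 * pi * \<i> * \<gamma> t)
        = (2 * pi * \<i> * s $ i) * k s t" for t
    proof -
      have "\<gamma> t \<noteq> 0" using n\<gamma>[of t] r by auto
      then show ?thesis using nz[OF s, of t] unfolding k_def by (simp add: field_simps)
    qed
    ultimately have 1: "((\<lambda>t. (2 * pi * \<i> * s $ i) * k s t) has_integral (2 * pi * \<i> * ?h (s $ i))) (cbox 0 1)"
      by simp
    have "((\<lambda>t. (2 * pi * \<i> * s $ i) * k s t) has_integral (2 * pi * \<i> * s $ i) * g s) (cbox 0 1)"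
      unfolding g_def by (intro has_integral_mult_right integrable_integral integrable_continuous ck1 s)
    then have "2 * pi * \<i> * ?h (s $ i) = (2 * pi * \<i> * s $ i) * g s" using 1 has_integral_unique by blast
    then have "?h (s $ i) = s $ i * g s" by simp
    moreover have "upd i (s $ i) s = s" by (simp add: upd_def)
    ultimately show ?thesis by simp
  qed
  have ev: "\<forall>\<^sub>F s in nhds 0. s \<in> ball (0::complex^'a) r" by (rule eventually_nhds_in_open) (use r in auto)
  show ?thesis
  proof (rule that)
    show "holomorphic_germ g" unfolding holomorphic_germ_iff using ev by eventually_elim (rule cg)
    show "\<forall>\<^sub>F s in nhds 0. f s = s $ i * g s" using ev by eventually_elim (rule eq)
  qed
qed

text \<open>Points with \<open>s $ i = 0\<close> are limits of points on a parallel to the i-th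
  axis, so continuity suffices. The condition \<open>Q\<close> has to be constant along that axis,
  so that the approaching points satisfy it as well.\<close>

lemma hg_cancel_coordinate:
  fixes f :: "complex^'a::finite \<Rightarrow> complex"
  assumes f: "holomorphic_germ f" and z: "\<forall>\<^sub>F s in nhds 0. s $ i \<noteq> 0 \<longrightarrow> Q s \<longrightarrow> f s = 0"
    and Q: "\<And>s t. Q s \<Longrightarrow> Q (s + t *s axis i 1)"
  shows "\<forall>\<^sub>F s in nhds 0. Q s \<longrightarrow> f s = 0"
proof -
  obtain U where U: "open U" "0 \<in> U"
     "\<And>s. s \<in> U \<Longrightarrow> cdiff_at f s" "\<And>s. s \<in> U \<Longrightarrow> s $ i \<noteq> 0 \<Longrightarrow> Q s \<Longrightarrow> f s = 0"
    using eventually_conj[OF f[unfolded holomorphic_germ_iff] z] unfolding eventually_nhds by blast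
  have "f s = 0" if s: "s \<in> U" "Q s" for s
  proof (cases "s $ i = 0")
    case False
    then show ?thesis using U(4) s by blast
  next
    case True
    let ?l = "\<lambda>t::complex. s + t *s axis i 1"
    have cl: "isCont ?l 0" by (rule has_derivative_continuous[OF has_derivative_affine_line])
    then have "(?l \<longlongrightarrow> s) (at 0)" by (simp add: isCont_def)
    then have "\<forall>\<^sub>F t in at 0. ?l t \<in> U" using U(1) s(1) by (simp add: topological_tendstoD)
    then have "\<forall>\<^sub>F t in at 0. f (?l t) = 0"
      unfolding eventually_at_filter
    proof eventually_elim
      case (elim t)
      show ?case
      proof (intro impI)
        assume "t \<noteq> 0"
        then show "f (?l t) = 0"
          using elim True Q[OF s(2), of t] by (intro U(4)) auto
      qed
    qed
    then have "((\<lambda>t. f (?l t)) \<longlongrightarrow> 0) (at 0)" by (rule tendsto_eventually)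
    moreover have "isCont (\<lambda>t. f (?l t)) 0"
      by (rule isCont_o2[OF cl]) (use U(3)[OF s(1)] cdiff_at_isCont in simp)
    then have "((\<lambda>t. f (?l t)) \<longlongrightarrow> f s) (at 0)" by (simp add: isCont_def)
    ultimately show ?thesis using tendsto_unique trivial_limit_at by blast
  qed
  then show ?thesis unfolding eventually_nhds using U(1,2) by blast
qed

lemma hg_cancel:
  assumes "holomorphic_germ f" "holomorphic_germ g" "\<forall>\<^sub>F s in nhds 0. s $ i ^ k * f s = s $ i ^ k * g s"
  shows "\<forall>\<^sub>F s in nhds 0. f s = g s"
proof -
  have "\<forall>\<^sub>F s in nhds 0. True \<longrightarrow> f s - g s = 0"
    by (rule hg_cancel_coordinate[where i=i]) (use assms in \<open>auto intro: hg_diff elim!: eventually_mono\<close>)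
  then show ?thesis by simp
qed

text \<open>Powers of different coordinates are coprime: on s_j = 0 the relation gives s_i^a f = 0,
  so \<open>f\<close> vanishes there and one factor s_j splits off. Induction on \<open>b\<close>
  repeats this.\<close>

theorem hg_divide_power:
  fixes f g :: "complex^'a::finite \<Rightarrow> complex"
  assumes "holomorphic_germ f" "holomorphic_germ g" "i \<noteq> j"
    "\<forall>\<^sub>F s in nhds 0. f s * s $ i ^ a = g s * s $ j ^ b"
  obtains h where "holomorphic_germ h" "\<forall>\<^sub>F s in nhds 0. f s = s $ j ^ b * h s"
proof -
  have "\<exists>h. holomorphic_germ h \<and> (\<forall>\<^sub>F s in nhds 0. f s = s $ j ^ b * h s)"
    using assms
  proof (induction b arbitrary: f)
    case 0
    then show ?case by auto
  next
    case (Suc b)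
    have "\<forall>\<^sub>F s in nhds 0. s $ j = 0 \<longrightarrow> f s = 0"
    proof (rule hg_cancel_coordinate[where i=i])
      show "\<forall>\<^sub>F s in nhds 0. s $ i \<noteq> 0 \<longrightarrow> s $ j = 0 \<longrightarrow> f s = 0"
        using Suc.prems(4) by eventually_elim auto
      show "(s + t *s axis i 1) $ j = 0" if "s $ j = 0" for s and t :: complex
        using that Suc.prems(3) by (simp add: axis_def)
    qed (fact Suc.prems)
    then obtain f1 where f1: "holomorphic_germ f1" "\<forall>\<^sub>F s in nhds 0. f s = s $ j * f1 s"
      using hg_divide_coordinate[OF Suc.prems(1)] by blast
    have "\<forall>\<^sub>F s in nhds 0. s $ j ^ 1 * (f1 s * s $ i ^ a) = s $ j ^ 1 * (g s * s $ j ^ b)"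
      using Suc.prems(4) f1(2) by eventually_elim (simp add: mult_ac)
    then have "\<forall>\<^sub>F s in nhds 0. f1 s * s $ i ^ a = g s * s $ j ^ b"
      by (rule hg_cancel[rotated 2]) (use f1 Suc.prems in \<open>auto intro!: hol_intros\<close>)
    then obtain h where "holomorphic_germ h" "\<forall>\<^sub>F s in nhds 0. f1 s = s $ j ^ b * h s"
      using Suc.IH[OF f1(1) Suc.prems(2,3)] by blast
    moreover from this(2) f1(2) have "\<forall>\<^sub>F s in nhds 0. f s = s $ j ^ Suc b * h s"
      by eventually_elim simp
    ultimately show ?case by blast
  qed
  then show ?thesis using that by blast
qed

section \<open>Homogeneous polynomials as Taylor coefficients of germs\<close>

section \<open>Homogeneous polynomials and Taylor expansion\<close>

lemma finite_mdeg_le: "finite {\<alpha>::'a::finite \<Rightarrow> nat. mdeg \<alpha> \<le> d}"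
proof -
  have "{\<alpha>::'a \<Rightarrow> nat. mdeg \<alpha> \<le> d} \<subseteq> PiE UNIV (\<lambda>_. {..d})"
  proof
    fix \<alpha> :: "'a \<Rightarrow> nat" assume "\<alpha> \<in> {\<alpha>. mdeg \<alpha> \<le> d}"
    moreover have "\<alpha> i \<le> mdeg \<alpha>" for i unfolding mdeg_def by (rule member_le_sum) auto
    ultimately show "\<alpha> \<in> PiE UNIV (\<lambda>_. {..d})" by (auto intro: order_trans)
  qed
  then show ?thesis by (rule finite_subset) (auto intro: finite_PiE)
qed

lemma finite_mdeg_eq [simp]: "finite {\<alpha>::'a::finite \<Rightarrow> nat. mdeg \<alpha> = d}"
  by (rule finite_subset[OF _ finite_mdeg_le[of d]]) auto

definition madd :: "('a \<Rightarrow> nat) \<Rightarrow> ('a \<Rightarrow> nat) \<Rightarrow> 'a \<Rightarrow> nat" where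
  "madd \<alpha> \<beta> = (\<lambda>i. \<alpha> i + \<beta> i)"

lemma mdeg_madd [simp]: "mdeg (madd \<alpha> \<beta>) = mdeg \<alpha> + mdeg \<beta>"
  by (simp add: mdeg_def madd_def sum.distrib)

lemma mpow_madd: "mpow s (madd \<alpha> \<beta>) = mpow s \<alpha> * mpow s \<beta>"
  by (simp add: mpow_def madd_def power_add prod.distrib)

lemma mdeg_0 [simp]: "mdeg (\<lambda>_. 0) = 0" and mpow_0 [simp]: "mpow s (\<lambda>_. 0) = 1"
  by (simp_all add: mdeg_def mpow_def)

lemma mdeg_0_iff: "mdeg \<alpha> = 0 \<longleftrightarrow> \<alpha> = (\<lambda>_. 0)"
  by (auto simp: mdeg_def)

definition msingle :: "'a \<Rightarrow> nat \<Rightarrow> 'a \<Rightarrow> nat" where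
  "msingle i k = (\<lambda>j. if j = i then k else 0)"

lemma mdeg_msingle [simp]: "mdeg (msingle (i::'a::finite) k) = k"
  by (simp add: mdeg_def msingle_def)

lemma mpow_msingle [simp]: "mpow s (msingle i k) = s $ i ^ k"
proof -
  have "mpow s (msingle i k) = (\<Prod>j\<in>UNIV. if j = i then s $ i ^ k else 1)"
    unfolding mpow_def msingle_def by (rule prod.cong) auto
  then show ?thesis by simp
qed

lemma mpow_scale: "mpow (t *s s) \<alpha> = t ^ mdeg \<alpha> * mpow s \<alpha>"
  by (simp add: mpow_def mdeg_def power_mult_distrib prod.distrib power_sum)

lemma hg_mpow [hol_intros]: "holomorphic_germ (\<lambda>s. mpow s \<alpha>)"
  unfolding mpow_def by (intro hol_intros)

lemma vanish_nth: "vanish (Suc 0) (\<lambda>s::complex^'a::finite. s $ i)"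
  using vanish_vec_iff[of "Suc 0" "\<lambda>s. s"] vanish_id by blast

lemma vanish_mpow_compose:
  fixes x :: "'c::real_normed_vector \<Rightarrow> complex^'a::finite"
  assumes "vanish 1 x" shows "vanish (mdeg \<alpha>) (\<lambda>s. mpow (x s) \<alpha>)"
  unfolding mpow_def mdeg_def
proof (rule vanish_prod)
  fix i
  have "vanish 1 (\<lambda>s. x s $ i)" using assms by (simp add: vanish_vec_iff)
  then show "vanish (\<alpha> i) (\<lambda>s. x s $ i ^ \<alpha> i)" using vanish_pow[of 1 _ "\<alpha> i"] by simp
qed

lemma vanish_mpow: "vanish (mdeg \<alpha>) (\<lambda>s. mpow s \<alpha>)"
  by (rule vanish_mpow_compose) simp

definition hpoly :: "nat \<Rightarrow> (complex^'a::finite \<Rightarrow> complex) \<Rightarrow> bool" where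
  "hpoly d P \<longleftrightarrow> (\<exists>c. \<forall>s. P s = (\<Sum>\<alpha>\<in>{\<alpha>. mdeg \<alpha> = d}. c \<alpha> * mpow s \<alpha>))"

lemma hpoly_zero: "hpoly d (\<lambda>s. 0)"
  unfolding hpoly_def by (rule exI[of _ "\<lambda>_. 0"]) simp

lemma hpoly_mpow: "mdeg \<alpha> = d \<Longrightarrow> hpoly d (\<lambda>s. mpow s \<alpha>)"
  unfolding hpoly_def by (rule exI[of _ "\<lambda>\<beta>. if \<beta> = \<alpha> then 1 else 0"]) (simp add: if_distrib[where f="\<lambda>x. x * _"] cong: if_cong)

lemma hpoly_add: "hpoly d P \<Longrightarrow> hpoly d Q \<Longrightarrow> hpoly d (\<lambda>s. P s + Q s)"
  unfolding hpoly_def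
proof (elim exE)
  fix c c' assume "\<forall>s. P s = (\<Sum>\<alpha>\<in>{\<alpha>. mdeg \<alpha> = d}. c \<alpha> * mpow s \<alpha>)" "\<forall>s. Q s = (\<Sum>\<alpha>\<in>{\<alpha>. mdeg \<alpha> = d}. c' \<alpha> * mpow s \<alpha>)"
  then show "\<exists>c. \<forall>s. P s + Q s = (\<Sum>\<alpha>\<in>{\<alpha>. mdeg \<alpha> = d}. c \<alpha> * mpow s \<alpha>)"
    by (intro exI[of _ "\<lambda>\<alpha>. c \<alpha> + c' \<alpha>"]) (simp add: sum.distrib algebra_simps)
qed

lemma hpoly_cmult: "hpoly d P \<Longrightarrow> hpoly d (\<lambda>s. c * P s)"
  unfolding hpoly_def
proof (elim exE)
  fix c' assume "\<forall>s. P s = (\<Sum>\<alpha>\<in>{\<alpha>. mdeg \<alpha> = d}. c' \<alpha> * mpow s \<alpha>)"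
  then show "\<exists>c'. \<forall>s. c * P s = (\<Sum>\<alpha>\<in>{\<alpha>. mdeg \<alpha> = d}. c' \<alpha> * mpow s \<alpha>)"
    by (intro exI[of _ "\<lambda>\<alpha>. c * c' \<alpha>"]) (simp add: sum_distrib_left algebra_simps)
qed

lemma hpoly_uminus: "hpoly d P \<Longrightarrow> hpoly d (\<lambda>s. - P s)"
  using hpoly_cmult[of d P "-1"] by simp

lemma hpoly_diff: "hpoly d P \<Longrightarrow> hpoly d Q \<Longrightarrow> hpoly d (\<lambda>s. P s - Q s)"
  using hpoly_add[OF _ hpoly_uminus, of d P Q] by simp

lemma hpoly_sum: "(\<And>i. i \<in> I \<Longrightarrow> hpoly d (P i)) \<Longrightarrow> hpoly d (\<lambda>s. \<Sum>i\<in>I. P i s)"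
  by (induction I rule: infinite_finite_induct) (auto intro: hpoly_zero hpoly_add)

lemma hpoly_mult: assumes "hpoly d P" "hpoly e Q" shows "hpoly (d + e) (\<lambda>s. P s * Q s)"
proof -
  obtain c c' where c: "\<And>s. P s = (\<Sum>\<alpha>\<in>{\<alpha>. mdeg \<alpha> = d}. c \<alpha> * mpow s \<alpha>)"
      "\<And>s. Q s = (\<Sum>\<beta>\<in>{\<beta>. mdeg \<beta> = e}. c' \<beta> * mpow s \<beta>)" using assms unfolding hpoly_def by blast
  have "P s * Q s = (\<Sum>\<alpha>\<in>{\<alpha>. mdeg \<alpha> = d}. \<Sum>\<beta>\<in>{\<beta>. mdeg \<beta> = e}. (c \<alpha> * c' \<beta>) * mpow s (madd \<alpha> \<beta>))" for s
    unfolding c sum_product by (intro sum.cong refl) (simp add: mpow_madd mult_ac)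
  moreover have "hpoly (d + e) (\<lambda>s. \<Sum>\<alpha>\<in>{\<alpha>. mdeg \<alpha> = d}. \<Sum>\<beta>\<in>{\<beta>. mdeg \<beta> = e}. (c \<alpha> * c' \<beta>) * mpow s (madd \<alpha> \<beta>))"
    by (intro hpoly_sum hpoly_cmult hpoly_mpow) simp
  ultimately show ?thesis by simp
qed

lemma hpoly_nth: "hpoly (Suc 0) (\<lambda>s. s $ i)"
  using hpoly_mpow[of "msingle i 1" "Suc 0"] by simp

lemma hpoly_const: "hpoly 0 (\<lambda>s. c)"
  using hpoly_cmult[OF hpoly_mpow[OF mdeg_0], of c] by simp

lemma hpoly_power: "hpoly d P \<Longrightarrow> hpoly (k * d) (\<lambda>s. P s ^ k)"
  by (induction k) (auto intro: hpoly_const hpoly_mult)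

lemma hpoly_scale: "hpoly d P \<Longrightarrow> P (t *s s) = t ^ d * P s"
  unfolding hpoly_def by (auto simp: mpow_scale sum_distrib_left mult_ac intro!: sum.cong)

lemma hpoly_hg: "hpoly d P \<Longrightarrow> holomorphic_germ P"
proof -
  assume "hpoly d P"
  then obtain c where "P = (\<lambda>s. \<Sum>\<alpha>\<in>{\<alpha>. mdeg \<alpha> = d}. c \<alpha> * mpow s \<alpha>)" unfolding hpoly_def by auto
  then show ?thesis by (simp add: hol_intros)
qed

lemma hpoly_vanish: "hpoly d P \<Longrightarrow> vanish d P"
proof -
  assume "hpoly d P"
  then obtain c where P: "P = (\<lambda>s. \<Sum>\<alpha>\<in>{\<alpha>. mdeg \<alpha> = d}. c \<alpha> * mpow s \<alpha>)" unfolding hpoly_def by auto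
  show ?thesis unfolding P by (intro vanish_sum vanish_cmult) (use vanish_mpow in auto)
qed

lemma jet_hpoly: assumes "hpoly d P" shows "jet P s = fps_const (P s) * fps_X ^ d"
proof (rule jetI)
  have "(\<lambda>t. P s * t ^ d) has_fps_expansion fps_const (P s) * fps_X ^ d"
    by (intro has_fps_expansion_mult has_fps_expansion_power has_fps_expansion_fps_X has_fps_expansion_const)
  then show "(\<lambda>t. P (t *s s)) has_fps_expansion fps_const (P s) * fps_X ^ d"
    by (simp add: hpoly_scale[OF assms] mult.commute)
qed

lemma hpoly_jet_nth: "hpoly d P \<Longrightarrow> fps_nth (jet P s) e = (if e = d then P s else 0)"
  by (simp add: jet_hpoly fps_X_power_mult_right_nth)

lemma hg_zeroing:
  assumes "holomorphic_germ f" shows "holomorphic_germ (\<lambda>s. f (\<chi> j. if j \<in> S then 0 else s $ j))"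
proof (rule hg_compose[OF assms])
  show "hol_map (\<lambda>s::complex^'a. \<chi> j. if j \<in> S then 0 else s $ j)"
  proof (rule hol_mapI)
    show "holomorphic_germ (\<lambda>s::complex^'a. (\<chi> j. if j \<in> S then 0 else s $ j) $ j)" for j
      by (cases "j \<in> S") (auto intro: hol_intros)
  qed
qed (simp add: vec_eq_iff)

text \<open>Setting the coordinates to zero one at a time telescopes f(s) - f(0); each difference
  vanishes on one coordinate hyperplane and is therefore divisible by that coordinate.\<close>

lemma hadamard:
  fixes f :: "complex^'a::finite \<Rightarrow> complex"
  assumes f: "holomorphic_germ f"
  obtains g where "\<And>i. holomorphic_germ (g i)" "\<forall>\<^sub>F s in nhds 0. f s = f 0 + (\<Sum>i\<in>UNIV. s $ i * g i s)"
proof -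
  let ?z = "\<lambda>S s. (\<chi> j. if j \<in> S then 0 else s $ j) :: complex^'a"
  have "\<exists>g. (\<forall>i. holomorphic_germ (g i)) \<and> (\<forall>\<^sub>F s in nhds 0. f s = f (?z S s) + (\<Sum>i\<in>S. s $ i * g i s))"
    for S :: "'a set"
    using finite[of S]
  proof (induction S rule: finite_induct)
    case empty
    have "?z {} s = s" for s by (simp add: vec_eq_iff)
    then show ?case by (intro exI[of _ "\<lambda>i s. 0"]) (auto intro: hol_intros)
  next
    case (insert k S)
    then obtain g where g: "\<And>i. holomorphic_germ (g i)"
      "\<forall>\<^sub>F s in nhds 0. f s = f (?z S s) + (\<Sum>i\<in>S. s $ i * g i s)" by blast
    have "holomorphic_germ (\<lambda>s. f (?z S s) - f (?z (insert k S) s))"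
      by (intro hol_intros hg_zeroing f)
    moreover have "\<forall>\<^sub>F s in nhds 0. s $ k = 0 \<longrightarrow> f (?z S s) - f (?z (insert k S) s) = 0"
    proof (rule always_eventually, intro allI impI)
      fix s :: "complex^'a" assume "s $ k = 0"
      then have "?z S s = ?z (insert k S) s" by (simp add: vec_eq_iff)
      then show "f (?z S s) - f (?z (insert k S) s) = 0" by simp
    qed
    ultimately obtain h where h: "holomorphic_germ h"
      "\<forall>\<^sub>F s in nhds 0. f (?z S s) - f (?z (insert k S) s) = s $ k * h s"
      by (rule hg_divide_coordinate)
    let ?g = "g(k := h)"
    have "\<forall>\<^sub>F s in nhds 0. f s = f (?z (insert k S) s) + (\<Sum>i\<in>insert k S. s $ i * ?g i s)"
      using g(2) h(2)
    proof eventually_elim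
      case (elim s)
      have "(\<Sum>i\<in>S. s $ i * ?g i s) = (\<Sum>i\<in>S. s $ i * g i s)"
        by (rule sum.cong) (use insert.hyps in auto)
      then show ?case using elim insert.hyps by (simp add: algebra_simps)
    qed
    moreover have "holomorphic_germ (?g i)" for i using g(1) h(1) by simp
    ultimately show ?case by blast
  qed
  from this[of UNIV] obtain g where g: "\<And>i. holomorphic_germ (g i)"
    "\<forall>\<^sub>F s in nhds 0. f s = f (?z UNIV s) + (\<Sum>i\<in>UNIV. s $ i * g i s)" by blast
  have z: "?z UNIV s = 0" for s by (simp add: vec_eq_iff)
  show ?thesis by (rule that[OF g(1) g(2)[unfolded z]])
qed

lemma jet_cong: assumes "\<forall>\<^sub>F s in nhds 0. f s = g s" shows "jet f s = jet g s"
proof -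
  have "filterlim (\<lambda>t. t *s s) (nhds 0) (nhds 0)" by (rule hol_curve_lim) auto
  from eventually_compose_filterlim[OF assms this]
  show ?thesis unfolding jet_def by (intro fps_expansion_cong) simp
qed

lemma jet_hadamard:
  assumes "holomorphic_germ f" "\<And>i. holomorphic_germ (g i)"
    "\<forall>\<^sub>F s in nhds 0. f s = f 0 + (\<Sum>i\<in>UNIV. s $ i * g i s)"
  shows "fps_nth (jet f s) (Suc d) = (\<Sum>i\<in>UNIV. s $ i * fps_nth (jet (g i) s) d)"
proof -
  have "jet f s = jet (\<lambda>s. f 0 + (\<Sum>i\<in>UNIV. s $ i * g i s)) s" by (rule jet_cong[OF assms(3)])
  also have "\<dots> = fps_const (f 0) + (\<Sum>i\<in>UNIV. jet (\<lambda>s. s $ i) s * jet (g i) s)"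
    using assms(2) by (simp add: jet_add jet_sum jet_mult jet_const hol_intros)
  also have "\<dots> = fps_const (f 0) + (\<Sum>i\<in>UNIV. fps_const (s $ i) * (fps_X * jet (g i) s))"
    by (simp add: jet_hpoly[OF hpoly_nth] mult_ac)
  finally show ?thesis by (simp add: fps_sum_nth)
qed

text \<open>A coefficient defined line by line is polynomial in \<open>s\<close>: by Hadamard's
  formula the coefficient of degree d + 1 of \<open>f\<close> is the sum of s_i times the
  coefficients of degree d of the cofactors.\<close>

theorem hpoly_jet:
  assumes "holomorphic_germ f" shows "hpoly d (\<lambda>s. fps_nth (jet f s) d)"
  using assms
proof (induction d arbitrary: f)
  case 0
  then show ?case by (simp add: jet_nth hpoly_const)
next
  case (Suc d)
  obtain g where g: "\<And>i. holomorphic_germ (g i)" "\<forall>\<^sub>F s in nhds 0. f s = f 0 + (\<Sum>i\<in>UNIV. s $ i * g i s)"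
    by (rule hadamard[OF Suc.prems]) (rule that)
  have "hpoly (Suc 0 + d) (\<lambda>s. \<Sum>i\<in>UNIV. s $ i * fps_nth (jet (g i) s) d)"
    by (intro hpoly_sum hpoly_mult hpoly_nth Suc.IH g)
  then show ?case by (simp add: jet_hadamard[OF Suc.prems g])
qed

text \<open>Hadamard's formula again: the remainder of \<open>f\<close> is the sum of s_i times the
  remainders of the cofactors, so each step of the induction gains one order.\<close>

theorem taylor:
  assumes "holomorphic_germ f" shows "vanish K (\<lambda>s. f s - (\<Sum>d<K. fps_nth (jet f s) d))"
  using assms
proof (induction K arbitrary: f)
  case 0
  then show ?case by (simp add: vanish_0_hg)
next
  case (Suc K)
  obtain g where g: "\<And>i. holomorphic_germ (g i)" "\<forall>\<^sub>F s in nhds 0. f s = f 0 + (\<Sum>i\<in>UNIV. s $ i * g i s)"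
    by (rule hadamard[OF Suc.prems]) (rule that)
  have "vanish (Suc 0 + K) (\<lambda>s. \<Sum>i\<in>UNIV. s $ i * (g i s - (\<Sum>d<K. fps_nth (jet (g i) s) d)))"
    by (intro vanish_sum vanish_mult vanish_nth Suc.IH g)
  moreover have "\<forall>\<^sub>F s in nhds 0. (\<Sum>i\<in>UNIV. s $ i * (g i s - (\<Sum>d<K. fps_nth (jet (g i) s) d)))
     = f s - (\<Sum>d<Suc K. fps_nth (jet f s) d)"
    using g(2)
  proof eventually_elim
    case (elim s)
    have j0: "fps_nth (jet f s) 0 = f 0" by (simp add: jet_nth)
    have "(\<Sum>d<Suc K. fps_nth (jet f s) d) = fps_nth (jet f s) 0 + (\<Sum>d<K. fps_nth (jet f s) (Suc d))"
      by (rule sum.lessThan_Suc_shift)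
    also have "\<dots> = f 0 + (\<Sum>d<K. \<Sum>i\<in>UNIV. s $ i * fps_nth (jet (g i) s) d)"
      by (simp only: jet_hadamard[OF Suc.prems g] j0)
    also have "\<dots> = f 0 + (\<Sum>i\<in>UNIV. s $ i * (\<Sum>d<K. fps_nth (jet (g i) s) d))"
      by (subst sum.swap) (simp add: sum_distrib_left)
    finally show ?case using elim by (simp add: right_diff_distrib sum_subtractf)
  qed
  ultimately show ?case by (simp add: vanish_cong)
qed

lemma vanish_iff_jet:
  assumes "holomorphic_germ f" shows "vanish K f \<longleftrightarrow> (\<forall>s. \<forall>d<K. fps_nth (jet f s) d = 0)"
  using vanish_jet[OF assms] taylor[OF assms, of K] by auto

lemma hg_leading_term:
  assumes "holomorphic_germ f" "vanish K f"
  shows "vanish (Suc K) (\<lambda>s. f s - fps_nth (jet f s) K)"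
proof -
  have "(\<Sum>d<Suc K. fps_nth (jet f s) d) = fps_nth (jet f s) K" for s
    using vanish_jet[OF assms] by simp
  then show ?thesis using taylor[OF assms(1), of "Suc K"] by simp
qed

lemma hpoly_vanish_zero:
  assumes "hpoly d P" "vanish (Suc d) P" shows "P s = 0"
  using vanish_jet[OF hpoly_hg[OF assms(1)] assms(2), of d s] hpoly_jet_nth[OF assms(1), of s d] by simp

text \<open>Induction on the set of variables: the sum is a polynomial in \<open>s $ k\<close> whose
  coefficients involve only the variables of the smaller set, and these coefficients vanish by the
  one-variable result. The common bound \<open>K\<close> makes the sets of exponents finite
  boxes.\<close>

lemma monomials_independent_aux:
  fixes S :: "'a::finite set"
  assumes "finite S" "\<And>s. (\<Sum>\<alpha>\<in>{\<alpha>. (\<forall>i. \<alpha> i \<le> K) \<and> (\<forall>i. i \<notin> S \<longrightarrow> \<alpha> i = 0)}. c \<alpha> * mpow s \<alpha>) = 0"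
    "\<forall>i. \<alpha> i \<le> K" "\<forall>i. i \<notin> S \<longrightarrow> \<alpha> i = 0"
  shows "c \<alpha> = 0"
  using assms
proof (induction S arbitrary: c \<alpha> rule: finite_induct)
  case empty
  have "{\<alpha>::'a \<Rightarrow> nat. (\<forall>i. \<alpha> i \<le> K) \<and> (\<forall>i. i \<notin> {} \<longrightarrow> \<alpha> i = 0)} = {\<lambda>_. 0}" by auto
  moreover have "\<alpha> = (\<lambda>_. 0)" using empty.prems(3) by auto
  ultimately show ?case using empty.prems(1)[of 0] by simp
next
  case (insert k S)
  let ?A = "\<lambda>S. {\<alpha>::'a \<Rightarrow> nat. (\<forall>i. \<alpha> i \<le> K) \<and> (\<forall>i. i \<notin> S \<longrightarrow> \<alpha> i = 0)}"
  have bij: "bij_betw (\<lambda>(n, \<beta>). \<beta>(k := n)) ({..K} \<times> ?A S) (?A (insert k S))"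
    unfolding bij_betw_def
  proof
    show "inj_on (\<lambda>(n, \<beta>). \<beta>(k := n)) ({..K} \<times> ?A S)"
    proof (rule inj_onI, clarify)
      fix n \<beta> n' \<beta>' assume *: "\<forall>i. \<beta> i \<le> K" "\<forall>i. i \<notin> S \<longrightarrow> \<beta> i = 0" "\<forall>i. \<beta>' i \<le> K" "\<forall>i. i \<notin> S \<longrightarrow> \<beta>' i = 0"
        "\<beta>(k := n) = \<beta>'(k := n')"
      have "\<beta> i = \<beta>' i" for i
        using fun_cong[OF *(5), of i] *(2,4) insert.hyps(2) by (cases "i = k") auto
      then show "n = n' \<and> \<beta> = \<beta>'" using fun_cong[OF *(5), of k] by auto
    qed
    show "(\<lambda>(n, \<beta>). \<beta>(k := n)) ` ({..K} \<times> ?A S) = ?A (insert k S)"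
    proof
      show "(\<lambda>(n, \<beta>). \<beta>(k := n)) ` ({..K} \<times> ?A S) \<subseteq> ?A (insert k S)" by auto
      show "?A (insert k S) \<subseteq> (\<lambda>(n, \<beta>). \<beta>(k := n)) ` ({..K} \<times> ?A S)"
      proof
        fix \<alpha> :: "'a \<Rightarrow> nat" assume a: "\<alpha> \<in> ?A (insert k S)"
        then have "(\<alpha> k, \<alpha>(k := 0)) \<in> {..K} \<times> ?A S" by auto
        moreover have "\<alpha> = (\<lambda>(n, \<beta>). \<beta>(k := n)) (\<alpha> k, \<alpha>(k := 0))" by auto
        ultimately show "\<alpha> \<in> (\<lambda>(n, \<beta>). \<beta>(k := n)) ` ({..K} \<times> ?A S)" by (rule rev_image_eqI)
      qed
    qed
  qed
  have m: "mpow s (\<beta>(k := n)) = s $ k ^ n * mpow s \<beta>" if "\<beta> \<in> ?A S" for s n and \<beta> :: "'a \<Rightarrow> nat"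
  proof -
    have "\<beta> k = 0" using that insert.hyps by auto
    then have "\<beta>(k := n) = madd (msingle k n) \<beta>" by (auto simp: madd_def msingle_def fun_eq_iff)
    then show ?thesis by (simp add: mpow_madd)
  qed
  have main: "(\<Sum>n\<le>K. (\<Sum>\<beta>\<in>?A S. c (\<beta>(k := n)) * mpow s \<beta>) * s $ k ^ n) = 0" for s
  proof -
    have "(\<Sum>\<alpha>\<in>?A (insert k S). c \<alpha> * mpow s \<alpha>)
        = (\<Sum>(n, \<beta>)\<in>{..K} \<times> ?A S. c (\<beta>(k := n)) * mpow s (\<beta>(k := n)))"
      by (subst sum.reindex_bij_betw[OF bij, symmetric]) (simp add: case_prod_unfold)
    also have "\<dots> = (\<Sum>(n, \<beta>)\<in>{..K} \<times> ?A S. c (\<beta>(k := n)) * mpow s \<beta> * s $ k ^ n)"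
      by (rule sum.cong) (auto simp: m)
    also have "\<dots> = (\<Sum>n\<le>K. \<Sum>\<beta>\<in>?A S. c (\<beta>(k := n)) * mpow s \<beta> * s $ k ^ n)"
      by (simp add: sum.cartesian_product)
    finally show ?thesis using insert.prems(1)[of s] by (simp add: sum_distrib_right)
  qed
  have upd0: "mpow (upd k x s) \<beta> = mpow s \<beta>" if "\<beta> \<in> ?A S" for x s and \<beta> :: "'a \<Rightarrow> nat"
  proof -
    have "\<beta> k = 0" using that insert.hyps by auto
    then show ?thesis unfolding mpow_def by (intro prod.cong) (auto simp: upd_nth)
  qed
  have "(\<Sum>\<beta>\<in>?A S. c (\<beta>(k := n)) * mpow s \<beta>) = 0" if "n \<le> K" for n s
  proof -
    have "(\<Sum>n\<le>K. (\<Sum>\<beta>\<in>?A S. c (\<beta>(k := n)) * mpow s \<beta>) * x ^ n) = 0" for x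
    proof -
      have "(\<Sum>\<beta>\<in>?A S. c (\<beta>(k := n)) * mpow (upd k x s) \<beta>) = (\<Sum>\<beta>\<in>?A S. c (\<beta>(k := n)) * mpow s \<beta>)" for n
        by (rule sum.cong) (simp_all add: upd0)
      then show ?thesis using main[of "upd k x s"] by (simp add: upd_nth)
    qed
    then show ?thesis using polyfun_eq_0[of "\<lambda>n. \<Sum>\<beta>\<in>?A S. c (\<beta>(k := n)) * mpow s \<beta>" K] that by blast
  qed
  then have "c ((\<alpha>(k := 0))(k := \<alpha> k)) = 0"
    using insert.prems(2,3) by (intro insert.IH[of "\<lambda>\<beta>. c (\<beta>(k := \<alpha> k))"]) auto
  then show ?case by simp
qed

lemma monomials_independent:
  fixes c :: "('a::finite \<Rightarrow> nat) \<Rightarrow> complex"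
  assumes "finite A" "\<And>s. (\<Sum>\<alpha>\<in>A. c \<alpha> * mpow s \<alpha>) = 0" "\<alpha> \<in> A"
  shows "c \<alpha> = 0"
proof -
  define K where "K = (\<Sum>\<alpha>\<in>A. mdeg \<alpha>)"
  have K: "\<beta> i \<le> K" if "\<beta> \<in> A" for \<beta> i
  proof -
    have "\<beta> i \<le> mdeg \<beta>" unfolding mdeg_def by (rule member_le_sum) auto
    also have "\<dots> \<le> K" unfolding K_def using assms(1) that by (intro member_le_sum) auto
    finally show ?thesis .
  qed
  let ?B = "{\<alpha>::'a \<Rightarrow> nat. (\<forall>i. \<alpha> i \<le> K) \<and> (\<forall>i. i \<notin> UNIV \<longrightarrow> \<alpha> i = 0)}"
  have fin: "finite ?B"
    by (rule finite_subset[of _ "PiE UNIV (\<lambda>_. {..K})"]) (auto intro: finite_PiE)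
  have "(\<Sum>\<alpha>\<in>?B. (if \<alpha> \<in> A then c \<alpha> else 0) * mpow s \<alpha>) = 0" for s
  proof -
    have "(\<Sum>\<alpha>\<in>A. c \<alpha> * mpow s \<alpha>) = (\<Sum>\<alpha>\<in>A. (if \<alpha> \<in> A then c \<alpha> else 0) * mpow s \<alpha>)" by (rule sum.cong) auto
    also have "\<dots> = (\<Sum>\<alpha>\<in>?B. (if \<alpha> \<in> A then c \<alpha> else 0) * mpow s \<alpha>)"
      by (rule sum.mono_neutral_left[OF fin]) (use K in auto)
    finally show ?thesis using assms(2) by simp
  qed
  from monomials_independent_aux[where S=UNIV and K=K and c="\<lambda>\<alpha>. if \<alpha> \<in> A then c \<alpha> else 0" and \<alpha>=\<alpha>, OF finite this]
  show ?thesis using K[OF assms(3)] assms(3) by simp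
qed

section \<open>Linear forms, local parametrizations and smooth curve germs\<close>

section \<open>Linear forms and subspaces\<close>

text \<open>The bilinear pairing, without complex conjugation, so that linear forms over the complex
  numbers correspond to vectors \<open>a\<close>.\<close>

definition bform :: "complex^'m::finite \<Rightarrow> complex^'m \<Rightarrow> complex" where
  "bform a x = (\<Sum>j\<in>UNIV. a $ j * x $ j)"

lemma bform_add: "bform a (x + y) = bform a x + bform a y"
  and bform_diff: "bform a (x - y) = bform a x - bform a y"
  and bform_smult: "bform a (c *s x) = c * bform a x"
  and bform_zero [simp]: "bform a 0 = 0"
  by (simp_all add: bform_def sum.distrib sum_subtractf sum_distrib_left algebra_simps)

lemma bform_axis [simp]: "bform a (axis j 1) = a $ j"
  by (simp add: bform_def axis_def if_distrib cong: if_cong)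

lemma subspace_bform: "vec.subspace {x. bform a x = 0}"
  by (auto simp: vec.subspace_def bform_add bform_smult)

text \<open>A linear map that kills a basis of the span and fixes \<open>x\<close> has a coordinate
  that is nonzero at \<open>x\<close>; the corresponding row of its matrix is the form.\<close>

lemma span_separation:
  fixes S :: "(complex^'m::finite) set"
  assumes "x \<notin> vec.span S"
  obtains a where "\<And>y. y \<in> S \<Longrightarrow> bform a y = 0" "bform a x \<noteq> 0"
proof -
  obtain B where B: "B \<subseteq> S" "vec.independent B" "S \<subseteq> vec.span B" using vec.maximal_independent_subset by blast
  have "vec.span B = vec.span S" using B by (metis vec.span_mono vec.span_span subset_antisym vec.span_minimal vec.subspace_span)
  then have xB: "x \<notin> vec.span B" using assms by simp
  then have ind: "vec.independent (insert x B)" using B(2) by (simp add: vec.independent_insert)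
  obtain g where g: "Vector_Spaces.linear (*s) (*s) g" "\<forall>y\<in>insert x B. g y = (if y = x then x else 0)"
    using vec.linear_independent_extend[OF ind, where f="\<lambda>y. if y = x then x else 0"] by blast
  have "x \<noteq> 0" using xB vec.span_zero by blast
  then obtain k where k: "x $ k \<noteq> 0" by (auto simp: vec_eq_iff)
  define a where "a = matrix g $ k"
  have ga: "bform a y = g y $ k" for y
    using matrix_works[OF g(1), of y] by (simp add: bform_def a_def matrix_vector_mult_def vec_eq_iff)
  have "B \<subseteq> {y. bform a y = 0}"
  proof
    fix y assume "y \<in> B"
    moreover have "y \<noteq> x" using xB \<open>y \<in> B\<close> vec.span_base by blast
    ultimately show "y \<in> {y. bform a y = 0}" using g(2) by (simp add: ga)
  qed
  then have "vec.span B \<subseteq> {y. bform a y = 0}" by (rule vec.span_minimal[OF _ subspace_bform])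
  then have "bform a y = 0" if "y \<in> S" for y using that B(3) by blast
  moreover have "bform a x \<noteq> 0" using g(2) k by (simp add: ga)
  ultimately show ?thesis using that by blast
qed

lemma hg_bform: "hol_map F \<Longrightarrow> holomorphic_germ (\<lambda>s. bform a (F s))"
  unfolding bform_def hol_map_def by (intro hol_intros) auto

lemma vanish_bform: "vanish K F \<Longrightarrow> vanish K (\<lambda>s. bform a (F s))"
  unfolding bform_def vanish_vec_iff by (intro vanish_sum vanish_cmult) auto

lemma vanish_matrix:
  fixes F :: "'a::real_normed_vector \<Rightarrow> complex^'n::finite" and A :: "complex^'n^'m::finite"
  shows "vanish K F \<Longrightarrow> vanish K (\<lambda>s. A *v F s)"
  unfolding vanish_vec_iff matrix_vector_mult_def vec_lambda_beta by (intro allI vanish_sum vanish_cmult) auto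

lemma vanish_at_0: "vanish (Suc K) f \<Longrightarrow> f 0 = 0"
  unfolding vanish_def by (auto dest!: eventually_nhds_x_imp_x)

lemma analytic_bform: "hol_curve c \<Longrightarrow> (\<lambda>t. bform a (c t)) analytic_on {0}"
  unfolding bform_def hol_curve_def by (intro analytic_intros) auto

lemma deriv_bform:
  assumes "hol_curve c"
  shows "(deriv ^^ k) (\<lambda>t. bform a (c t)) 0 = bform a (curve_deriv k c)"
proof -
  let ?F = "\<lambda>j. fps_expansion (\<lambda>t. c t $ j) 0"
  have "(\<lambda>t. bform a (c t)) has_fps_expansion (\<Sum>j\<in>UNIV. fps_const (a $ j) * ?F j)"
    unfolding bform_def
    by (intro has_fps_expansion_sum has_fps_expansion_mult has_fps_expansion_const analytic_has_fps)
       (use assms in \<open>auto simp: hol_curve_def\<close>)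
  then have "(deriv ^^ k) (\<lambda>t. bform a (c t)) 0 / fact k = fps_nth (\<Sum>j\<in>UNIV. fps_const (a $ j) * ?F j) k"
    by (rule fps_nth_fps_expansion[symmetric])
  also have "\<dots> = bform a (curve_deriv k c) / fact k"
    by (simp add: fps_sum_nth fps_expansion_def bform_def curve_deriv_def sum_divide_distrib)
  finally show ?thesis by simp
qed

lemma curve_deriv_in_subspace:
  assumes "hol_curve c" "vec.subspace A" "\<forall>\<^sub>F t in nhds 0. c t \<in> A"
  shows "curve_deriv k c \<in> A"
proof (rule ccontr)
  assume "curve_deriv k c \<notin> A"
  then have "curve_deriv k c \<notin> vec.span A" using assms(2) by (simp add: vec.span_eq_iff[THEN iffD2])
  then obtain a where a: "\<And>y. y \<in> A \<Longrightarrow> bform a y = 0" "bform a (curve_deriv k c) \<noteq> 0"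
    by (rule span_separation) (rule that)
  have "\<forall>\<^sub>F t in nhds 0. bform a (c t) = 0" using assms(3) by eventually_elim (rule a(1))
  then have "(deriv ^^ k) (\<lambda>t. bform a (c t)) 0 = (deriv ^^ k) (\<lambda>t. 0) 0"
    by (intro higher_deriv_cong_ev) auto
  then show False using a(2) by (simp add: deriv_bform[OF assms(1)])
qed

lemma curve_deriv_1:
  assumes "hol_curve c" "c 0 = 0" shows "vanish 2 (\<lambda>t. c t - t *s curve_deriv 1 c)"
  unfolding vanish_vec_iff
proof
  fix j
  have an: "(\<lambda>t. c t $ j) analytic_on {0}" using assms(1) by (simp add: hol_curve_def)
  then have "vanish 1 (\<lambda>t. c t $ j)" using assms(2) by (simp add: vanish_analytic_iff)
  from analytic_leading_term[OF an this]
  show "vanish 2 (\<lambda>t. (c t - t *s curve_deriv 1 c) $ j)"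
    by (simp add: curve_deriv_def mult.commute numeral_2_eq_2)
qed

lemma vanish_line_unique:
  fixes u v :: "complex^'n::finite"
  assumes "vanish 2 (\<lambda>t. c t - t *s u)" "vanish 2 (\<lambda>t. c t - t *s v)" shows "u = v"
proof -
  have "vanish 2 (\<lambda>t::complex. t *s (v - u))"
    using vanish_diff[OF assms] by (simp add: vector_ssub_ldistrib)
  then have "vanish (Suc 1) (\<lambda>t::complex. (v - u) $ j * t ^ 1)" for j
    unfolding vanish_vec_iff by (simp add: algebra_simps numeral_2_eq_2)
  then have "(v - u) $ j = 0" for j by (rule vanish_monomial_zero)
  then show ?thesis by (simp add: vec_eq_iff)
qed

lemma linear_part:
  assumes "hol_map F" "F 0 = 0"
  obtains D where "vanish 2 (\<lambda>s. F s - D *v s)"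
proof -
  have "\<exists>d. vanish 2 (\<lambda>s. F s $ j - (\<Sum>i\<in>UNIV. d i * s $ i))" for j
  proof -
    have f: "holomorphic_germ (\<lambda>s. F s $ j)" using assms(1) by (simp add: hol_map_def)
    obtain g where g: "\<And>i. holomorphic_germ (g i)" "\<forall>\<^sub>F s in nhds 0. F s $ j = F 0 $ j + (\<Sum>i\<in>UNIV. s $ i * g i s)"
      by (rule hadamard[OF f]) (rule that)
    have "vanish 1 (\<lambda>s. g i s - g i 0)" for i
    proof (rule vanish_1_cdiff)
      show "cdiff_at (\<lambda>s. g i s - g i 0) 0"
        using hg_diff[OF g(1) hg_const] unfolding holomorphic_germ_iff by (rule eventually_nhds_x_imp_x)
    qed simp
    then have "vanish (Suc 0 + 1) (\<lambda>s. \<Sum>i\<in>UNIV. s $ i * (g i s - g i 0))"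
      by (intro vanish_sum vanish_mult vanish_nth)
    moreover have "\<forall>\<^sub>F s in nhds 0. (\<Sum>i\<in>UNIV. s $ i * (g i s - g i 0)) = F s $ j - (\<Sum>i\<in>UNIV. g i 0 * s $ i)"
      using g(2) by eventually_elim (simp add: assms(2) right_diff_distrib sum_subtractf mult.commute)
    ultimately show ?thesis by (intro exI[of _ "\<lambda>i. g i 0"]) (simp add: vanish_cong numeral_2_eq_2)
  qed
  then have "\<forall>j. \<exists>d. vanish 2 (\<lambda>s. F s $ j - (\<Sum>i\<in>UNIV. d i * s $ i))" by blast
  from choice[OF this] obtain d where "\<And>j. vanish 2 (\<lambda>s. F s $ j - (\<Sum>i\<in>UNIV. d j i * s $ i))" by blast
  then have "vanish 2 (\<lambda>s. F s - (\<chi> j i. d j i) *v s)"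
    unfolding vanish_vec_iff by (simp add: matrix_vector_mult_def)
  then show ?thesis by (rule that)
qed

lemma vanish_curve_linear:
  fixes F :: "complex^'n::finite \<Rightarrow> complex^'m::finite"
  assumes "vanish 2 (\<lambda>s. F s - D *v s)" "vanish 2 (\<lambda>t::complex. c t - t *s u)"
  shows "vanish 2 (\<lambda>t. F (c t) - t *s (D *v u))"
proof -
  have c1: "vanish 1 c"
    using vanish_add[OF vanish_mono[OF assms(2), of 1] vanish_line[of u]] by simp
  have "vanish 2 (\<lambda>t. (F (c t) - D *v c t) + D *v (c t - t *s u))"
    by (rule vanish_add[OF vanish_compose[OF assms(1) c1] vanish_matrix[OF assms(2)]])
  then show ?thesis by (simp add: matrix_vector_mult_diff_distrib vector_scalar_commute)
qed

section \<open>Local parametrizations\<close>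

text \<open>The left inverse \<pi> is holomorphic on a whole neighbourhood of 0 in the ambient
  space. It lifts curves in \<open>X\<close> to the parameter space, and the conditions are stable
  under coordinate changes on either side.\<close>

definition param :: "(complex^'n::finite \<Rightarrow> complex^'m::finite) \<Rightarrow> (complex^'m) set \<Rightarrow> bool" where
  "param \<gamma> X \<longleftrightarrow> hol_map \<gamma> \<and> \<gamma> 0 = 0 \<and>
     (\<exists>\<pi>. hol_map \<pi> \<and> \<pi> 0 = 0 \<and> (\<forall>\<^sub>F s in nhds 0. \<pi> (\<gamma> s) = s) \<and>
       (\<forall>\<^sub>F s in nhds 0. \<gamma> s \<in> X) \<and> (\<forall>\<^sub>F x in nhds 0. x \<in> X \<longrightarrow> \<gamma> (\<pi> x) = x))"

lemma paramI:
  "hol_map \<gamma> \<Longrightarrow> \<gamma> 0 = 0 \<Longrightarrow> hol_map \<pi> \<Longrightarrow> \<pi> 0 = 0 \<Longrightarrow> \<forall>\<^sub>F s in nhds 0. \<pi> (\<gamma> s) = s \<Longrightarrow>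
   \<forall>\<^sub>F s in nhds 0. \<gamma> s \<in> X \<Longrightarrow> \<forall>\<^sub>F x in nhds 0. x \<in> X \<longrightarrow> \<gamma> (\<pi> x) = x \<Longrightarrow> param \<gamma> X"
  unfolding param_def by blast

lemma param_parametrizes:
  assumes "param \<gamma> X" shows "parametrizes \<gamma> X"
proof -
  obtain \<pi> where p: "hol_map \<pi>" "\<pi> 0 = 0" "\<forall>\<^sub>F s in nhds 0. \<gamma> s \<in> X" "\<forall>\<^sub>F x in nhds 0. x \<in> X \<longrightarrow> \<gamma> (\<pi> x) = x"
    using assms unfolding param_def by blast
  obtain r0 where r0: "r0 > 0" "\<And>s. norm s < r0 \<Longrightarrow> \<gamma> s \<in> X"
    using p(3) unfolding eventually_nhds_metric by auto
  have "germ_eq (\<gamma> ` ball 0 r) X" if r: "0 < r" "r < r0" for r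
  proof -
    have "\<forall>\<^sub>F x in nhds 0. \<pi> x \<in> ball 0 r"
      using r by (intro eventually_hol_map[OF p(1,2)] eventually_nhds_in_open) auto
    with p(4) show ?thesis
      unfolding germ_eq_def
    proof eventually_elim
      case (elim x)
      have "x \<in> X" if "x \<in> \<gamma> ` ball 0 r" using that r0(2) r(2) by auto
      moreover have "x \<in> \<gamma> ` ball 0 r" if "x \<in> X" using that elim by (metis imageI)
      ultimately show ?case by blast
    qed
  qed
  then show ?thesis unfolding parametrizes_def eventually_at_right_field using r0(1) by blast
qed

text \<open>One sufficiently small radius is enough: there \<pi> inverts \<gamma>, and the image of
  the ball has the germ of \<open>Y\<close>.\<close>

lemma parametrizes_param:
  assumes "hol_map \<gamma>" "\<gamma> 0 = 0" "hol_map \<pi>" "\<pi> 0 = 0" "\<forall>\<^sub>F s in nhds 0. \<pi> (\<gamma> s) = s" "parametrizes \<gamma> Y"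
  shows "param \<gamma> Y"
proof -
  obtain r0 where r0: "r0 > 0" "\<And>r. 0 < r \<Longrightarrow> r < r0 \<Longrightarrow> germ_eq (\<gamma> ` ball 0 r) Y"
    using assms(6) unfolding parametrizes_def eventually_at_right_field by blast
  obtain r1 where r1: "r1 > 0" "\<And>s. norm s < r1 \<Longrightarrow> \<pi> (\<gamma> s) = s"
    using assms(5) unfolding eventually_nhds_metric by auto
  define r where "r = min r0 r1 / 2"
  have r: "0 < r" "r < r0" "r < r1" using r0(1) r1(1) by (auto simp: r_def min_def)
  have g: "\<forall>\<^sub>F x in nhds 0. x \<in> \<gamma> ` ball 0 r \<longleftrightarrow> x \<in> Y" using r0(2)[OF r(1,2)] by (simp add: germ_eq_def)
  have "\<forall>\<^sub>F s in nhds (0::complex^'a). s \<in> ball 0 r" by (rule eventually_nhds_in_open) (use r in auto)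
  with eventually_hol_map[OF assms(1,2) g] have "\<forall>\<^sub>F s in nhds 0. \<gamma> s \<in> Y"
    by eventually_elim blast
  moreover have "\<forall>\<^sub>F x in nhds 0. x \<in> Y \<longrightarrow> \<gamma> (\<pi> x) = x"
    using g by eventually_elim (use r1(2) r(3) in auto)
  ultimately show ?thesis unfolding param_def using assms by blast
qed

lemma param_reparam:
  assumes "param \<gamma> X" "hol_map \<tau>" "\<tau> 0 = 0" "hol_map \<sigma>" "\<sigma> 0 = 0"
    "\<forall>\<^sub>F z in nhds 0. \<tau> (\<sigma> z) = z" "\<forall>\<^sub>F z in nhds 0. \<sigma> (\<tau> z) = z"
  shows "param (\<lambda>s. \<gamma> (\<tau> s)) X"
proof -
  obtain \<pi> where p: "hol_map \<gamma>" "\<gamma> 0 = 0" "hol_map \<pi>" "\<pi> 0 = 0" "\<forall>\<^sub>F s in nhds 0. \<pi> (\<gamma> s) = s"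
    "\<forall>\<^sub>F s in nhds 0. \<gamma> s \<in> X" "\<forall>\<^sub>F x in nhds 0. x \<in> X \<longrightarrow> \<gamma> (\<pi> x) = x"
    using assms(1) unfolding param_def by blast
  have "\<forall>\<^sub>F s in nhds 0. \<sigma> (\<pi> (\<gamma> (\<tau> s))) = s"
    using eventually_hol_map[OF assms(2,3) p(5)] assms(7) by eventually_elim simp
  moreover have "\<forall>\<^sub>F x in nhds 0. x \<in> X \<longrightarrow> \<gamma> (\<tau> (\<sigma> (\<pi> x))) = x"
    using eventually_hol_map[OF p(3,4) assms(6)] p(7) by eventually_elim simp
  moreover have "\<forall>\<^sub>F s in nhds 0. \<gamma> (\<tau> s) \<in> X" by (rule eventually_hol_map[OF assms(2,3) p(6)])
  moreover have "hol_map (\<lambda>s. \<gamma> (\<tau> s))" by (rule hol_map_compose[OF p(1) assms(2,3)])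
  moreover have "hol_map (\<lambda>x. \<sigma> (\<pi> x))" by (rule hol_map_compose[OF assms(4) p(3,4)])
  ultimately show ?thesis
    using assms(3,5) p(2,4) by (intro paramI[where \<pi>="\<lambda>x. \<sigma> (\<pi> x)"]) simp_all
qed

lemma hol_map_cong: "\<forall>\<^sub>F s in nhds 0. F s = G s \<Longrightarrow> hol_map F \<Longrightarrow> hol_map G"
  unfolding hol_map_def
proof
  fix j assume e: "\<forall>\<^sub>F s in nhds 0. F s = G s" and h: "\<forall>j. holomorphic_germ (\<lambda>z. F z $ j)"
  have "\<forall>\<^sub>F s in nhds 0. F s $ j = G s $ j" using e by eventually_elim simp
  from hg_cong[OF this] h show "holomorphic_germ (\<lambda>z. G z $ j)" by simp
qed

lemma param_cong:
  assumes "param \<gamma> X" "\<forall>\<^sub>F s in nhds 0. \<gamma> s = \<gamma>' s" shows "param \<gamma>' X"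
proof -
  obtain \<pi> where p: "hol_map \<gamma>" "\<gamma> 0 = 0" "hol_map \<pi>" "\<pi> 0 = 0" "\<forall>\<^sub>F s in nhds 0. \<pi> (\<gamma> s) = s"
    "\<forall>\<^sub>F s in nhds 0. \<gamma> s \<in> X" "\<forall>\<^sub>F x in nhds 0. x \<in> X \<longrightarrow> \<gamma> (\<pi> x) = x"
    using assms(1) unfolding param_def by blast
  have "\<gamma>' 0 = 0" using eventually_nhds_x_imp_x[OF assms(2)] p(2) by simp
  moreover have "\<forall>\<^sub>F s in nhds 0. \<pi> (\<gamma>' s) = s" using p(5) assms(2) by eventually_elim simp
  moreover have "\<forall>\<^sub>F s in nhds 0. \<gamma>' s \<in> X" using p(6) assms(2) by eventually_elim simp
  moreover have "\<forall>\<^sub>F x in nhds 0. x \<in> X \<longrightarrow> \<gamma>' (\<pi> x) = x"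
    using p(7) eventually_hol_map[OF p(3,4) assms(2)] by eventually_elim simp
  ultimately show ?thesis unfolding param_def using p hol_map_cong[OF assms(2) p(1)] by blast
qed

lemma param_image:
  assumes "param \<gamma> X" "hol_map H" "H 0 = 0" "hol_map K" "K 0 = 0"
    "\<forall>\<^sub>F x in nhds 0. K (H x) = x" "\<forall>\<^sub>F y in nhds 0. H (K y) = y"
    "\<forall>\<^sub>F x in nhds 0. x \<in> X \<longrightarrow> H x \<in> Z" "\<forall>\<^sub>F y in nhds 0. y \<in> Z \<longrightarrow> K y \<in> X"
  shows "param (\<lambda>s. H (\<gamma> s)) Z"
proof -
  obtain \<pi> where p: "hol_map \<gamma>" "\<gamma> 0 = 0" "hol_map \<pi>" "\<pi> 0 = 0" "\<forall>\<^sub>F s in nhds 0. \<pi> (\<gamma> s) = s"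
    "\<forall>\<^sub>F s in nhds 0. \<gamma> s \<in> X" "\<forall>\<^sub>F x in nhds 0. x \<in> X \<longrightarrow> \<gamma> (\<pi> x) = x"
    using assms(1) unfolding param_def by blast
  have "\<forall>\<^sub>F s in nhds 0. \<pi> (K (H (\<gamma> s))) = s"
    using eventually_hol_map[OF p(1,2) assms(6)] p(5) by eventually_elim simp
  moreover have "\<forall>\<^sub>F s in nhds 0. H (\<gamma> s) \<in> Z"
    using eventually_hol_map[OF p(1,2) assms(8)] p(6) by eventually_elim simp
  moreover have "\<forall>\<^sub>F y in nhds 0. y \<in> Z \<longrightarrow> H (\<gamma> (\<pi> (K y))) = y"
    using eventually_hol_map[OF assms(4,5) p(7)] assms(7,9) by eventually_elim simp
  moreover have "hol_map (\<lambda>s. H (\<gamma> s))" by (rule hol_map_compose[OF assms(2) p(1,2)])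
  moreover have "hol_map (\<lambda>x. \<pi> (K x))" by (rule hol_map_compose[OF p(3) assms(4,5)])
  ultimately show ?thesis
    using assms(3,5) p(2,4) by (intro paramI[where \<pi>="\<lambda>x. \<pi> (K x)"]) simp_all
qed

lemma subspace_basis_matrix:
  fixes L :: "(complex^'m::finite) set"
  assumes "vec.subspace L" "vec.dim L = CARD('n::finite)"
  obtains B :: "complex^'n^'m" and B' :: "complex^'m^'n"
  where "B' ** B = mat 1" "range ((*v) B) = L"
proof -
  obtain S where S: "S \<subseteq> L" "vec.independent S" "L \<subseteq> vec.span S" "card S = CARD('n)"
    using vec.basis_exists[of L] assms(2) by metis
  have fin: "finite S" using S(4) card.infinite by fastforce
  then obtain b :: "'n \<Rightarrow> complex^'m" where b: "bij_betw b UNIV S"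
    using S(4) finite_same_card_bij[of "UNIV :: 'n set" S] by auto
  define B :: "complex^'n^'m" where "B = (\<chi> i j. b j $ i)"
  have col: "column j B = b j" for j by (simp add: B_def column_def vec_eq_iff)
  have spanS: "vec.span S = L" using S(1,3) assms(1) by (metis subset_antisym vec.span_minimal)
  have Bv: "B *v x = (\<Sum>j\<in>UNIV. x $ j *s b j)" for x
    using matrix_mult_sum[of B x] by (simp add: col)
  have "\<exists>B'. B' ** B = mat 1"
    unfolding matrix_left_invertible_independent_columns
  proof (intro allI impI)
    fix c i assume 0: "(\<Sum>i\<in>UNIV. c i *s column i B) = 0"
    have "(\<Sum>x\<in>S. c (inv_into UNIV b x) *s x) = (\<Sum>i\<in>UNIV. c i *s b i)"
      using b by (subst sum.reindex_bij_betw[OF b, symmetric]) (simp add: bij_betw_def)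
    then have "(\<Sum>x\<in>S. c (inv_into UNIV b x) *s x) = 0" using 0 by (simp add: col)
    moreover have "b i \<in> S" using b by (auto simp: bij_betw_def)
    ultimately have "c (inv_into UNIV b (b i)) = 0"
      by (rule vec.independentD[OF S(2) fin subset_refl])
    then show "c i = 0" using b by (simp add: bij_betw_def)
  qed
  then obtain B' where B': "B' ** B = mat 1" by blast
  have "range ((*v) B) = L"
  proof
    show "range ((*v) B) \<subseteq> L"
    proof (rule image_subsetI)
      fix x
      have bS: "b j \<in> S" for j using b by (auto simp: bij_betw_def)
      show "B *v x \<in> L"
        unfolding Bv spanS[symmetric] by (intro vec.span_sum vec.span_scale vec.span_base bS)
    qed
    show "L \<subseteq> range ((*v) B)"
    proof -
      have "vec.subspace (range ((*v) B))"
        by (rule vec.subspace_image[OF vec.subspace_UNIV])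
      moreover have "S \<subseteq> range ((*v) B)"
      proof
        fix x assume "x \<in> S"
        then obtain j where "x = b j" using b by (auto simp: bij_betw_def)
        then have "x = B *v axis j 1" by (simp add: matrix_vector_mult_def axis_def B_def vec_eq_iff if_distrib cong: if_cong)
        then show "x \<in> range ((*v) B)" by blast
      qed
      ultimately show ?thesis using spanS vec.span_minimal by blast
    qed
  qed
  with B' that show ?thesis by blast
qed

lemma smooth_germ_param:
  fixes X :: "(complex^'m::finite) set"
  assumes "smooth_germ CARD('n::finite) X"
  obtains \<gamma> :: "complex^'n \<Rightarrow> complex^'m" where "param \<gamma> X"
proof -
  obtain U V and \<Phi> \<Psi> :: "complex^'m \<Rightarrow> complex^'m" and L where *: "0 \<in> U" "holomorphic_map_on \<Phi> U" "holomorphic_map_on \<Psi> V"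
     "homeomorphism U V \<Phi> \<Psi>" "\<Phi> 0 = 0" "vec.subspace L" "vec.dim L = CARD('n)" "\<Phi> ` (X \<inter> U) = L \<inter> V"
    using assms unfolding smooth_germ_def by blast
  obtain B :: "complex^'n^'m" and B' :: "complex^'m^'n" where B: "B' ** B = mat 1" "range ((*v) B) = L"
    by (rule subspace_basis_matrix[OF *(6,7)]) (rule that)
  have BB: "B' *v (B *v s) = s" for s by (simp add: matrix_vector_mul_assoc B(1))
  have BB': "B *v (B' *v x) = x" if "x \<in> L" for x using that B(2) BB by auto
  have V0: "0 \<in> V" using *(1,4,5) by (auto simp: homeomorphism_def)
  have P0: "\<Psi> 0 = 0" using *(1,4,5) by (metis homeomorphism_apply1)
  have h\<Phi>: "hol_map \<Phi>" using *(1,2) by (rule holomorphic_map_on_germ[rotated])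
  have h\<Psi>: "hol_map \<Psi>" using V0 *(3) by (rule holomorphic_map_on_germ[rotated])
  have open_UV: "open U" "open V" using *(2,3) by (auto simp: holomorphic_map_on_def holomorphic_fun_on_def)
  have hB: "hol_map (\<lambda>s. B *v s)" by (rule hol_map_matrix[OF hol_map_id])
  have hB': "hol_map (\<lambda>x. B' *v \<Phi> x)" by (rule hol_map_matrix[OF h\<Phi>])
  have evV: "\<forall>\<^sub>F s in nhds 0. B *v s \<in> V"
    by (rule eventually_hol_map[OF hB _ eventually_nhds_in_open[OF open_UV(2) V0]]) simp
  have "param (\<lambda>s. \<Psi> (B *v s)) X"
    unfolding param_def
  proof (intro conjI exI[of _ "\<lambda>x. B' *v \<Phi> x"])
    show "hol_map (\<lambda>s. \<Psi> (B *v s))" by (rule hol_map_compose[OF h\<Psi> hB]) simp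
    show "\<forall>\<^sub>F s in nhds 0. B' *v \<Phi> (\<Psi> (B *v s)) = s"
      using evV by eventually_elim (use *(4) BB in \<open>simp add: homeomorphism_def\<close>)
    show "\<forall>\<^sub>F s in nhds 0. \<Psi> (B *v s) \<in> X"
      using evV
    proof eventually_elim
      case (elim s)
      then have "B *v s \<in> \<Phi> ` (X \<inter> U)" using B(2) *(8) by auto
      then show ?case using *(4) by (auto simp: homeomorphism_def)
    qed
    show "\<forall>\<^sub>F x in nhds 0. x \<in> X \<longrightarrow> \<Psi> (B *v (B' *v \<Phi> x)) = x"
      using eventually_nhds_in_open[OF open_UV(1) *(1)]
    proof eventually_elim
      case (elim x)
      show ?case
      proof
        assume "x \<in> X"
        then have "\<Phi> x \<in> L" using elim *(8) by blast
        then show "\<Psi> (B *v (B' *v \<Phi> x)) = x" using elim *(4) BB' by (simp add: homeomorphism_def)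
      qed
    qed
  qed (use P0 *(5) hB' in auto)
  then show ?thesis by (rule that)
qed

section \<open>Smooth curves as germs of sets\<close>

lemma hg_analytic_compose:
  assumes "g analytic_on {0}" "holomorphic_germ f" "f 0 = 0"
  shows "holomorphic_germ (\<lambda>z. g (f z))"
proof -
  have l: "filterlim f (nhds 0) (nhds 0)" using isCont_0_filterlim[OF hg_isCont[OF assms(2)] assms(3)] .
  have "\<forall>\<^sub>F z in nhds 0. g field_differentiable at (f z)"
    by (rule eventually_compose_filterlim[OF assms(1)[unfolded analytic_0_iff] l])
  with assms(2)[unfolded holomorphic_germ_iff] show ?thesis
    unfolding holomorphic_germ_iff
  proof eventually_elim
    case (elim z)
    obtain D where D: "(f has_derivative D) (at z)" "\<And>c h. D (c *s h) = c * D h"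
      using elim(1) unfolding cdiff_at_def by blast
    obtain g' where "(g has_derivative (*) g') (at (f z))"
      using elim(2) unfolding field_differentiable_def has_field_derivative_def by blast
    from has_derivative_compose[OF D(1) this]
    show ?case by (rule cdiff_atI) (simp add: D(2))
  qed
qed

text \<open>With a linear form l such that l(v) = 1, the map sending z to c(l(z)) + (z - l(z) v) is
  tangent to the identity and takes t v to c(t). Its local inverse straightens the curve to the line
  spanned by \<open>v\<close>, so the image of a piece of that line is the required germ.\<close>

theorem smooth_curve_germ:
  fixes c :: "complex \<Rightarrow> complex^'m::finite"
  assumes c: "hol_curve c" "c 0 = 0" and v: "curve_deriv 1 c = v" "v \<noteq> 0"
  obtains C where "smooth_germ 1 C" "tangent_space C = vec.span {v}"
    "\<And>S. \<forall>\<^sub>F t in nhds 0. c t \<in> S \<Longrightarrow> germ_subset C S"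
proof -
  obtain j where j: "v $ j \<noteq> 0" using v(2) by (auto simp: vec_eq_iff)
  define lf where "lf = (\<lambda>z::complex^'m. z $ j / v $ j)"
  have lfh: "holomorphic_germ lf" unfolding lf_def by (intro hol_intros) (use j in auto)
  have lf0: "lf 0 = 0" by (simp add: lf_def)
  have lfv: "lf (t *s v) = t" for t using j by (simp add: lf_def)
  define \<Psi> where "\<Psi> = (\<lambda>z. c (lf z) + (z - lf z *s v))"
  have \<Psi>v: "\<Psi> (t *s v) = c t" for t by (simp add: \<Psi>_def lfv)
  have \<Psi>h: "hol_map \<Psi>"
  proof (rule hol_mapI)
    fix k
    have "holomorphic_germ (\<lambda>z. c (lf z) $ k)"
      by (rule hg_analytic_compose[OF _ lfh lf0]) (use c(1) in \<open>simp add: hol_curve_def\<close>)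
    then have "holomorphic_germ (\<lambda>z. c (lf z) $ k + (z $ k - lf z * v $ k))"
      by (intro hol_intros lfh)
    then show "holomorphic_germ (\<lambda>z. \<Psi> z $ k)" by (simp add: \<Psi>_def)
  qed
  have lf1: "vanish 1 lf"
    by (rule vanish_1_cdiff) (use lfh lf0 eventually_nhds_x_imp_x in \<open>auto simp: holomorphic_germ_iff\<close>)
  have \<Psi>2: "vanish 2 (\<lambda>z. \<Psi> z - z)"
    using vanish_compose[OF curve_deriv_1[OF c, unfolded v(1)] lf1] by (simp add: \<Psi>_def)
  have \<Psi>0: "\<Psi> 0 = 0" by (simp add: \<Psi>_def lf0 c(2))
  obtain U V \<Phi> where UV: "open U" "open V" "0 \<in> U" "0 \<in> V" "homeomorphism U V \<Psi> \<Phi>"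
    "holomorphic_map_on \<Psi> U" "holomorphic_map_on \<Phi> V" "\<Phi> 0 = 0"
    by (rule hol_map_local_inverse[OF \<Psi>h \<Psi>0 \<Psi>2]) (rule that)
  have \<Phi>h: "hol_map \<Phi>" using UV(4,7) by (rule holomorphic_map_on_germ[rotated])
  let ?L = "vec.span {v}"
  define C where "C = \<Psi> ` (?L \<inter> U)"
  have CV: "C \<subseteq> V" using UV(5) by (auto simp: C_def homeomorphism_def)
  have \<Phi>\<Psi>: "\<Phi> (\<Psi> z) = z" if "z \<in> U" for z using UV(5) that by (simp add: homeomorphism_def)
  have \<Psi>\<Phi>: "\<Psi> (\<Phi> z) = z" if "z \<in> V" for z using UV(5) that by (simp add: homeomorphism_def)
  have \<Phi>C: "\<Phi> x \<in> ?L" if "x \<in> C" for x using that \<Phi>\<Psi> by (auto simp: C_def)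
  have "smooth_germ 1 C"
    unfolding smooth_germ_def
  proof (intro exI conjI)
    show "holomorphic_map_on \<Phi> V" "holomorphic_map_on \<Psi> U" "homeomorphism V U \<Phi> \<Psi>"
      using UV by (auto intro: homeomorphism_symD)
    show "vec.subspace ?L" by simp
    show "vec.dim ?L = 1" unfolding vec.dim_span vec.dim_insert using v(2) by simp
    show "\<Phi> ` (C \<inter> V) = ?L \<inter> U"
      using CV \<Phi>\<Psi> by (force simp: C_def)
  qed (use UV in auto)
  moreover have "tangent_space C = ?L"
  proof
    show "tangent_space C \<subseteq> ?L"
    proof
      fix w assume "w \<in> tangent_space C"
      then obtain c' where c': "curve_germ_in C c'" "w = curve_deriv 1 c'" by (auto simp: tangent_space_def)
      have h': "hol_curve c'" "c' 0 = 0" "\<forall>\<^sub>F t in nhds 0. c' t \<in> C"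
        using c'(1) by (auto simp: curve_germ_in_def hol_curve_def)
      have "curve_deriv 1 (\<lambda>t. \<Phi> (c' t)) \<in> ?L"
      proof (rule curve_deriv_in_subspace)
        show "hol_curve (\<lambda>t. \<Phi> (c' t))" by (rule hol_curve_compose[OF \<Phi>h h'(1,2)])
        show "\<forall>\<^sub>F t in nhds 0. \<Phi> (c' t) \<in> ?L" using h'(3) by eventually_elim (rule \<Phi>C)
      qed simp
      moreover have "curve_deriv 1 (\<lambda>t. \<Phi> (c' t)) = w"
      proof (rule vanish_line_unique)
        show "vanish 2 (\<lambda>t. \<Phi> (c' t) - t *s curve_deriv 1 (\<lambda>t. \<Phi> (c' t)))"
          by (rule curve_deriv_1) (use hol_curve_compose[OF \<Phi>h h'(1,2)] h'(2) UV(8) in auto)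
        have "vanish 2 (\<lambda>s. \<Phi> s - s)"
        proof -
          have "vanish 2 (\<lambda>s. - (\<Psi> (\<Phi> s) - \<Phi> s))"
            using vanish_compose[OF \<Psi>2 vanish_1_hol_map[OF \<Phi>h UV(8)]] by (rule vanish_minus)
          moreover have "\<forall>\<^sub>F s in nhds 0. - (\<Psi> (\<Phi> s) - \<Phi> s) = \<Phi> s - s"
            using eventually_nhds_in_open[OF UV(2,4)] by eventually_elim (simp add: \<Psi>\<Phi>)
          ultimately show ?thesis by (rule vanish_cong_imp)
        qed
        then have "vanish 2 (\<lambda>s. \<Phi> s - mat 1 *v s)" by simp
        from vanish_curve_linear[OF this, of c' w]
        show "vanish 2 (\<lambda>t. \<Phi> (c' t) - t *s w)" using curve_deriv_1[OF h'(1,2)] c'(2) by simp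
      qed
      ultimately show "w \<in> ?L" by simp
    qed
    show "?L \<subseteq> tangent_space C"
    proof
      fix w assume "w \<in> ?L"
      then obtain a where w: "w = a *s v" by (auto simp: vec.span_singleton)
      let ?c = "\<lambda>t. c (a * t)"
      have an: "(\<lambda>t. a * t) analytic_on {0}" by (intro analytic_intros)
      have hc: "hol_curve ?c" by (rule hol_curve_reparam[OF c(1) an]) simp
      have "\<forall>\<^sub>F t in nhds 0. (a * t) *s v \<in> U"
      proof -
        have "\<forall>\<^sub>F t in nhds 0. t *s (a *s v) \<in> U"
          by (rule eventually_hol_curve[OF hol_curve_line _ eventually_nhds_in_open[OF UV(1,3)]]) simp
        then show ?thesis by eventually_elim (simp add: vector_smult_assoc mult.commute)
      qed
      then have "\<forall>\<^sub>F t in nhds 0. ?c t \<in> C"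
      proof eventually_elim
        case (elim t)
        have "(a * t) *s v \<in> ?L" by (simp add: vec.span_scale vec.span_base)
        with elim have "\<Psi> ((a * t) *s v) \<in> C" unfolding C_def by blast
        then show ?case by (simp add: \<Psi>v)
      qed
      then have "curve_germ_in C ?c" using hc c(2) by (simp add: curve_germ_in_def hol_curve_def)
      moreover have "curve_deriv 1 ?c = w"
      proof (rule vanish_line_unique)
        show "vanish 2 (\<lambda>t. ?c t - t *s curve_deriv 1 ?c)" by (rule curve_deriv_1[OF hc]) (simp add: c(2))
        have "vanish 1 (\<lambda>t. a * t)" using vanish_cmult[OF vanish_id] by simp
        from vanish_compose[OF curve_deriv_1[OF c, unfolded v(1)] this]
        show "vanish 2 (\<lambda>t. ?c t - t *s w)" by (simp add: w vector_smult_assoc mult.commute)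
      qed
      ultimately show "w \<in> tangent_space C" unfolding tangent_space_def by blast
    qed
  qed
  moreover have "germ_subset C S" if S: "\<forall>\<^sub>F t in nhds 0. c t \<in> S" for S
  proof -
    have "filterlim (\<lambda>x. lf (\<Phi> x)) (nhds 0) (nhds 0)"
      by (rule isCont_0_filterlim[OF hg_isCont]) (use hg_compose[OF lfh \<Phi>h UV(8)] UV(8) lf0 in auto)
    then have "\<forall>\<^sub>F x in nhds 0. c (lf (\<Phi> x)) \<in> S" by (rule eventually_compose_filterlim[OF S])
    then show ?thesis
      unfolding germ_subset_def
    proof eventually_elim
      case (elim x)
      show ?case
      proof
        assume x: "x \<in> C"
        then obtain t where t: "\<Phi> x = t *s v" using \<Phi>C by (auto simp: vec.span_singleton)
        have "x = \<Psi> (\<Phi> x)" using x CV \<Psi>\<Phi> by auto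
        then have x: "x = c t" by (simp add: t \<Psi>v)
        have "c (lf (t *s v)) \<in> S" using elim unfolding t .
        then show "x \<in> S" unfolding x lfv .
      qed
    qed
  qed
  ultimately show ?thesis by (rule that)
qed

section \<open>Property (P) for parametrizations and its invariance under homographies\<close>

section \<open>Property (P) in terms of a parametrization\<close>

definition jet_regular :: "nat \<Rightarrow> (complex^'n::finite \<Rightarrow> complex^'m::finite) \<Rightarrow> bool" where
  "jet_regular q \<gamma> \<longleftrightarrow> (\<forall>a. vanish (Suc q) (\<lambda>s. bform a (\<gamma> s)) \<longrightarrow> a = 0)"

text \<open>The order \<open>m\<close> measures contact with the line t u: \<open>m = 2\<close> only
  fixes the tangent vector, and straightening raises \<open>m\<close> to q + 1. A linear subspace
  can replace an affine one because the curves pass through 0.\<close>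

definition has_flat_curves :: "nat \<Rightarrow> nat \<Rightarrow> (complex^'n::finite \<Rightarrow> complex^'m::finite) \<Rightarrow> bool" where
  "has_flat_curves q m \<gamma> \<longleftrightarrow> (\<forall>u. u \<noteq> 0 \<longrightarrow> (\<exists>\<sigma> A. hol_curve \<sigma> \<and> vanish m (\<lambda>t. \<sigma> t - t *s u) \<and>
     vec.subspace A \<and> vec.dim A = q \<and> (\<forall>\<^sub>F t in nhds 0. \<gamma> (\<sigma> t) \<in> A)))"

lemma curve_through_param:
  assumes "hol_map \<gamma>" "\<gamma> 0 = 0" "vanish 2 (\<lambda>s. \<gamma> s - D *v s)" "hol_curve \<sigma>" "vanish 2 (\<lambda>t. \<sigma> t - t *s u)"
  shows "hol_curve (\<lambda>t. \<gamma> (\<sigma> t))" "\<sigma> 0 = 0" "\<gamma> (\<sigma> 0) = 0" "curve_deriv 1 (\<lambda>t. \<gamma> (\<sigma> t)) = D *v u"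
proof -
  show s0: "\<sigma> 0 = 0" using vanish_at_0[of 1 "\<lambda>t. \<sigma> t - t *s u"] assms(5) by (simp add: numeral_2_eq_2)
  show h: "hol_curve (\<lambda>t. \<gamma> (\<sigma> t))" by (rule hol_curve_compose[OF assms(1,4) s0])
  show g0: "\<gamma> (\<sigma> 0) = 0" using s0 assms(2) by simp
  show "curve_deriv 1 (\<lambda>t. \<gamma> (\<sigma> t)) = D *v u"
    by (rule vanish_line_unique[OF curve_deriv_1[OF h g0] vanish_curve_linear[OF assms(3,5)]])
qed

text \<open>Curves in \<open>X\<close> and curves in the parameter space correspond through \<gamma>
  and \<pi>, whose linear parts satisfy E D = 1. Regularity is dualized: the osculating space is
  everything exactly when no nonzero form annihilates it.\<close>

theorem property_P_iff_param:
  fixes X :: "(complex^'m::finite) set" and \<gamma> :: "complex^'n::finite \<Rightarrow> complex^'m"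
  assumes par: "param \<gamma> X" and N: "CARD('m) = ((CARD('n) + q) choose q) - 1"
  shows "property_P CARD('n) q X \<longleftrightarrow> jet_regular q \<gamma> \<and> has_flat_curves q 2 \<gamma>"
proof -
  obtain \<pi> where p: "hol_map \<gamma>" "\<gamma> 0 = 0" "hol_map \<pi>" "\<pi> 0 = 0" "\<forall>\<^sub>F s in nhds 0. \<pi> (\<gamma> s) = s"
    "\<forall>\<^sub>F s in nhds 0. \<gamma> s \<in> X" "\<forall>\<^sub>F x in nhds 0. x \<in> X \<longrightarrow> \<gamma> (\<pi> x) = x"
    using par unfolding param_def by blast
  obtain D where D: "vanish 2 (\<lambda>s. \<gamma> s - D *v s)" by (rule linear_part[OF p(1,2)]) (rule that)
  obtain E where E: "vanish 2 (\<lambda>s. \<pi> s - E *v s)" by (rule linear_part[OF p(3,4)]) (rule that)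
  have line2: "vanish 2 (\<lambda>t. t *s u - t *s u)" for u :: "complex^'k::finite" by simp
  have ED: "E *v (D *v u) = u" for u
  proof (rule vanish_line_unique)
    show "vanish 2 (\<lambda>t. \<pi> (\<gamma> (t *s u)) - t *s (E *v (D *v u)))"
      by (rule vanish_curve_linear[OF E vanish_curve_linear[OF D line2]])
    have "\<forall>\<^sub>F t in nhds 0. 0 = \<pi> (\<gamma> (t *s u)) - t *s u"
      using eventually_hol_curve[OF hol_curve_line _ p(5), of u] by simp
    then show "vanish 2 (\<lambda>t. \<pi> (\<gamma> (t *s u)) - t *s u)" by (rule vanish_cong_imp[OF vanish_zero])
  qed
  have lift: "hol_curve c" "c 0 = 0" "\<forall>\<^sub>F t in nhds 0. \<gamma> (\<pi> (c t)) = c t" "hol_curve (\<lambda>t. \<pi> (c t))"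
     "vanish 2 (\<lambda>t. \<pi> (c t) - t *s (E *v curve_deriv 1 c))" "curve_deriv 1 c = D *v (E *v curve_deriv 1 c)"
     if cX: "curve_germ_in X c" for c
  proof -
    show c: "hol_curve c" "c 0 = 0" using cX by (auto simp: curve_germ_in_def hol_curve_def)
    have "\<forall>\<^sub>F t in nhds 0. c t \<in> X" using cX by (auto simp: curve_germ_in_def)
    with eventually_hol_curve[OF c p(7)] show ev: "\<forall>\<^sub>F t in nhds 0. \<gamma> (\<pi> (c t)) = c t"
      by eventually_elim simp
    show h: "hol_curve (\<lambda>t. \<pi> (c t))" by (rule hol_curve_compose[OF p(3) c])
    show v2: "vanish 2 (\<lambda>t. \<pi> (c t) - t *s (E *v curve_deriv 1 c))"
      by (rule vanish_curve_linear[OF E curve_deriv_1[OF c]])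
    show "curve_deriv 1 c = D *v (E *v curve_deriv 1 c)"
    proof (rule vanish_line_unique[OF curve_deriv_1[OF c]])
      have "\<forall>\<^sub>F t in nhds 0. \<gamma> (\<pi> (c t)) - t *s (D *v (E *v curve_deriv 1 c)) = c t - t *s (D *v (E *v curve_deriv 1 c))"
        using ev by eventually_elim simp
      then show "vanish 2 (\<lambda>t. c t - t *s (D *v (E *v curve_deriv 1 c)))"
        by (rule vanish_cong_imp[OF vanish_curve_linear[OF D v2]])
    qed
  qed
  have inX: "curve_germ_in X (\<lambda>t. \<gamma> (\<sigma> t))" if "hol_curve \<sigma>" "vanish 2 (\<lambda>t. \<sigma> t - t *s u)" for \<sigma> u
  proof -
    note * = curve_through_param[OF p(1,2) D that]
    have "\<forall>\<^sub>F t in nhds 0. \<gamma> (\<sigma> t) \<in> X" by (rule eventually_hol_curve[OF that(1) *(2) p(6)])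
    then show ?thesis using * by (simp add: curve_germ_in_def hol_curve_def)
  qed
  let ?O = "{curve_deriv k c |k c. 1 \<le> k \<and> k \<le> q \<and> curve_germ_in X c}"
  \<comment> \<open>The ambient dimension \<open>CARD('m)\<close> is the maximal one, so regularity
    means that the osculating space is the whole space.\<close>
  have reg: "q_regular CARD('n) q X \<longleftrightarrow> vec.span ?O = UNIV"
  proof -
    have "q_regular CARD('n) q X \<longleftrightarrow> vec.dim (vec.span ?O) = CARD('m)"
      by (simp add: q_regular_def osculating_space_def N)
    also have "\<dots> \<longleftrightarrow> vec.span ?O = UNIV"
    proof
      assume "vec.dim (vec.span ?O) = CARD('m)"
      then show "vec.span ?O = UNIV"
        by (intro vec.subspace_dim_equal[OF vec.subspace_span vec.subspace_UNIV]) (simp_all only: vec_dim_card order_refl subset_UNIV)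
    next
      assume "vec.span ?O = UNIV"
      then show "vec.dim (vec.span ?O) = CARD('m)" by (simp only: vec_dim_card)
    qed
    finally show ?thesis .
  qed
  have reg_jet: "jet_regular q \<gamma> \<longleftrightarrow> vec.span ?O = UNIV"
  proof
    assume R: "jet_regular q \<gamma>"
    show "vec.span ?O = UNIV"
    proof (rule ccontr)
      assume "vec.span ?O \<noteq> UNIV"
      then obtain x where "x \<notin> vec.span ?O" by blast
      then obtain a where a: "\<And>y. y \<in> ?O \<Longrightarrow> bform a y = 0" "bform a x \<noteq> 0"
        by (rule span_separation) (rule that)
      \<comment> \<open>The homogeneous parts of the form along \<gamma> are, up to factorials, its
        values on derivatives of the images of lines, and those of orders 1 to q lie in the
        osculating space.\<close>
      have "vanish (Suc q) (\<lambda>s. bform a (\<gamma> s))"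
        unfolding vanish_iff_jet[OF hg_bform[OF p(1)]]
      proof (intro allI impI)
        fix s d assume d: "d < Suc q"
        note c = curve_through_param[OF p(1,2) D hol_curve_line line2, of s]
        have "(deriv ^^ d) (\<lambda>t. bform a (\<gamma> (t *s s))) 0 = 0"
        proof (cases "d = 0")
          case True then show ?thesis using p(2) by simp
        next
          case False
          then have "curve_deriv d (\<lambda>t. \<gamma> (t *s s)) \<in> ?O"
            using d inX[OF hol_curve_line line2, of s] by (intro CollectI exI conjI) auto
          then show ?thesis unfolding deriv_bform[OF c(1)] by (rule a(1))
        qed
        then show "fps_nth (jet (\<lambda>s. bform a (\<gamma> s)) s) d = 0" by (simp add: jet_nth)
      qed
      then have "a = 0" using R by (simp add: jet_regular_def)
      then show False using a(2) by (simp add: bform_def)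
    qed
  next
    assume U: "vec.span ?O = UNIV"
    show "jet_regular q \<gamma>"
      unfolding jet_regular_def
    proof (intro allI impI)
      fix a assume va: "vanish (Suc q) (\<lambda>s. bform a (\<gamma> s))"
      have "?O \<subseteq> {x. bform a x = 0}"
      proof
        fix y assume "y \<in> ?O"
        then obtain k c where kc: "1 \<le> k" "k \<le> q" "curve_germ_in X c" "y = curve_deriv k c" by blast
        note l = lift[OF kc(3)]
        have "vanish 1 (\<lambda>t. \<pi> (c t))"
          using vanish_add[OF vanish_mono[OF l(5), of 1] vanish_line[of "E *v curve_deriv 1 c"]] by simp
        from vanish_compose[OF va this]
        have v: "vanish (Suc q) (\<lambda>t. bform a (\<gamma> (\<pi> (c t))))" .
        have "\<forall>\<^sub>F t in nhds 0. bform a (\<gamma> (\<pi> (c t))) = bform a (c t)" using l(3) by eventually_elim simp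
        from vanish_cong_imp[OF v this]
        have "(deriv ^^ k) (\<lambda>t. bform a (c t)) 0 = 0"
          using vanish_analytic_iff[OF analytic_bform[OF l(1)]] kc(2) by auto
        then show "y \<in> {x. bform a x = 0}" by (simp add: deriv_bform[OF l(1)] kc(4))
      qed
      then have "vec.span ?O \<subseteq> {x. bform a x = 0}" by (rule vec.span_minimal[OF _ subspace_bform])
      then have "bform a (axis j 1) = 0" for j using U by blast
      then show "a = 0" by (simp add: vec_eq_iff)
    qed
  qed
  have curves: "has_flat_curves q 2 \<gamma> \<longleftrightarrow> (\<forall>v\<in>tangent_space X. v \<noteq> 0 \<longrightarrow>
        (\<exists>C. distinguished_curve q X C \<and> tangent_space C = vec.span {v}))" (is "_ \<longleftrightarrow> ?R")
  proof
    assume F: "has_flat_curves q 2 \<gamma>"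
    show ?R
    proof (intro ballI impI)
      fix v assume "v \<in> tangent_space X" "v \<noteq> 0"
      then obtain c where c: "curve_germ_in X c" "v = curve_deriv 1 c" by (auto simp: tangent_space_def)
      define u where "u = E *v v"
      have Du: "D *v u = v" using lift(6)[OF c(1)] by (simp add: u_def c(2))
      then have "u \<noteq> 0" using \<open>v \<noteq> 0\<close> by auto
      then obtain \<sigma> A where \<sigma>: "hol_curve \<sigma>" "vanish 2 (\<lambda>t. \<sigma> t - t *s u)" "vec.subspace A" "vec.dim A = q"
         "\<forall>\<^sub>F t in nhds 0. \<gamma> (\<sigma> t) \<in> A" using F unfolding has_flat_curves_def by blast
      note * = curve_through_param[OF p(1,2) D \<sigma>(1,2)]
      obtain C where C: "smooth_germ 1 C" "tangent_space C = vec.span {v}"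
         "\<And>S. \<forall>\<^sub>F t in nhds 0. \<gamma> (\<sigma> t) \<in> S \<Longrightarrow> germ_subset C S"
        by (rule smooth_curve_germ[OF *(1,3), of v]) (use *(4) Du \<open>v \<noteq> 0\<close> in auto)
      have "\<forall>\<^sub>F t in nhds 0. \<gamma> (\<sigma> t) \<in> X \<inter> A"
        using eventually_hol_curve[OF \<sigma>(1) *(2) p(6)] \<sigma>(5) by eventually_elim simp
      then have "germ_subset C (X \<inter> A)" by (rule C(3))
      moreover have "affine_subspace_of_dim q A"
        unfolding affine_subspace_of_dim_def using \<sigma>(3,4) by (intro exI[of _ 0] exI[of _ A]) auto
      ultimately show "\<exists>C. distinguished_curve q X C \<and> tangent_space C = vec.span {v}"
        unfolding distinguished_curve_def using C(1,2) by blast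
    qed
  next
    assume R: ?R
    show "has_flat_curves q 2 \<gamma>"
      unfolding has_flat_curves_def
    proof (intro allI impI)
      fix u :: "complex^'n" assume u: "u \<noteq> 0"
      define v where "v = D *v u"
      have v0: "v \<noteq> 0" using ED[of u] u by (auto simp: v_def)
      note * = curve_through_param[OF p(1,2) D hol_curve_line line2, of u]
      have "v \<in> tangent_space X"
        unfolding tangent_space_def v_def *(4)[symmetric] using inX[OF hol_curve_line line2] by blast
      then obtain C where C: "distinguished_curve q X C" "tangent_space C = vec.span {v}" using R v0 by blast
      then obtain A where A: "affine_subspace_of_dim q A" "germ_subset C (X \<inter> A)"
        unfolding distinguished_curve_def by blast
      have "v \<in> tangent_space C" using C(2) by (simp add: vec.span_base)
      then obtain c where c: "curve_germ_in C c" "v = curve_deriv 1 c" by (auto simp: tangent_space_def)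
      have c': "hol_curve c" "c 0 = 0" "\<forall>\<^sub>F t in nhds 0. c t \<in> C"
        using c(1) by (auto simp: curve_germ_in_def hol_curve_def)
      have ev: "\<forall>\<^sub>F t in nhds 0. c t \<in> X \<inter> A"
        using eventually_hol_curve[OF c'(1,2) A(2)[unfolded germ_subset_def]] c'(3) by eventually_elim simp
      have "curve_germ_in X c" using c(1) ev by (auto simp: curve_germ_in_def elim: eventually_mono)
      note l = lift[OF this]
      obtain p0 L where L: "vec.subspace L" "vec.dim L = q" "A = (\<lambda>x. p0 + x) ` L"
        using A(1) unfolding affine_subspace_of_dim_def by blast
      \<comment> \<open>The curve passes through 0, so the affine space contains 0 and lies in its
        own direction \<open>L\<close>.\<close>
      have "0 \<in> A" using eventually_nhds_x_imp_x[OF ev] c'(2) by simp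
      then obtain y where y: "y \<in> L" "p0 + y = 0" using L(3) by auto
      then have "p0 = - y" by (simp add: eq_neg_iff_add_eq_0)
      then have "p0 \<in> L" using y(1) L(1) by (simp add: vec.subspace_neg)
      then have AL: "A \<subseteq> L" using L(1,3) by (auto simp: vec.subspace_add)
      have "\<forall>\<^sub>F t in nhds 0. \<gamma> (\<pi> (c t)) \<in> L"
        using l(3) ev by eventually_elim (use AL in auto)
      moreover have "E *v curve_deriv 1 c = u" unfolding c(2)[symmetric] v_def by (rule ED)
      ultimately show "\<exists>\<sigma> A. hol_curve \<sigma> \<and> vanish 2 (\<lambda>t. \<sigma> t - t *s u) \<and>
        vec.subspace A \<and> vec.dim A = q \<and> (\<forall>\<^sub>F t in nhds 0. \<gamma> (\<sigma> t) \<in> A)"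
        using l(4,5) L(1,2) by (intro exI[of _ "\<lambda>t. \<pi> (c t)"] exI[of _ L]) simp
    qed
  qed
  show ?thesis unfolding property_P_def reg reg_jet curves ..
qed

section \<open>Homographies\<close>

lemma homogenize_nth [simp]: "homogenize x $ None = 1" "homogenize x $ Some i = x $ i"
  by (simp_all add: homogenize_def)

lemma sum_option: "(\<Sum>k\<in>UNIV. f k) = f None + (\<Sum>i\<in>UNIV. f (Some (i::'a::finite)))"
  by (simp add: UNIV_option_conv sum.reindex)

lemma hg_homogenize: "holomorphic_germ (\<lambda>x. (M *v homogenize x) $ k)"
  unfolding matrix_vector_mult_def vec_lambda_beta sum_option homogenize_nth by (intro hol_intros)

lemma homography_nth: "homography M x $ i = (M *v homogenize x) $ Some i / (M *v homogenize x) $ None"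
  by (simp add: homography_def dehomogenize_def)

lemma hol_homography: "homography_defined_at M 0 \<Longrightarrow> hol_map (homography M)"
  unfolding homography_defined_at_def
  by (rule hol_mapI) (simp add: homography_nth hg_divide hg_homogenize)

lemma homography_inverse:
  assumes "M' ** M = mat 1" "homography_defined_at M x"
  shows "homography M' (homography M x) = x" "homography_defined_at M' (homography M x)"
proof -
  define d where "d = (M *v homogenize x) $ None"
  have d: "d \<noteq> 0" using assms(2) by (simp add: homography_defined_at_def d_def)
  have "M *v homogenize x = d *s homogenize (homography M x)"
  proof (simp only: vec_eq_iff, rule allI)
    fix k show "(M *v homogenize x) $ k = (d *s homogenize (homography M x)) $ k"
      using d by (cases k) (auto simp: d_def homography_nth)
  qed
  then have "homogenize x = M' *v (d *s homogenize (homography M x))"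
    by (metis assms(1) matrix_vector_mul_assoc matrix_vector_mul_lid)
  then have e: "homogenize x $ k = d * (M' *v homogenize (homography M x)) $ k" for k
    by (simp add: vector_scalar_commute)
  have n: "(M' *v homogenize (homography M x)) $ None = 1 / d" using e[of None] d by (simp add: field_simps)
  then show "homography_defined_at M' (homography M x)" using d by (simp add: homography_defined_at_def)
  show "homography M' (homography M x) = x"
  proof (simp only: vec_eq_iff, rule allI)
    fix i show "homography M' (homography M x) $ i = x $ i"
      unfolding homography_nth[of M'] n using e[of "Some i"] by simp
  qed
qed

lemma eventually_homography_defined:
  assumes "homography_defined_at M 0" shows "\<forall>\<^sub>F x in nhds 0. homography_defined_at M x"
  using assms unfolding homography_defined_at_def by (intro hg_eventually_nonzero hg_homogenize)

lemma homography_inverse_germ: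
  assumes "invertible M" "homography_defined_at M 0" "homography M 0 = 0"
  obtains M' where "invertible M'" "homography_defined_at M' 0" "homography M' 0 = 0"
    "\<And>x. homography_defined_at M x \<Longrightarrow> homography M' (homography M x) = x"
    "\<forall>\<^sub>F x in nhds 0. homography M' (homography M x) = x" "\<forall>\<^sub>F x in nhds 0. homography M (homography M' x) = x"
proof -
  obtain M' where M': "M ** M' = mat 1" "M' ** M = mat 1" using assms(1) unfolding invertible_def by blast
  note * = homography_inverse[OF M'(2)] and ** = homography_inverse[OF M'(1)]
  have d: "homography_defined_at M' 0" "homography M' 0 = 0" using *[OF assms(2)] assms(3) by auto
  have inv: "invertible M'" using M' unfolding invertible_def by blast
  have e1: "\<forall>\<^sub>F x in nhds 0. homography M' (homography M x) = x"
    using eventually_homography_defined[OF assms(2)] by eventually_elim (rule *(1))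
  have e2: "\<forall>\<^sub>F x in nhds 0. homography M (homography M' x) = x"
    using eventually_homography_defined[OF d(1)] by eventually_elim (rule **(1))
  show ?thesis by (rule that[OF inv d *(1) e1 e2])
qed

lemma projectively_equivalent_param:
  assumes "projectively_equivalent X Y" "param \<gamma> Y"
  obtains M where "invertible M" "homography_defined_at M 0" "homography M 0 = 0" "param (\<lambda>s. homography M (\<gamma> s)) X"
proof -
  obtain M U where M: "invertible M" "open U" "0 \<in> U" "\<And>x. x \<in> U \<Longrightarrow> homography_defined_at M x"
    "homography M 0 = 0" "germ_eq (homography M ` (X \<inter> U)) Y"
    using assms(1) unfolding projectively_equivalent_def by blast
  note d = M(4)[OF M(3)]
  obtain M' where M': "invertible M'" "homography_defined_at M' 0" "homography M' 0 = 0"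
    "\<And>x. homography_defined_at M x \<Longrightarrow> homography M' (homography M x) = x"
    "\<forall>\<^sub>F x in nhds 0. homography M' (homography M x) = x" "\<forall>\<^sub>F x in nhds 0. homography M (homography M' x) = x"
    by (rule homography_inverse_germ[OF M(1) d M(5)]) (rule that)
  note h = hol_homography[OF d] and h' = hol_homography[OF M'(2)]
  have g: "\<forall>\<^sub>F y in nhds 0. y \<in> homography M ` (X \<inter> U) \<longleftrightarrow> y \<in> Y" using M(6) by (simp add: germ_eq_def)
  have "param (\<lambda>s. homography M' (\<gamma> s)) X"
  proof (rule param_image[OF assms(2) h' M'(3) h M(5) M'(6,5)])
    show "\<forall>\<^sub>F y in nhds 0. y \<in> Y \<longrightarrow> homography M' y \<in> X"
      using g by eventually_elim (use M(4) M'(4) in auto)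
    show "\<forall>\<^sub>F x in nhds 0. x \<in> X \<longrightarrow> homography M x \<in> Y"
      using eventually_hol_map[OF h M(5) g] eventually_nhds_in_open[OF M(2,3)] by eventually_elim blast
  qed
  with M' that show ?thesis by blast
qed

lemma param_projectively_equivalent:
  assumes "invertible M" "homography_defined_at M 0" "homography M 0 = 0" "param \<gamma> X"
  obtains Y where "param (\<lambda>s. homography M (\<gamma> s)) Y" "projectively_equivalent X Y"
proof -
  obtain M' where M': "invertible M'" "homography_defined_at M' 0" "homography M' 0 = 0"
    "\<And>x. homography_defined_at M x \<Longrightarrow> homography M' (homography M x) = x"
    "\<forall>\<^sub>F x in nhds 0. homography M' (homography M x) = x" "\<forall>\<^sub>F x in nhds 0. homography M (homography M' x) = x"
    by (rule homography_inverse_germ[OF assms(1-3)]) (rule that)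
  note h = hol_homography[OF assms(2)] and h' = hol_homography[OF M'(2)]
  obtain U where U: "open U" "0 \<in> U" "\<And>x. x \<in> U \<Longrightarrow> homography_defined_at M x"
    using eventually_homography_defined[OF assms(2)] unfolding eventually_nhds by blast
  define Y where "Y = homography M ` (X \<inter> U)"
  have "param (\<lambda>s. homography M (\<gamma> s)) Y"
  proof (rule param_image[OF assms(4) h assms(3) h' M'(3) M'(5,6)])
    show "\<forall>\<^sub>F x in nhds 0. x \<in> X \<longrightarrow> homography M x \<in> Y"
      using eventually_nhds_in_open[OF U(1,2)] by eventually_elim (auto simp: Y_def)
    show "\<forall>\<^sub>F y in nhds 0. y \<in> Y \<longrightarrow> homography M' y \<in> X"
      by (rule always_eventually) (use U(3) M'(4) in \<open>auto simp: Y_def\<close>)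
  qed
  moreover have "projectively_equivalent X Y"
    unfolding projectively_equivalent_def
    by (rule exI[of _ M], rule exI[of _ U]) (use assms U in \<open>auto simp: germ_eq_def Y_def\<close>)
  ultimately show ?thesis by (rule that)
qed

definition lin_block :: "complex^('m::finite option)^('m option) \<Rightarrow> complex^'m^'m" where
  "lin_block M = (\<chi> i j. M $ Some i $ Some j)"

text \<open>Fixing 0 leaves only the top entry in the column of \<open>None\<close>, so the
  homography is a linear map followed by division by a scalar function. It therefore takes linear
  subspaces into linear subspaces, which is what flat curves require.\<close>

lemma homography_fixing_0:
  assumes "homography_defined_at M 0" "homography M 0 = 0"
  shows "M $ None $ None \<noteq> 0" "M $ Some i $ None = 0"
    "homography M x = (1 / (M *v homogenize x) $ None) *s (lin_block M *v x)"
proof -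
  have e: "(M *v homogenize 0) $ k = M $ k $ None" for k
    by (simp add: matrix_vector_mult_def sum_option)
  show n: "M $ None $ None \<noteq> 0" using assms(1) by (simp add: homography_defined_at_def e)
  have z: "M $ Some i $ None = 0" for i
  proof -
    have "homography M 0 $ i = 0" by (simp only: assms(2) zero_index)
    then show ?thesis using n by (simp add: homography_nth e)
  qed
  then show "M $ Some i $ None = 0" .
  show "homography M x = (1 / (M *v homogenize x) $ None) *s (lin_block M *v x)"
  proof (simp only: vec_eq_iff, rule allI)
    fix i
    have "(M *v homogenize x) $ Some i = (lin_block M *v x) $ i"
      by (simp add: matrix_vector_mult_def sum_option z lin_block_def)
    then show "homography M x $ i = ((1 / (M *v homogenize x) $ None) *s (lin_block M *v x)) $ i"
      by (simp add: homography_nth)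
  qed
qed

text \<open>A kernel vector of the block extends to one of \<open>M\<close>: the entry at
  \<open>None\<close> is chosen to cancel the row of \<open>None\<close>, and the other rows do not
  see it.\<close>

lemma invertible_lin_block:
  assumes "invertible M" "homography_defined_at M 0" "homography M 0 = 0"
  shows "invertible (lin_block M)"
  unfolding invertible_left_inverse matrix_left_invertible_ker
proof (intro allI impI)
  fix x assume x: "lin_block M *v x = 0"
  note h = homography_fixing_0[OF assms(2,3)]
  define X where "X = (\<chi> k. case k of None \<Rightarrow> - (\<Sum>j\<in>UNIV. M $ None $ Some j * x $ j) / M $ None $ None | Some j \<Rightarrow> x $ j)"
  have "(M *v X) $ k = 0" for k
  proof (cases k)
    case None
    then show ?thesis using h(1) by (simp add: matrix_vector_mult_def sum_option X_def)
  next
    case (Some i)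
    have "(lin_block M *v x) $ i = 0" using x by simp
    then show ?thesis using Some by (simp add: matrix_vector_mult_def sum_option X_def h(2) lin_block_def)
  qed
  then have "M *v X = 0" by (simp add: vec_eq_iff)
  then have "X = 0" using assms(1) unfolding invertible_left_inverse matrix_left_invertible_ker by blast
  then have "X $ Some j = 0" for j by simp
  then show "x = 0" by (simp add: X_def vec_eq_iff)
qed

section \<open>Invariance of regularity and of flat curves\<close>

lemma invertible_surj: "invertible (A :: complex^'n::finite^'n) \<Longrightarrow> \<exists>x. A *v x = y"
  unfolding invertible_def by (metis matrix_vector_mul_assoc matrix_vector_mul_lid)

text \<open>After multiplication by \<open>h\<close>, a form \<open>a\<close> on \<delta> becomes
  the form \<open>transpose A *v a\<close> on \<gamma>; boundedness of \<open>h\<close> preserves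
  the order of vanishing.\<close>

lemma jet_regular_scaled:
  fixes \<gamma> \<delta> :: "complex^'n::finite \<Rightarrow> complex^'m::finite" and A :: "complex^'m^'m"
  assumes "jet_regular q \<gamma>" "invertible A" "vanish 0 h" "\<forall>\<^sub>F s in nhds 0. h s *s \<delta> s = A *v \<gamma> s"
  shows "jet_regular q \<delta>"
  unfolding jet_regular_def
proof (intro allI impI)
  fix a assume "vanish (Suc q) (\<lambda>s. bform a (\<delta> s))"
  then have v: "vanish (Suc q) (\<lambda>s. bform a (\<delta> s) * h s)" using assms(3) by (rule vanish_mult0)
  define b where "b = transpose A *v a"
  have b: "bform b x = bform a (A *v x)" for x
    unfolding b_def bform_def matrix_vector_mult_def transpose_def
    by (simp add: sum_distrib_left sum_distrib_right) (subst sum.swap, simp add: mult_ac)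
  have "\<forall>\<^sub>F s in nhds 0. bform a (\<delta> s) * h s = bform b (\<gamma> s)"
    using assms(4) by eventually_elim (metis b bform_smult mult.commute)
  from vanish_cong_imp[OF v this] have "b = 0" using assms(1) by (simp add: jet_regular_def)
  then have 0: "bform a (A *v x) = 0" for x using b[of x] by (simp add: bform_def)
  have "bform a (axis j 1) = 0" for j using invertible_surj[OF assms(2), of "axis j 1"] 0 by metis
  then show "a = 0" by (simp add: vec_eq_iff)
qed

lemma jet_regular_reparam:
  assumes "jet_regular q \<gamma>" "hol_map \<sigma>" "\<sigma> 0 = 0" "\<forall>\<^sub>F z in nhds 0. \<tau> (\<sigma> z) = z"
  shows "jet_regular q (\<lambda>s. \<gamma> (\<tau> s))"
  unfolding jet_regular_def
proof (intro allI impI)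
  fix a assume v: "vanish (Suc q) (\<lambda>s. bform a (\<gamma> (\<tau> s)))"
  have "vanish (Suc q) (\<lambda>s. bform a (\<gamma> (\<tau> (\<sigma> s))))"
    by (rule vanish_compose[OF v vanish_1_hol_map[OF assms(2,3)]])
  moreover have "\<forall>\<^sub>F s in nhds 0. bform a (\<gamma> (\<tau> (\<sigma> s))) = bform a (\<gamma> s)"
    using assms(4) by eventually_elim simp
  ultimately have "vanish (Suc q) (\<lambda>s. bform a (\<gamma> s))" by (rule vanish_cong_imp)
  then show "a = 0" using assms(1) by (simp add: jet_regular_def)
qed

lemma has_flat_curves_scaled:
  fixes \<gamma> \<delta> :: "complex^'n::finite \<Rightarrow> complex^'m::finite" and A :: "complex^'m^'m"
  assumes "has_flat_curves q (Suc m) \<gamma>" "invertible A" "\<forall>\<^sub>F s in nhds 0. \<exists>c. \<delta> s = c *s (A *v \<gamma> s)"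
  shows "has_flat_curves q (Suc m) \<delta>"
  unfolding has_flat_curves_def
proof (intro allI impI)
  fix u :: "complex^'n" assume "u \<noteq> 0"
  then obtain \<sigma> L where L: "hol_curve \<sigma>" "vanish (Suc m) (\<lambda>t. \<sigma> t - t *s u)" "vec.subspace L" "vec.dim L = q"
    "\<forall>\<^sub>F t in nhds 0. \<gamma> (\<sigma> t) \<in> L"
    using assms(1) unfolding has_flat_curves_def by blast
  have s0: "\<sigma> 0 = 0" using vanish_at_0[OF L(2)] by simp
  let ?L = "(*v) A ` L"
  have sub: "vec.subspace ?L" by (rule vec.subspace_image[OF L(3)])
  have inj: "inj ((*v) A)" using assms(2) unfolding invertible_left_inverse matrix_left_invertible_injective .
  have "vec.dim ?L = vec.dim L"
    by (rule vec.dim_image_eq[OF matrix_vector_mul_linear_gen]) (use inj in \<open>blast intro: inj_on_subset\<close>)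
  moreover have "\<forall>\<^sub>F t in nhds 0. \<delta> (\<sigma> t) \<in> ?L"
    using L(5) eventually_hol_curve[OF L(1) s0 assms(3)]
    by eventually_elim (use vec.subspace_scale[OF sub] in auto)
  ultimately show "\<exists>\<sigma> A. hol_curve \<sigma> \<and> vanish (Suc m) (\<lambda>t. \<sigma> t - t *s u) \<and>
     vec.subspace A \<and> vec.dim A = q \<and> (\<forall>\<^sub>F t in nhds 0. \<delta> (\<sigma> t) \<in> A)"
    using L sub by (intro exI[of _ \<sigma>] exI[of _ ?L]) simp
qed

lemma has_flat_curves_linear:
  fixes \<gamma> :: "complex^'n::finite \<Rightarrow> complex^'m::finite" and A :: "complex^'m^'m"
  shows "has_flat_curves q (Suc m) \<gamma> \<Longrightarrow> invertible A \<Longrightarrow> has_flat_curves q (Suc m) (\<lambda>s. A *v \<gamma> s)"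
  by (erule (1) has_flat_curves_scaled) (auto intro!: always_eventually exI[of _ 1])

lemma regular_flat_homography:
  assumes M: "invertible M" "homography_defined_at M 0" "homography M 0 = 0"
    and g: "hol_map \<gamma>" "\<gamma> 0 = 0"
  shows "jet_regular q \<gamma> \<Longrightarrow> jet_regular q (\<lambda>s. homography M (\<gamma> s))"
    "has_flat_curves q (Suc m) \<gamma> \<Longrightarrow> has_flat_curves q (Suc m) (\<lambda>s. homography M (\<gamma> s))"
proof -
  note h = homography_fixing_0(3)[OF M(2,3)] and inv = invertible_lin_block[OF M]
  show "has_flat_curves q (Suc m) \<gamma> \<Longrightarrow> has_flat_curves q (Suc m) (\<lambda>s. homography M (\<gamma> s))"
    by (erule has_flat_curves_scaled[OF _ inv]) (rule always_eventually, use h in blast)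
  assume R: "jet_regular q \<gamma>"
  show "jet_regular q (\<lambda>s. homography M (\<gamma> s))"
  proof (rule jet_regular_scaled[OF R inv])
    show "vanish 0 (\<lambda>s. (M *v homogenize (\<gamma> s)) $ None)"
      by (rule vanish_0_hg[OF hg_compose[OF hg_homogenize g]])
    have "\<forall>\<^sub>F s in nhds 0. homography_defined_at M (\<gamma> s)"
      by (rule eventually_hol_map[OF g eventually_homography_defined[OF M(2)]])
    then show "\<forall>\<^sub>F s in nhds 0. (M *v homogenize (\<gamma> s)) $ None *s homography M (\<gamma> s) = lin_block M *v \<gamma> s"
      by eventually_elim (simp add: h homography_defined_at_def vector_smult_assoc)
  qed
qed

section \<open>Linear normalization of jets and rigidity of flat curves\<close>

section \<open>Normalized jets\<close>

lemma finite_multi_indices: "finite (multi_indices q)"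
  by (rule finite_subset[OF _ finite_mdeg_le[of q]]) (auto simp: multi_indices_def)

lemma monomials_idx_independent:
  fixes idx :: "'m::finite \<Rightarrow> 'n::finite \<Rightarrow> nat"
  assumes "inj_on idx J" "\<And>s. (\<Sum>j\<in>J. c j * mpow s (idx j)) = (0::complex)" "j \<in> J"
  shows "c j = 0"
proof -
  have "(\<Sum>\<alpha>\<in>idx ` J. c (inv_into J idx \<alpha>) * mpow s \<alpha>) = 0" for s
    using assms(2)[of s] by (subst sum.reindex[OF assms(1)]) (simp add: assms(1))
  then have "c (inv_into J idx (idx j)) = 0"
    by (rule monomials_independent[rotated]) (use assms(3) in auto)
  then show ?thesis using assms(1,3) by simp
qed

text \<open>Among the nonzero coefficients of a form those of lowest degree decide: their monomials
  make up the homogeneous part of that degree, which would have to vanish, against the independence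
  of monomials. Each coordinate is controlled only up to its own degree, which is what normal forms
  provide.\<close>

lemma jet_regular_triangular:
  fixes idx :: "'m::finite \<Rightarrow> 'n::finite \<Rightarrow> nat" and \<gamma> :: "complex^'n \<Rightarrow> complex^'m"
  assumes idx: "bij_betw idx UNIV (multi_indices q)"
    and v: "\<And>j. vanish (Suc (mdeg (idx j))) (\<lambda>s. \<gamma> s $ j - mpow s (idx j))"
  shows "jet_regular q \<gamma>"
  unfolding jet_regular_def
proof (intro allI impI, rule ccontr)
  fix a assume va: "vanish (Suc q) (\<lambda>s. bform a (\<gamma> s))" and "a \<noteq> 0"
  then obtain j0 where "a $ j0 \<noteq> 0" by (auto simp: vec_eq_iff)
  then obtain j where j: "a $ j \<noteq> 0" and jm: "\<And>i. a $ i \<noteq> 0 \<Longrightarrow> mdeg (idx j) \<le> mdeg (idx i)"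
    using ex_has_least_nat[of "\<lambda>i. a $ i \<noteq> 0" j0 "\<lambda>i. mdeg (idx i)"] by blast
  define k where "k = mdeg (idx j)"
  have kq: "k \<le> q" using idx by (auto simp: k_def bij_betw_def multi_indices_def)
  let ?J = "{i. mdeg (idx i) = k}"
  define P where "P = (\<lambda>s. \<Sum>i\<in>?J. a $ i * mpow s (idx i))"
  have "hpoly k P" unfolding P_def by (intro hpoly_sum hpoly_cmult hpoly_mpow) simp
  have "vanish (Suc k) (\<lambda>s. \<Sum>i\<in>UNIV. a $ i * \<gamma> s $ i - (if i \<in> ?J then a $ i * mpow s (idx i) else 0))"
  proof (rule vanish_sum)
    fix i
    consider "a $ i = 0" | "i \<in> ?J" | "a $ i \<noteq> 0" "mdeg (idx i) > k" using jm[of i] by (force simp: k_def)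
    then show "vanish (Suc k) (\<lambda>s. a $ i * \<gamma> s $ i - (if i \<in> ?J then a $ i * mpow s (idx i) else 0))"
    proof cases
      case 1
      then show ?thesis by (simp cong: if_cong)
    next
      case 2
      then have "vanish (Suc k) (\<lambda>s. a $ i * (\<gamma> s $ i - mpow s (idx i)))" using v[of i] by (intro vanish_cmult) auto
      then show ?thesis using 2 by (simp add: right_diff_distrib)
    next
      case 3
      have "vanish (mdeg (idx i)) (\<lambda>s. (\<gamma> s $ i - mpow s (idx i)) + mpow s (idx i))"
        by (rule vanish_add[OF vanish_mono[OF v] vanish_mpow]) simp
      then have vi: "vanish (mdeg (idx i)) (\<lambda>s. \<gamma> s $ i)" by simp
      have "Suc k \<le> mdeg (idx i)" using 3(2) by linarith
      then have "vanish (Suc k) (\<lambda>s. \<gamma> s $ i)" by (rule vanish_mono[OF vi])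
      then show ?thesis using 3 vanish_cmult by auto
    qed
  qed
  then have vP: "vanish (Suc k) (\<lambda>s. bform a (\<gamma> s) - P s)"
    by (simp add: sum_subtractf bform_def P_def sum.If_cases)
  have "vanish (Suc k) (\<lambda>s. bform a (\<gamma> s))" by (rule vanish_mono[OF va]) (use kq in simp)
  from vanish_diff[OF this vP] have "vanish (Suc k) P" by simp
  then have "P s = 0" for s by (rule hpoly_vanish_zero[OF \<open>hpoly k P\<close>])
  then have "a $ j = 0"
    unfolding P_def
    by (rule monomials_idx_independent[where J="?J", rotated])
       (use idx in \<open>auto simp: k_def bij_betw_def intro: inj_on_subset\<close>)
  then show False using j by simp
qed

definition normal_jet :: "('m::finite \<Rightarrow> 'n::finite \<Rightarrow> nat) \<Rightarrow> nat \<Rightarrow> (complex^'n \<Rightarrow> complex^'m) \<Rightarrow> bool" where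
  "normal_jet idx q \<gamma> \<longleftrightarrow> (\<forall>j. vanish (Suc q) (\<lambda>s. \<gamma> s $ j - mpow s (idx j)))"

lemma jet_regular_normal_jet:
  assumes "bij_betw idx UNIV (multi_indices q)" "normal_jet idx q \<gamma>" shows "jet_regular q \<gamma>"
proof (rule jet_regular_triangular[OF assms(1)])
  fix j
  have "mdeg (idx j) \<le> q" using assms(1) by (auto simp: bij_betw_def multi_indices_def)
  then show "vanish (Suc (mdeg (idx j))) (\<lambda>s. \<gamma> s $ j - mpow s (idx j))"
    using assms(2) by (auto simp: normal_jet_def intro: vanish_mono)
qed

lemma hg_taylor_monomials:
  assumes "holomorphic_germ f" "f 0 = 0"
  obtains c where "vanish (Suc q) (\<lambda>s. f s - (\<Sum>\<alpha>\<in>multi_indices q. c \<alpha> * mpow s \<alpha>))"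
proof -
  have "\<forall>d. \<exists>c. \<forall>s. fps_nth (jet f s) d = (\<Sum>\<alpha>\<in>{\<alpha>. mdeg \<alpha> = d}. c \<alpha> * mpow s \<alpha>)"
    using hpoly_jet[OF assms(1)] unfolding hpoly_def by blast
  from choice[OF this] obtain c where c: "\<And>d s. fps_nth (jet f s) d = (\<Sum>\<alpha>\<in>{\<alpha>. mdeg \<alpha> = d}. c d \<alpha> * mpow s \<alpha>)"
    by blast
  have "(\<Sum>d<Suc q. fps_nth (jet f s) d) = (\<Sum>\<alpha>\<in>multi_indices q. c (mdeg \<alpha>) \<alpha> * mpow s \<alpha>)" for s
  proof -
    have "(\<Sum>d<Suc q. fps_nth (jet f s) d) = (\<Sum>d\<in>{1..q}. fps_nth (jet f s) d)"
      by (rule sum.mono_neutral_right) (auto simp: jet_nth assms(2) Suc_le_eq)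
    also have "\<dots> = (\<Sum>d\<in>{1..q}. \<Sum>\<alpha>\<in>{\<alpha>. mdeg \<alpha> = d}. c (mdeg \<alpha>) \<alpha> * mpow s \<alpha>)"
      by (intro sum.cong refl) (simp add: c)
    also have "\<dots> = (\<Sum>d\<in>{1..q}. \<Sum>\<alpha>\<in>{\<alpha>\<in>multi_indices q. mdeg \<alpha> = d}. c (mdeg \<alpha>) \<alpha> * mpow s \<alpha>)"
      by (intro sum.cong refl) (auto simp: multi_indices_def)
    also have "\<dots> = (\<Sum>\<alpha>\<in>multi_indices q. c (mdeg \<alpha>) \<alpha> * mpow s \<alpha>)"
      by (rule sum.group[OF finite_multi_indices]) (auto simp: multi_indices_def)
    finally show ?thesis .
  qed
  then have "vanish (Suc q) (\<lambda>s. f s - (\<Sum>\<alpha>\<in>multi_indices q. c (mdeg \<alpha>) \<alpha> * mpow s \<alpha>))"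
    using taylor[OF assms(1), of "Suc q"] by simp
  then show ?thesis by (rule that)
qed

text \<open>Coordinates and monomials share an index set, so the Taylor coefficients form a square
  matrix \<open>Y\<close>. A vector killed by its transpose is a form of order q + 1 along \<gamma>;
  regularity thus makes \<open>Y\<close> invertible, and \<open>T\<close> is its inverse.\<close>

theorem jet_regular_normalize:
  fixes idx :: "'m::finite \<Rightarrow> 'n::finite \<Rightarrow> nat" and \<gamma> :: "complex^'n \<Rightarrow> complex^'m"
  assumes idx: "bij_betw idx UNIV (multi_indices q)"
    and g: "hol_map \<gamma>" "\<gamma> 0 = 0" and R: "jet_regular q \<gamma>"
  obtains T where "invertible T" "normal_jet idx q (\<lambda>s. T *v \<gamma> s)"
proof -
  have "\<exists>c. vanish (Suc q) (\<lambda>s. \<gamma> s $ j - (\<Sum>\<alpha>\<in>multi_indices q. c \<alpha> * mpow s \<alpha>))" for j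
    by (rule hg_taylor_monomials[of "\<lambda>s. \<gamma> s $ j"]) (use g in \<open>auto simp: hol_map_def\<close>)
  then have "\<forall>j. \<exists>c. vanish (Suc q) (\<lambda>s. \<gamma> s $ j - (\<Sum>\<alpha>\<in>multi_indices q. c \<alpha> * mpow s \<alpha>))" by blast
  from choice[OF this] obtain c where c: "\<And>j. vanish (Suc q) (\<lambda>s. \<gamma> s $ j - (\<Sum>\<alpha>\<in>multi_indices q. c j \<alpha> * mpow s \<alpha>))"
    by blast
  define Y :: "complex^'m^'m" where "Y = (\<chi> j l. c j (idx l))"
  define V where "V = (\<lambda>s. \<chi> l. mpow s (idx l))"
  have "(\<Sum>\<alpha>\<in>multi_indices q. c j \<alpha> * mpow s \<alpha>) = (Y *v V s) $ j" for j s
    unfolding Y_def V_def matrix_vector_mult_def by (simp add: sum.reindex_bij_betw[OF idx, symmetric])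
  then have YV: "vanish (Suc q) (\<lambda>s. \<gamma> s - Y *v V s)" using c by (simp add: vanish_vec_iff)
  have "invertible (transpose Y)"
    unfolding invertible_left_inverse matrix_left_invertible_ker
  proof (intro allI impI)
    fix a assume a: "transpose Y *v a = 0"
    have b: "bform (transpose Y *v a) x = bform a (Y *v x)" for x
      unfolding bform_def matrix_vector_mult_def transpose_def
      by (simp add: sum_distrib_left sum_distrib_right) (subst sum.swap, simp add: mult_ac)
    have "bform a (Y *v x) = 0" for x using b[of x] a by (simp add: bform_def)
    then have "vanish (Suc q) (\<lambda>s. bform a (\<gamma> s))"
      using vanish_bform[OF YV, of a] by (simp add: bform_diff)
    then show "a = 0" using R by (simp add: jet_regular_def)
  qed
  then obtain B where "B ** transpose Y = mat 1" unfolding invertible_left_inverse by blast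
  then have "transpose (B ** transpose Y) = mat 1" by (simp add: transpose_mat)
  then have "invertible Y"
    unfolding matrix_transpose_mul transpose_transpose invertible_right_inverse by blast
  then obtain T where T: "T ** Y = mat 1" "Y ** T = mat 1" unfolding invertible_def by blast
  have "vanish (Suc q) (\<lambda>s. T *v \<gamma> s - V s)"
    using vanish_matrix[OF YV, of T] by (simp add: matrix_vector_mult_diff_distrib matrix_vector_mul_assoc T)
  then have "normal_jet idx q (\<lambda>s. T *v \<gamma> s)" by (simp add: normal_jet_def vanish_vec_iff V_def)
  moreover have "invertible T" using T unfolding invertible_def by blast
  ultimately show ?thesis using that by blast
qed

section \<open>A dimension count along flat curves\<close>

text \<open>Each vector is detected by a form that kills all earlier ones, so it lies outside their
  span.\<close>

lemma dim_triangular: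
  fixes x :: "nat \<Rightarrow> complex^'m::finite"
  assumes "\<And>k. 1 \<le> k \<Longrightarrow> k \<le> n \<Longrightarrow> \<exists>a. bform a (x k) \<noteq> 0 \<and> (\<forall>d. 1 \<le> d \<longrightarrow> d < k \<longrightarrow> bform a (x d) = 0)"
  shows "vec.dim (x ` {1..n}) = n"
  using assms
proof (induction n)
  case 0
  then show ?case by simp
next
  case (Suc n)
  obtain a where a: "bform a (x (Suc n)) \<noteq> 0" "\<forall>d. 1 \<le> d \<longrightarrow> d < Suc n \<longrightarrow> bform a (x d) = 0"
    using Suc.prems[of "Suc n"] by auto
  have "vec.span (x ` {1..n}) \<subseteq> {y. bform a y = 0}"
    by (rule vec.span_minimal[OF _ subspace_bform]) (use a(2) in auto)
  then have "x (Suc n) \<notin> vec.span (x ` {1..n})" using a(1) by blast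
  moreover have "vec.dim (x ` {1..n}) = n" using Suc by simp
  moreover have "x ` {1..Suc n} = insert (x (Suc n)) (x ` {1..n})" by (simp add: atLeastAtMostSuc_conv)
  ultimately show ?case by (simp add: vec.dim_insert)
qed

lemma curve_deriv_leading:
  assumes "hol_curve e" "vanish (Suc k) (\<lambda>t. bform a (e t) - c * t ^ k)"
  shows "bform a (curve_deriv k e) = c * fact k" "d < k \<Longrightarrow> bform a (curve_deriv d e) = 0"
proof -
  have an: "(\<lambda>t::complex. c * t ^ k) analytic_on {0}" by (auto intro!: analytic_intros)
  have eq: "bform a (curve_deriv d e) = (if d = k then c * fact k else 0)" if "d \<le> k" for d
    using vanish_deriv_eq[OF analytic_bform[OF assms(1)] an vanish_mono[OF assms(2)], of d] that
    by (simp add: deriv_bform[OF assms(1)] higher_deriv_power_0)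
  show "bform a (curve_deriv k e) = c * fact k" "d < k \<Longrightarrow> bform a (curve_deriv d e) = 0"
    using eq by auto
qed

text \<open>Otherwise \<open>e\<close> would have \<open>q + 1\<close> linearly independent Taylor coefficients in \<open>A\<close>.\<close>

theorem flat_curve_relation:
  fixes e :: "complex \<Rightarrow> complex^'m::finite"
  assumes e: "hol_curve e" and A: "vec.subspace A" "vec.dim A = q" "\<forall>\<^sub>F t in nhds 0. e t \<in> A"
    and lead: "\<And>k. 1 \<le> k \<Longrightarrow> k \<le> q \<Longrightarrow> \<exists>a c. c \<noteq> 0 \<and> vanish (Suc k) (\<lambda>t. bform a (e t) - c * t ^ k)"
    and L: "vanish (Suc q) (\<lambda>t. bform b (e t))"
  shows "\<forall>\<^sub>F t in nhds 0. bform b (e t) = 0"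
proof (rule analytic_flat_zero[OF analytic_bform[OF e]], rule ccontr)
  fix K assume "\<not> vanish K (\<lambda>t. bform b (e t))"
  then obtain r where r: "bform b (curve_deriv r e) \<noteq> 0"
    unfolding vanish_analytic_iff[OF analytic_bform[OF e]] deriv_bform[OF e] by blast
  have bz: "bform b (curve_deriv d e) = 0" if "d \<le> q" for d
    using L that unfolding vanish_analytic_iff[OF analytic_bform[OF e]] deriv_bform[OF e] by simp
  \<comment> \<open>Slot q + 1 holds the derivative of the order \<open>r\<close> at which
    \<open>b\<close> first fails to be known to vanish; there \<open>b\<close> itself is the
    detecting form, as it kills all derivatives of order at most q.\<close>
  define x where "x = (\<lambda>k. curve_deriv (if k = Suc q then r else k) e)"
  have "vec.dim (x ` {1..Suc q}) = Suc q"
  proof (rule dim_triangular)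
    fix k assume k: "1 \<le> k" "k \<le> Suc q"
    show "\<exists>a. bform a (x k) \<noteq> 0 \<and> (\<forall>d. 1 \<le> d \<longrightarrow> d < k \<longrightarrow> bform a (x d) = 0)"
    proof (cases "k = Suc q")
      case True
      then show ?thesis using r bz by (intro exI[of _ b]) (simp add: x_def)
    next
      case False
      then obtain a c where a: "c \<noteq> 0" "vanish (Suc k) (\<lambda>t. bform a (e t) - c * t ^ k)"
        using lead[of k] k by auto
      have "bform a (curve_deriv k e) \<noteq> 0" using curve_deriv_leading(1)[OF e a(2)] a(1) by simp
      then show ?thesis
        using curve_deriv_leading(2)[OF e a(2)] False k by (intro exI[of _ a]) (simp add: x_def)
    qed
  qed
  moreover have "x ` {1..Suc q} \<subseteq> A"
    using curve_deriv_in_subspace[OF e A(1,3)] by (auto simp: x_def)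
  then have "vec.dim (x ` {1..Suc q}) \<le> vec.dim A" by (rule vec.dim_subset)
  ultimately show False unfolding A(2) by linarith
qed

lemma bform_two: "bform (a *s axis i 1 - b *s axis j 1) x = a * x $ i - b * x $ j"
proof -
  have "bform (a *s axis i 1 - b *s axis j 1) x = bform x (a *s axis i 1 - b *s axis j 1)"
    unfolding bform_def by (simp add: mult.commute)
  then show ?thesis by (simp add: bform_diff bform_smult)
qed

lemma bform_one: "bform (axis i 1) x = x $ i"
  using bform_two[of 1 i 0 i x] by simp

section \<open>Perturbation of monomials\<close>

text \<open>Telescoping: y^(n+1) - x^(n+1) = (y - x) y^n + x (y^n - x^n). Replacing one factor of
  order 1 by a difference of order r + 1 gains r.\<close>

lemma vanish_power_diff:
  fixes x y :: "'c::real_normed_vector \<Rightarrow> complex"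
  assumes "vanish 1 x" "vanish (Suc r) (\<lambda>t. y t - x t)"
  shows "vanish (n + r) (\<lambda>t. y t ^ n - x t ^ n)"
proof (induction n)
  case 0 then show ?case by simp
next
  case (Suc n)
  have y: "vanish 1 y" using vanish_add[OF vanish_mono[OF assms(2), of 1] assms(1)] by simp
  have "vanish (Suc r + n * 1) (\<lambda>t. (y t - x t) * y t ^ n)"
    by (intro vanish_mult vanish_pow assms y)
  moreover have "vanish (1 + (n + r)) (\<lambda>t. x t * (y t ^ n - x t ^ n))"
    by (intro vanish_mult assms Suc.IH)
  ultimately have "vanish (Suc n + r) (\<lambda>t. (y t - x t) * y t ^ n + x t * (y t ^ n - x t ^ n))"
    by (intro vanish_add) (simp_all add: add_ac)
  then show ?case by (simp add: algebra_simps)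
qed

lemma vanish_mpow_diff:
  fixes x y :: "'c::real_normed_vector \<Rightarrow> complex^'n::finite"
  assumes x: "vanish 1 x" and d: "vanish (Suc r) (\<lambda>t. y t - x t)"
  shows "vanish (mdeg \<alpha> + r) (\<lambda>t. mpow (y t) \<alpha> - mpow (x t) \<alpha>)"
proof -
  have y: "vanish 1 y" using vanish_add[OF vanish_mono[OF d, of 1] x] by simp
  have xi: "vanish 1 (\<lambda>t. x t $ i)" and yi: "vanish 1 (\<lambda>t. y t $ i)" and di: "vanish (Suc r) (\<lambda>t. y t $ i - x t $ i)" for i
    using x y d by (simp_all add: vanish_vec_iff)
  have "vanish ((\<Sum>i\<in>I. \<alpha> i) + r) (\<lambda>t. (\<Prod>i\<in>I. y t $ i ^ \<alpha> i) - (\<Prod>i\<in>I. x t $ i ^ \<alpha> i))" for I :: "'n set"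
    using finite[of I]
  proof (induction I rule: finite_induct)
    case empty then show ?case by simp
  next
    case (insert k I)
    have "vanish ((\<alpha> k + r) + (\<Sum>i\<in>I. \<alpha> i * 1)) (\<lambda>t. (y t $ k ^ \<alpha> k - x t $ k ^ \<alpha> k) * (\<Prod>i\<in>I. y t $ i ^ \<alpha> i))"
      by (intro vanish_mult vanish_power_diff vanish_prod vanish_pow xi yi di)
    moreover have "vanish (\<alpha> k * 1 + ((\<Sum>i\<in>I. \<alpha> i) + r)) (\<lambda>t. x t $ k ^ \<alpha> k * ((\<Prod>i\<in>I. y t $ i ^ \<alpha> i) - (\<Prod>i\<in>I. x t $ i ^ \<alpha> i)))"
      by (intro vanish_mult vanish_pow xi insert.IH)
    ultimately have "vanish ((\<Sum>i\<in>insert k I. \<alpha> i) + r) (\<lambda>t. (y t $ k ^ \<alpha> k - x t $ k ^ \<alpha> k) * (\<Prod>i\<in>I. y t $ i ^ \<alpha> i)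
        + x t $ k ^ \<alpha> k * ((\<Prod>i\<in>I. y t $ i ^ \<alpha> i) - (\<Prod>i\<in>I. x t $ i ^ \<alpha> i)))"
      using insert.hyps by (intro vanish_add) (simp_all add: add_ac)
    then show ?case using insert.hyps by (simp add: algebra_simps)
  qed
  from this[of UNIV] show ?thesis by (simp add: mdeg_def mpow_def)
qed

lemma vanish_hpoly_diff:
  fixes x y :: "'c::real_normed_vector \<Rightarrow> complex^'n::finite"
  assumes "hpoly d P" "vanish 1 x" "vanish (Suc r) (\<lambda>t. y t - x t)"
  shows "vanish (d + r) (\<lambda>t. P (y t) - P (x t))"
proof -
  obtain c where c: "\<And>s. P s = (\<Sum>\<alpha>\<in>{\<alpha>. mdeg \<alpha> = d}. c \<alpha> * mpow s \<alpha>)" using assms(1) unfolding hpoly_def by blast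
  have "vanish (d + r) (\<lambda>t. \<Sum>\<alpha>\<in>{\<alpha>. mdeg \<alpha> = d}. c \<alpha> * (mpow (y t) \<alpha> - mpow (x t) \<alpha>))"
    by (intro vanish_sum vanish_cmult) (use vanish_mpow_diff[OF assms(2,3)] in auto)
  then show ?thesis by (simp add: c right_diff_distrib sum_subtractf)
qed

text \<open>Calculation with dual numbers: f = t^k (a + b e) with e = t^r, modulo t^(k+r+1). For r
  >= 1 the square of e is negligible, and products obey the Leibniz rule.\<close>

definition two_terms :: "nat \<Rightarrow> nat \<Rightarrow> complex \<Rightarrow> complex \<Rightarrow> (complex \<Rightarrow> complex) \<Rightarrow> bool" where
  "two_terms r k a b f \<longleftrightarrow> vanish (k + r + 1) (\<lambda>t. f t - (a * t ^ k + b * t ^ (k + r)))"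

lemma two_terms_vanish: assumes "two_terms r k a b f" shows "vanish k f"
proof -
  have "vanish k (\<lambda>t. (f t - (a * t ^ k + b * t ^ (k + r))) + (a * t ^ k + b * t ^ (k + r)))"
    by (intro vanish_add vanish_cmult vanish_power vanish_mono[OF assms[unfolded two_terms_def]]
        vanish_mono[OF vanish_power[of "k + r"]]) auto
  then show ?thesis by simp
qed

lemma two_terms_mult:
  assumes r: "1 \<le> r" and f: "two_terms r k a b f" and g: "two_terms r l a' b' g"
  shows "two_terms r (k + l) (a * a') (a * b' + a' * b) (\<lambda>t. f t * g t)"
proof -
  let ?F = "\<lambda>t. a * t ^ k + b * t ^ (k + r)" and ?G = "\<lambda>t. a' * t ^ l + b' * t ^ (l + r)"
  have F: "vanish k ?F" by (intro vanish_add vanish_cmult vanish_power vanish_mono[OF vanish_power[of "k + r"]]) auto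
  have 1: "vanish (k + l + r + 1) (\<lambda>t. (f t - ?F t) * g t)"
    using vanish_mult[OF f[unfolded two_terms_def] two_terms_vanish[OF g]] by (simp add: add_ac)
  have 2: "vanish (k + l + r + 1) (\<lambda>t. ?F t * (g t - ?G t))"
    using vanish_mult[OF F g[unfolded two_terms_def]] by (simp add: add_ac)
  have 3: "vanish (k + l + r + 1) (\<lambda>t. (b * b') * t ^ (k + l + r + r))"
    by (intro vanish_cmult vanish_mono[OF vanish_power[of "k + l + r + r"]]) (use r in auto)
  have "vanish (k + l + r + 1) (\<lambda>t. (f t - ?F t) * g t + ?F t * (g t - ?G t) + (b * b') * t ^ (k + l + r + r))"
    by (intro vanish_add 1 2 3)
  moreover have "(f t - ?F t) * g t + ?F t * (g t - ?G t) + (b * b') * t ^ (k + l + r + r)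
      = f t * g t - ((a * a') * t ^ (k + l) + (a * b' + a' * b) * t ^ (k + l + r))" for t
    by (simp add: power_add algebra_simps)
  ultimately show ?thesis by (simp add: two_terms_def)
qed

lemma two_terms_power:
  assumes r: "1 \<le> r" and f: "two_terms r 1 a b f"
  shows "two_terms r (Suc n) (a ^ Suc n) (of_nat (Suc n) * a ^ n * b) (\<lambda>t. f t ^ Suc n)"
proof (induction n)
  case 0 then show ?case using f by simp
next
  case (Suc n)
  from two_terms_mult[OF r f Suc.IH] show ?case by (simp add: algebra_simps)
qed

lemma two_terms_add_higher:
  assumes "two_terms r k a b f" "vanish (k + r + 1) (\<lambda>t. g t - c * t ^ (k + r))"
  shows "two_terms r k a (b + c) (\<lambda>t. g t + f t)"
  using vanish_add[OF assms(1)[unfolded two_terms_def] assms(2)]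
  unfolding two_terms_def by (simp add: algebra_simps)

lemma two_terms_leading: assumes "1 \<le> r" "two_terms r k a b f" shows "vanish (Suc k) (\<lambda>t. f t - a * t ^ k)"
proof -
  have "vanish (Suc k) (\<lambda>t. (f t - (a * t ^ k + b * t ^ (k + r))) + b * t ^ (k + r))"
    by (intro vanish_add vanish_cmult vanish_mono[OF vanish_power[of "k + r"]]
        vanish_mono[OF assms(2)[unfolded two_terms_def]]) (use assms(1) in auto)
  then show ?thesis by (simp add: algebra_simps)
qed

lemma two_terms_combine:
  assumes "two_terms r k a b f" "two_terms r k a' b' g"
  shows "two_terms r k (c * a - c' * a') (c * b - c' * b') (\<lambda>t. c * f t - c' * g t)"
proof -
  have "vanish (k + r + 1) (\<lambda>t. c * (f t - (a * t ^ k + b * t ^ (k + r))) - c' * (g t - (a' * t ^ k + b' * t ^ (k + r))))"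
    by (intro vanish_diff vanish_cmult assms[unfolded two_terms_def])
  then show ?thesis by (simp add: two_terms_def algebra_simps)
qed

lemma idx_inv:
  assumes "bij_betw idx UNIV (multi_indices q)" "1 \<le> mdeg \<alpha>" "mdeg \<alpha> \<le> q"
  shows "idx (inv idx \<alpha>) = \<alpha>"
proof (rule f_inv_into_f)
  show "\<alpha> \<in> range idx" using assms by (auto simp: bij_betw_def multi_indices_def)
qed

section \<open>Straightening the flat curves into lines, and the resulting divisibility\<close>

section \<open>Straightening the flat curves to higher order\<close>

text \<open>With \<open>p = k + 2\<close>, the linear system for the second-order coefficient \<open>w\<close> of the flat curve
  in the direction \<open>u\<close> expresses that the components with indices \<open>p e_i\<close> and \<open>(p - 1) e_i + e_j\<close>
  of the curve remain proportional to those of \<open>u\<close>; the Taylor polynomials of degree \<open>q + 1\<close>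
  of these components are the right-hand sides.\<close>

definition direction_eqs ::
    "nat \<Rightarrow> ('n \<Rightarrow> complex^'n::finite \<Rightarrow> complex) \<Rightarrow> ('n \<Rightarrow> 'n \<Rightarrow> complex^'n \<Rightarrow> complex) \<Rightarrow> complex^'n \<Rightarrow> complex^'n \<Rightarrow> bool" where
  "direction_eqs k C1 C2 u w \<longleftrightarrow>
     (\<forall>i. of_nat (k + 2) * u $ i ^ (k + 1) * w $ i = - C1 i u) \<and>
     (\<forall>i j. i \<noteq> j \<longrightarrow> of_nat (k + 1) * u $ i ^ k * u $ j * w $ i + u $ i ^ (k + 1) * w $ j = - C2 i j u)"

text \<open>Since k + 2 + r = q + 1, the coordinates of degree k + 2 have along the curve just two
  terms up to order q + 1. Cross-multiplying the leading coefficients of two of them gives a form of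
  order q + 1, which must vanish identically; hence the coefficients of order q + 1 are proportional
  to the leading ones. A change of the curve parameter makes the common factor zero.\<close>

lemma flat_curve_step:
  fixes idx :: "'m::finite \<Rightarrow> 'n::finite \<Rightarrow> nat" and \<gamma> :: "complex^'n \<Rightarrow> complex^'m"
  assumes idx: "bij_betw idx UNIV (multi_indices q)" and q: "q = Suc k + r" and r: "1 \<le> r"
    and g: "hol_map \<gamma>" "\<gamma> 0 = 0" and nj: "normal_jet idx q \<gamma>"
    and u: "u \<noteq> 0" and s: "hol_curve \<sigma>" "vanish (Suc r) (\<lambda>t. \<sigma> t - t *s u)"
    and A: "vec.subspace A" "vec.dim A = q" "\<forall>\<^sub>F t in nhds 0. \<gamma> (\<sigma> t) \<in> A"
  defines "C \<equiv> \<lambda>\<alpha> s. fps_nth (jet (\<lambda>s. \<gamma> s $ inv idx \<alpha> - mpow s \<alpha>) s) (Suc q)"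
  obtains \<sigma>' w where "hol_curve \<sigma>'" "vanish (Suc (Suc r)) (\<lambda>t. \<sigma>' t - (t *s u + t ^ Suc r *s w))"
    "\<forall>\<^sub>F t in nhds 0. \<gamma> (\<sigma>' t) \<in> A"
    "direction_eqs k (\<lambda>i. C (msingle i (k + 2))) (\<lambda>i j. C (madd (msingle i (k + 1)) (msingle j 1))) u w"
proof -
  define e where "e = (\<lambda>t. \<gamma> (\<sigma> t))"
  have s0: "\<sigma> 0 = 0" using vanish_at_0[OF s(2)] by simp
  have e: "hol_curve e" unfolding e_def by (rule hol_curve_compose[OF g(1) s(1) s0])
  have s1: "vanish 1 \<sigma>" using vanish_add[OF vanish_mono[OF s(2), of 1] vanish_line[of u]] by simp
  obtain i0 where i0: "u $ i0 \<noteq> 0" using u by (auto simp: vec_eq_iff)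
  define w where "w = (\<chi> i. (deriv ^^ Suc r) (\<lambda>t. \<sigma> t $ i - t * u $ i) 0 / fact (Suc r))"
  have w: "vanish (Suc (Suc r)) (\<lambda>t. \<sigma> t $ i - t * u $ i - w $ i * t ^ Suc r)" for i
  proof -
    have "(\<lambda>t. \<sigma> t $ i - t * u $ i) analytic_on {0}"
      using s(1) by (auto simp: hol_curve_def intro!: analytic_intros)
    moreover have "vanish (Suc r) (\<lambda>t. \<sigma> t $ i - t * u $ i)" using s(2) by (simp add: vanish_vec_iff)
    ultimately show ?thesis unfolding w_def vec_lambda_beta by (rule analytic_leading_term)
  qed
  have sig: "two_terms r 1 (u $ i) (w $ i) (\<lambda>t. \<sigma> t $ i)" for i
    using w[of i] by (simp add: two_terms_def algebra_simps)
  \<comment> \<open>The first error \<open>C \<alpha>\<close> of the normalized jet is homogeneous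
    of degree q + 1. It may be evaluated on the line t u instead of the curve, because the
    difference has order q + 1 + r.\<close>
  have rest: "vanish (Suc (Suc q)) (\<lambda>t. (e t $ inv idx \<alpha> - mpow (\<sigma> t) \<alpha>) - C \<alpha> u * t ^ Suc q)"
    if \<alpha>: "1 \<le> mdeg \<alpha>" "mdeg \<alpha> \<le> q" for \<alpha>
  proof -
    let ?f = "\<lambda>s. \<gamma> s $ inv idx \<alpha> - mpow s \<alpha>"
    have hf: "holomorphic_germ ?f" using g(1) by (auto simp: hol_map_def intro!: hol_intros)
    have vf: "vanish (Suc q) ?f" using nj idx_inv[OF idx \<alpha>] unfolding normal_jet_def by metis
    have "vanish (Suc (Suc q)) (\<lambda>s. ?f s - C \<alpha> s)" unfolding C_def by (rule hg_leading_term[OF hf vf])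
    from vanish_compose[OF this s1] have 1: "vanish (Suc (Suc q)) (\<lambda>t. ?f (\<sigma> t) - C \<alpha> (\<sigma> t))" .
    have hC: "hpoly (Suc q) (C \<alpha>)" unfolding C_def by (rule hpoly_jet[OF hf])
    have "vanish (Suc q + r) (\<lambda>t. C \<alpha> (\<sigma> t) - C \<alpha> (t *s u))"
      by (rule vanish_hpoly_diff[OF hC vanish_line s(2)])
    then have 2: "vanish (Suc (Suc q)) (\<lambda>t. C \<alpha> (\<sigma> t) - C \<alpha> u * t ^ Suc q)"
      using r by (auto simp: hpoly_scale[OF hC] mult.commute intro: vanish_mono)
    from vanish_add[OF 1 2] show ?thesis by (simp add: e_def algebra_simps)
  qed
  \<comment> \<open>Pure powers of a coordinate in which \<open>u\<close> is nonzero detect every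
    order from 1 to q, as \<open>flat_curve_relation\<close> demands.\<close>
  have lead: "\<exists>a c. c \<noteq> 0 \<and> vanish (Suc n) (\<lambda>t. bform a (e t) - c * t ^ n)" if n: "1 \<le> n" "n \<le> q" for n
  proof (intro exI conjI)
    let ?\<alpha> = "msingle i0 n"
    show "u $ i0 ^ n \<noteq> 0" using i0 by simp
    obtain n' where n': "n = Suc n'" using n(1) by (cases n) auto
    have "vanish (Suc n) (\<lambda>t. mpow (\<sigma> t) ?\<alpha> - u $ i0 ^ n * t ^ n)"
      using two_terms_leading[OF r two_terms_power[OF r sig[of i0], of n']] by (simp add: n')
    moreover have "vanish (Suc n) (\<lambda>t. (e t $ inv idx ?\<alpha> - mpow (\<sigma> t) ?\<alpha>))"
    proof -
      have "vanish (Suc n) (\<lambda>t. ((e t $ inv idx ?\<alpha> - mpow (\<sigma> t) ?\<alpha>) - C ?\<alpha> u * t ^ Suc q) + C ?\<alpha> u * t ^ Suc q)"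
        by (intro vanish_add vanish_cmult vanish_mono[OF rest] vanish_mono[OF vanish_power]) (use n in auto)
      then show ?thesis by simp
    qed
    ultimately have "vanish (Suc n) (\<lambda>t. (mpow (\<sigma> t) ?\<alpha> - u $ i0 ^ n * t ^ n) + (e t $ inv idx ?\<alpha> - mpow (\<sigma> t) ?\<alpha>))"
      by (rule vanish_add)
    then show "vanish (Suc n) (\<lambda>t. bform (axis (inv idx ?\<alpha>) 1) (e t) - u $ i0 ^ n * t ^ n)"
      by (simp add: bform_one)
  qed
  have rel: "b * X = a * Y"
    if ea: "two_terms r (k + 2) a X (\<lambda>t. e t $ ja)" and eb: "two_terms r (k + 2) b Y (\<lambda>t. e t $ jb)" for a b X Y ja jb
  proof -
    let ?L = "b *s axis ja 1 - a *s axis jb 1 :: complex^'m"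
    have L: "bform ?L (e t) = b * e t $ ja - a * e t $ jb" for t by (rule bform_two)
    have t: "two_terms r (k + 2) 0 (b * X - a * Y) (\<lambda>t. bform ?L (e t))"
      using two_terms_combine[OF ea eb, of b a] by (simp add: L mult.commute)
    have kr: "k + 2 + r = Suc q" by (simp add: q)
    have "vanish (Suc q) (\<lambda>t. (bform ?L (e t) - (0 * t ^ (k + 2) + (b * X - a * Y) * t ^ (k + 2 + r))) + (b * X - a * Y) * t ^ (k + 2 + r))"
      by (intro vanish_add vanish_cmult vanish_mono[OF t[unfolded two_terms_def]] vanish_mono[OF vanish_power]) (auto simp: q)
    then have "vanish (Suc q) (\<lambda>t. bform ?L (e t))" by simp
    from flat_curve_relation[OF e A(1,2) _ lead this] A(3)
    have "\<forall>\<^sub>F t in nhds 0. bform ?L (e t) = 0" by (simp add: e_def)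
    then have "\<forall>\<^sub>F t in nhds 0. bform ?L (e t) - (0 * t ^ (k + 2) + (b * X - a * Y) * t ^ (k + 2 + r)) = (a * Y - b * X) * t ^ Suc q"
      by eventually_elim (simp only: kr, simp add: algebra_simps)
    from vanish_cong_imp[OF t[unfolded two_terms_def] this]
    have "vanish (Suc (Suc q)) (\<lambda>t. (a * Y - b * X) * t ^ Suc q)" unfolding kr by simp
    then have "a * Y - b * X = 0" by (rule vanish_monomial_zero)
    then show ?thesis by simp
  qed
  have higher: "vanish (k + 2 + r + 1) (\<lambda>t. (e t $ inv idx \<alpha> - mpow (\<sigma> t) \<alpha>) - C \<alpha> u * t ^ (k + 2 + r))"
    if "1 \<le> mdeg \<alpha>" "mdeg \<alpha> \<le> q" for \<alpha>
    using rest[OF that] by (simp add: q)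
  have E1: "two_terms r (k + 2) (u $ i ^ (k + 2)) (of_nat (k + 2) * u $ i ^ (k + 1) * w $ i + C (msingle i (k + 2)) u)
      (\<lambda>t. e t $ inv idx (msingle i (k + 2)))" for i
  proof -
    have "two_terms r (k + 2) (u $ i ^ (k + 2)) (of_nat (k + 2) * u $ i ^ (k + 1) * w $ i)
        (\<lambda>t. mpow (\<sigma> t) (msingle i (k + 2)))"
      using two_terms_power[OF r sig[of i], of "Suc k"] unfolding mpow_msingle by simp
    from two_terms_add_higher[OF this higher[of "msingle i (k + 2)"]] show ?thesis using r q by simp
  qed
  have E2: "two_terms r (k + 2) (u $ i ^ (k + 1) * u $ j)
      (u $ i ^ (k + 1) * w $ j + of_nat (k + 1) * u $ i ^ k * w $ i * u $ j + C (madd (msingle i (k + 1)) (msingle j 1)) u)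
      (\<lambda>t. e t $ inv idx (madd (msingle i (k + 1)) (msingle j 1)))" for i j
  proof -
    have "two_terms r (k + 2) (u $ i ^ (k + 1) * u $ j)
        (u $ i ^ (k + 1) * w $ j + of_nat (k + 1) * u $ i ^ k * w $ i * u $ j)
        (\<lambda>t. mpow (\<sigma> t) (madd (msingle i (k + 1)) (msingle j 1)))"
      using two_terms_mult[OF r two_terms_power[OF r sig[of i], of k] sig[of j]]
      unfolding mpow_madd mpow_msingle by (simp add: mult_ac)
    from two_terms_add_higher[OF this higher[of "madd (msingle i (k + 1)) (msingle j 1)"]] show ?thesis using r q by simp
  qed
  \<comment> \<open>The common factor of proportionality, read off from the pure power of the
    coordinate \<open>i0\<close>.\<close>
  define l where "l = (of_nat (k + 2) * u $ i0 ^ (k + 1) * w $ i0 + C (msingle i0 (k + 2)) u) / u $ i0 ^ (k + 2)"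
  have R: "X = l * a" if "two_terms r (k + 2) a X (\<lambda>t. e t $ j)" for a X j
    using rel[OF that E1[of i0]] i0 by (simp add: l_def field_simps)
  \<comment> \<open>Replacing t by t - c t^(r+1) changes \<open>w\<close> by - c u, hence the
    coefficient belonging to a monomial of degree k + 2 by - (k + 2) c u^alpha; this value of
    \<open>c\<close> removes \<open>l\<close>.\<close>
  define c where "c = l / of_nat (k + 2)"
  have c: "of_nat (k + 2) * c = l" unfolding c_def by (simp del: of_nat_add of_nat_Suc)
  define w' where "w' = w - c *s u"
  have eqs: "direction_eqs k (\<lambda>i. C (msingle i (k + 2))) (\<lambda>i j. C (madd (msingle i (k + 1)) (msingle j 1))) u w'"
    unfolding direction_eqs_def
  proof (intro conjI allI impI)
    fix i
    have h: "of_nat (k + 2) * u $ i ^ (k + 1) * w' $ i = of_nat (k + 2) * u $ i ^ (k + 1) * w $ i - (of_nat (k + 2) * c) * u $ i ^ (k + 2)"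
      by (simp add: w'_def algebra_simps)
    show "of_nat (k + 2) * u $ i ^ (k + 1) * w' $ i = - C (msingle i (k + 2)) u"
      unfolding h c R[OF E1[of i], symmetric] by (simp add: algebra_simps)
  next
    fix i j :: 'n
    have h: "of_nat (k + 1) * u $ i ^ k * u $ j * w' $ i + u $ i ^ (k + 1) * w' $ j
      = of_nat (k + 1) * u $ i ^ k * u $ j * w $ i + u $ i ^ (k + 1) * w $ j - (of_nat (k + 2) * c) * (u $ i ^ (k + 1) * u $ j)"
      by (simp add: w'_def algebra_simps)
    show "of_nat (k + 1) * u $ i ^ k * u $ j * w' $ i + u $ i ^ (k + 1) * w' $ j = - C (madd (msingle i (k + 1)) (msingle j 1)) u"
      unfolding h c R[OF E2[of i j], symmetric] by (simp add: algebra_simps)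
  qed
  define \<tau> where "\<tau> = (\<lambda>t::complex. t - c * t ^ Suc r)"
  have ta: "\<tau> analytic_on {0}" unfolding \<tau>_def by (intro analytic_intros)
  have t0: "\<tau> 0 = 0" by (simp add: \<tau>_def)
  have td: "vanish (Suc r) (\<lambda>t. \<tau> t - t)" using vanish_cmult[OF vanish_power, of "Suc r" "-c"] by (simp add: \<tau>_def)
  have t1: "vanish 1 \<tau>" using vanish_add[OF vanish_mono[OF td, of 1] vanish_id[folded One_nat_def]] by simp
  have tp: "vanish (Suc r + r) (\<lambda>t. \<tau> t ^ Suc r - t ^ Suc r)"
    by (rule vanish_power_diff[OF _ td]) simp
  have v: "vanish (Suc (Suc r)) (\<lambda>t. \<sigma> (\<tau> t) - (t *s u + t ^ Suc r *s w'))"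
    unfolding vanish_vec_iff
  proof
    fix i
    have "vanish (Suc (Suc r)) (\<lambda>t. (\<sigma> (\<tau> t) $ i - \<tau> t * u $ i - w $ i * \<tau> t ^ Suc r) + w $ i * (\<tau> t ^ Suc r - t ^ Suc r))"
      by (intro vanish_add vanish_cmult vanish_compose[OF w t1] vanish_mono[OF tp]) (use r in simp)
    then show "vanish (Suc (Suc r)) (\<lambda>t. (\<sigma> (\<tau> t) - (t *s u + t ^ Suc r *s w')) $ i)"
      by (simp add: \<tau>_def w'_def algebra_simps)
  qed
  have in_A: "\<forall>\<^sub>F t in nhds 0. \<gamma> (\<sigma> (\<tau> t)) \<in> A"
    using eventually_compose_filterlim[OF A(3) vanish_lim[of 0 \<tau>]] t1 by simp
  show ?thesis by (rule that[OF hol_curve_reparam[OF s(1) ta t0] v in_A eqs])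
qed

lemma hpoly_cancel_coordinate:
  fixes P :: "complex^'n::finite \<Rightarrow> complex"
  assumes "hpoly d P" "\<And>u. u $ i ^ l * P u = 0" shows "P u = 0"
proof -
  have "\<forall>\<^sub>F u in nhds 0. P u = 0"
    by (rule hg_cancel[where i=i and k=l]) (use assms in \<open>auto intro: hpoly_hg hol_intros\<close>)
  then have "vanish (Suc d) P" using vanish_cong[of P "\<lambda>_. 0"] by simp
  then show ?thesis by (rule hpoly_vanish_zero[OF assms(1)])
qed

text \<open>Two different coordinates are needed here: \<open>W i\<close> is a quotient by a power of the \<open>i\<close>-th
  coordinate and also by a power of another one, hence a polynomial.\<close>

lemma direction_field_polynomial:
  fixes C1 :: "'n::finite \<Rightarrow> complex^'n \<Rightarrow> complex"
  assumes n: "2 \<le> CARD('n)"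
    and C1: "\<And>i. hpoly (k + 2 + r) (C1 i)" and C2: "\<And>i j. hpoly (k + 2 + r) (C2 i j)"
    and ex: "\<And>u. u \<noteq> 0 \<Longrightarrow> \<exists>w. direction_eqs k C1 C2 u w"
  obtains W where "\<And>i. hpoly (Suc r) (W i)"
    "\<And>u w. u \<noteq> 0 \<Longrightarrow> direction_eqs k C1 C2 u w \<Longrightarrow> w = (\<chi> i. W i u)"
proof -
  \<comment> \<open>Elimination of w_j from the equations for the indices (k + 2) e_j and (k + 1)
    e_j + e_i; what remains equals (k + 2) u_j^(k+2) w_i.\<close>
  define A where "A = (\<lambda>i j u. of_nat (k + 1) * (u $ i * C1 j u) - of_nat (k + 2) * (u $ j * C2 j i u))"
  have wA: "of_nat (k + 2) * u $ j ^ (k + 2) * w $ i = A i j u" if "direction_eqs k C1 C2 u w" "i \<noteq> j" for u w i j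
  proof -
    have 1: "C1 j u = - (of_nat (k + 2) * u $ j ^ (k + 1) * w $ j)"
      and 2: "C2 j i u = - (of_nat (k + 1) * u $ j ^ k * u $ i * w $ j + u $ j ^ (k + 1) * w $ i)"
      using that by (auto simp: direction_eqs_def)
    show ?thesis unfolding A_def 1 2 by (simp add: algebra_simps)
  qed
  have w1: "of_nat (k + 2) * u $ i ^ (k + 1) * w $ i = - C1 i u" if "direction_eqs k C1 C2 u w" for u w i
    using that by (simp add: direction_eqs_def)
  \<comment> \<open>Two expressions for w_i are compared, one with denominator u_i^(k+1) and one
    with denominator u_j^(k+2). The result is an identity between polynomials in u, free of
    w.\<close>
  have key: "A i j u * u $ i ^ (k + 1) = - C1 i u * u $ j ^ (k + 2)" if ij: "i \<noteq> j" for i j u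
  proof (cases "u = 0")
    case True then show ?thesis by simp
  next
    case False
    then obtain w where w: "direction_eqs k C1 C2 u w" using ex by blast
    show ?thesis unfolding wA[OF w ij, symmetric] w1[OF w, symmetric] by (simp add: mult_ac)
  qed
  have hA: "hpoly (k + 2 + Suc r) (A i j)" for i j
  proof -
    have "hpoly (Suc 0 + (k + 2 + r)) (A i j)"
      unfolding A_def by (intro hpoly_diff hpoly_cmult hpoly_mult hpoly_nth C1 C2)
    then show ?thesis by simp
  qed
  have "\<exists>W. hpoly (Suc r) W \<and> (\<forall>u. - C1 i u = u $ i ^ (k + 1) * (of_nat (k + 2) * W u)) \<and>
     (\<forall>j u. j \<noteq> i \<longrightarrow> A i j u = u $ j ^ (k + 2) * (of_nat (k + 2) * W u))" for i
  proof -
    have "\<exists>j. j \<noteq> i"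
    proof (rule ccontr)
      assume "\<nexists>j. j \<noteq> i"
      then have "UNIV = {i}" by auto
      then have "CARD('n) = card {i}" by simp
      then show False using n by simp
    qed
    then obtain j where j: "j \<noteq> i" by blast
    obtain h where h: "holomorphic_germ h" "\<forall>\<^sub>F u in nhds 0. A i j u = u $ j ^ (k + 2) * h u"
    proof (rule hg_divide_power[of "A i j" "\<lambda>u. - C1 i u" i j "k + 1" "k + 2"])
      show "holomorphic_germ (A i j)" by (rule hpoly_hg[OF hA])
      show "holomorphic_germ (\<lambda>u. - C1 i u)" by (rule hpoly_hg[OF hpoly_uminus[OF C1]])
      show "\<forall>\<^sub>F u in nhds 0. A i j u * u $ i ^ (k + 1) = - C1 i u * u $ j ^ (k + 2)"
        by (intro always_eventually allI) (rule key[OF j[symmetric]])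
    qed (use j that in auto)
    \<comment> \<open>Division only yields a germ \<open>h\<close>; since dividend and divisor are
      homogeneous, its part of degree r + 1 is already the quotient.\<close>
    define W where "W = (\<lambda>u. fps_nth (jet h u) (Suc r) / of_nat (k + 2))"
    have kW: "of_nat (k + 2) * W u = fps_nth (jet h u) (Suc r)" for u
      unfolding W_def by (simp del: of_nat_add of_nat_Suc)
    have hW: "hpoly (Suc r) W"
      using hpoly_cmult[OF hpoly_jet[OF h(1)], of "Suc r" "1 / of_nat (k + 2)"] by (simp add: W_def)
    have hkW: "hpoly (Suc r) (\<lambda>u. of_nat (k + 2) * W u)" by (rule hpoly_cmult[OF hW])
    have hj: "hpoly ((k + 2) * Suc 0) (\<lambda>u::complex^'n. u $ j ^ (k + 2))" for j by (rule hpoly_power[OF hpoly_nth])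
    have Aj: "A i j u = u $ j ^ (k + 2) * (of_nat (k + 2) * W u)" for u
    proof -
      have "A i j u = fps_nth (jet (A i j) u) (k + 2 + Suc r)" by (simp add: hpoly_jet_nth[OF hA])
      also have "jet (A i j) u = jet (\<lambda>u. u $ j ^ (k + 2)) u * jet h u"
        unfolding jet_cong[OF h(2)] by (intro jet_mult hol_intros h(1))
      also have "\<dots> = fps_const (u $ j ^ (k + 2)) * (fps_X ^ (k + 2) * jet h u)"
        unfolding jet_hpoly[OF hj] by (simp add: mult.assoc)
      finally show ?thesis
        unfolding kW by (simp only: fps_mult_left_const_nth fps_X_power_mult_nth not_add_less1 if_False diff_add_inverse)
    qed
    have B: "- C1 i u = u $ i ^ (k + 1) * (of_nat (k + 2) * W u)" for u
    proof -
      have "- C1 i u - u $ i ^ (k + 1) * (of_nat (k + 2) * W u) = 0"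
      proof (rule hpoly_cancel_coordinate[where i=j and l="k + 2" and u=u])
        have "hpoly ((k + 1) * Suc 0 + Suc r) (\<lambda>u. u $ i ^ (k + 1) * (of_nat (k + 2) * W u))"
          by (intro hpoly_mult hpoly_power hpoly_nth hkW)
        then have "hpoly (k + 2 + r) (\<lambda>u. u $ i ^ (k + 1) * (of_nat (k + 2) * W u))" by simp
        then show "hpoly (k + 2 + r) (\<lambda>u. - C1 i u - u $ i ^ (k + 1) * (of_nat (k + 2) * W u))"
          by (intro hpoly_diff hpoly_uminus C1)
        show "u $ j ^ (k + 2) * (- C1 i u - u $ i ^ (k + 1) * (of_nat (k + 2) * W u)) = 0" for u
        proof -
          have "u $ j ^ (k + 2) * (- C1 i u - u $ i ^ (k + 1) * (of_nat (k + 2) * W u))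
            = - C1 i u * u $ j ^ (k + 2) - (u $ j ^ (k + 2) * (of_nat (k + 2) * W u)) * u $ i ^ (k + 1)"
            by (simp only: right_diff_distrib mult_ac)
          also have "\<dots> = 0" unfolding Aj[symmetric] using key[OF j[symmetric], of u] by simp
          finally show ?thesis .
        qed
      qed
      then show ?thesis by simp
    qed
    \<comment> \<open>The polynomial found with \<open>j\<close> serves every other coordinate j' as
      well: after multiplication by u_i^(k+1) the claim follows from \<open>key\<close> and
      \<open>B\<close>.\<close>
    have "A i j' u = u $ j' ^ (k + 2) * (of_nat (k + 2) * W u)" if j': "j' \<noteq> i" for j' u
    proof -
      have "A i j' u - u $ j' ^ (k + 2) * (of_nat (k + 2) * W u) = 0"
      proof (rule hpoly_cancel_coordinate[where i=i and l="k + 1" and u=u])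
        have "hpoly ((k + 2) * Suc 0 + Suc r) (\<lambda>u. u $ j' ^ (k + 2) * (of_nat (k + 2) * W u))"
          by (intro hpoly_mult hpoly_power hpoly_nth hkW)
        then have "hpoly (k + 2 + Suc r) (\<lambda>u. u $ j' ^ (k + 2) * (of_nat (k + 2) * W u))" by simp
        then show "hpoly (k + 2 + Suc r) (\<lambda>u. A i j' u - u $ j' ^ (k + 2) * (of_nat (k + 2) * W u))"
          by (intro hpoly_diff hA)
        show "u $ i ^ (k + 1) * (A i j' u - u $ j' ^ (k + 2) * (of_nat (k + 2) * W u)) = 0" for u
        proof -
          have "u $ i ^ (k + 1) * (A i j' u - u $ j' ^ (k + 2) * (of_nat (k + 2) * W u))
            = A i j' u * u $ i ^ (k + 1) - (u $ i ^ (k + 1) * (of_nat (k + 2) * W u)) * u $ j' ^ (k + 2)"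
            by (simp only: right_diff_distrib mult_ac)
          also have "\<dots> = 0" unfolding B[symmetric] using key[OF j'[symmetric], of u] by simp
          finally show ?thesis .
        qed
      qed
      then show ?thesis by simp
    qed
    then show ?thesis using hW B by blast
  qed
  then have "\<forall>i. \<exists>W. hpoly (Suc r) W \<and> (\<forall>u. - C1 i u = u $ i ^ (k + 1) * (of_nat (k + 2) * W u)) \<and>
     (\<forall>j u. j \<noteq> i \<longrightarrow> A i j u = u $ j ^ (k + 2) * (of_nat (k + 2) * W u))" by blast
  from choice[OF this] obtain W where W: "\<And>i. hpoly (Suc r) (W i)"
    "\<And>i u. - C1 i u = u $ i ^ (k + 1) * (of_nat (k + 2) * W i u)"
    "\<And>i j u. j \<noteq> i \<Longrightarrow> A i j u = u $ j ^ (k + 2) * (of_nat (k + 2) * W i u)" by blast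
  have "w = (\<chi> i. W i u)" if u: "u \<noteq> 0" and w: "direction_eqs k C1 C2 u w" for u w
  proof -
    obtain j where j: "u $ j \<noteq> 0" using u by (auto simp: vec_eq_iff)
    have k2: "of_nat (k + 2) \<noteq> (0::complex)" by (simp del: of_nat_add of_nat_Suc)
    have "w $ i = W i u" for i
    proof (cases "j = i")
      case True
      have "u $ i ^ (k + 1) * (of_nat (k + 2) * W i u) = u $ i ^ (k + 1) * (of_nat (k + 2) * w $ i)"
        using w1[OF w, of i] W(2)[of i u] by (simp only: mult_ac)
      then show ?thesis using j True k2 by (simp del: of_nat_add of_nat_Suc)
    next
      case False
      have "u $ j ^ (k + 2) * (of_nat (k + 2) * W i u) = u $ j ^ (k + 2) * (of_nat (k + 2) * w $ i)"
        using wA[OF w False[symmetric]] W(3)[OF False, of u] by (simp only: mult_ac)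
      then show ?thesis using j k2 by (simp del: of_nat_add of_nat_Suc)
    qed
    then show ?thesis by (simp add: vec_eq_iff)
  qed
  with W(1) show ?thesis by (rule that)
qed

text \<open>The coefficients \<open>w\<close> form a homogeneous polynomial field W of degree r + 1,
  and F(s) = s + W(s) takes t u to t u + t^(r+1) W(u). Pulling the flat curves back by
  \<open>F\<close> removes this term and improves their contact with lines by one order.\<close>

theorem straighten_step:
  fixes idx :: "'m::finite \<Rightarrow> 'n::finite \<Rightarrow> nat" and \<gamma> :: "complex^'n \<Rightarrow> complex^'m"
  assumes idx: "bij_betw idx UNIV (multi_indices q)" and n: "2 \<le> CARD('n)"
    and q: "q = Suc k + r" and r: "1 \<le> r"
    and g: "hol_map \<gamma>" "\<gamma> 0 = 0" and nj: "normal_jet idx q \<gamma>" and flat: "has_flat_curves q (Suc r) \<gamma>"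
  obtains F G :: "complex^'n \<Rightarrow> complex^'n" where "hol_map F" "F 0 = 0" "hol_map G" "G 0 = 0"
    "\<forall>\<^sub>F z in nhds 0. F (G z) = z" "\<forall>\<^sub>F z in nhds 0. G (F z) = z"
    "has_flat_curves q (Suc (Suc r)) (\<lambda>s. \<gamma> (F s))"
proof -
  define C where "C = (\<lambda>\<alpha> s. fps_nth (jet (\<lambda>s. \<gamma> s $ inv idx \<alpha> - mpow s \<alpha>) s) (Suc q))"
  have hC: "hpoly (k + 2 + r) (C \<alpha>)" for \<alpha>
  proof -
    have "holomorphic_germ (\<lambda>s. \<gamma> s $ inv idx \<alpha> - mpow s \<alpha>)"
      using g(1) by (auto simp: hol_map_def intro!: hol_intros)
    from hpoly_jet[OF this, of "Suc q"] show ?thesis by (simp add: C_def q)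
  qed
  let ?E = "direction_eqs k (\<lambda>i. C (msingle i (k + 2))) (\<lambda>i j. C (madd (msingle i (k + 1)) (msingle j 1)))"
  have step: "\<exists>\<sigma> w A. hol_curve \<sigma> \<and> vanish (Suc (Suc r)) (\<lambda>t. \<sigma> t - (t *s u + t ^ Suc r *s w)) \<and>
      vec.subspace A \<and> vec.dim A = q \<and> (\<forall>\<^sub>F t in nhds 0. \<gamma> (\<sigma> t) \<in> A) \<and> ?E u w" if u: "u \<noteq> 0" for u
  proof -
    obtain \<sigma> A where s: "hol_curve \<sigma>" "vanish (Suc r) (\<lambda>t. \<sigma> t - t *s u)"
      "vec.subspace A" "vec.dim A = q" "\<forall>\<^sub>F t in nhds 0. \<gamma> (\<sigma> t) \<in> A"
      using flat u unfolding has_flat_curves_def by blast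
    obtain \<sigma>' w where "hol_curve \<sigma>'" "vanish (Suc (Suc r)) (\<lambda>t. \<sigma>' t - (t *s u + t ^ Suc r *s w))"
      "\<forall>\<^sub>F t in nhds 0. \<gamma> (\<sigma>' t) \<in> A" "?E u w"
      using flat_curve_step[OF idx q r g nj u s] unfolding C_def by blast
    then show ?thesis using s(3,4) by blast
  qed
  obtain W where W: "\<And>i. hpoly (Suc r) (W i)" "\<And>u w. u \<noteq> 0 \<Longrightarrow> ?E u w \<Longrightarrow> w = (\<chi> i. W i u)"
  proof (rule direction_field_polynomial[OF n hC hC])
    show "\<exists>w. ?E u w" if "u \<noteq> 0" for u using step[OF that] by blast
  qed (use that in blast)
  define Wv where "Wv = (\<lambda>s. \<chi> i. W i s)"
  have vW: "vanish (Suc r) Wv" unfolding vanish_vec_iff Wv_def by (simp add: hpoly_vanish[OF W(1)])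
  define F where "F = (\<lambda>s. s + Wv s)"
  have F: "hol_map F"
    unfolding F_def Wv_def by (rule hol_mapI) (simp add: hg_add hg_nth hpoly_hg[OF W(1)])
  have F0: "F 0 = 0" using vanish_at_0[OF vW] by (simp add: F_def)
  have F2: "vanish (Suc r) (\<lambda>s. F s - s)" using vW by (simp add: F_def)
  have "vanish 2 (\<lambda>s. F s - s)" by (rule vanish_mono[OF F2]) (use r in simp)
  then obtain G where G: "hol_map G" "G 0 = 0" "\<forall>\<^sub>F z in nhds 0. F (G z) = z" "\<forall>\<^sub>F z in nhds 0. G (F z) = z"
    "\<And>K. vanish K (\<lambda>s. F s - s) \<Longrightarrow> vanish K (\<lambda>s. G s - s)"
    by (rule hol_map_inverse_germ[OF F F0]) (rule that)
  have "has_flat_curves q (Suc (Suc r)) (\<lambda>s. \<gamma> (F s))"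
    unfolding has_flat_curves_def
  proof (intro allI impI)
    fix u :: "complex^'n" assume u: "u \<noteq> 0"
    obtain \<sigma> w A where s: "hol_curve \<sigma>" "vanish (Suc (Suc r)) (\<lambda>t. \<sigma> t - (t *s u + t ^ Suc r *s w))"
      "vec.subspace A" "vec.dim A = q" "\<forall>\<^sub>F t in nhds 0. \<gamma> (\<sigma> t) \<in> A" "?E u w" using step[OF u] by blast
    \<comment> \<open>Uniqueness of the solution identifies the \<open>w\<close> of this particular
      curve with the value of the polynomial field.\<close>
    have w: "w = Wv u" unfolding Wv_def by (rule W(2)[OF u s(6)])
    have "\<sigma> 0 - (0 *s u + 0 ^ Suc r *s w) = 0" by (rule vanish_at_0[OF s(2)])
    then have s0: "\<sigma> 0 = 0" by simp
    have sr: "vanish (Suc r) (\<lambda>t. \<sigma> t - t *s u)"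
    proof -
      have "vanish (Suc r + 0) (\<lambda>t::complex. t ^ Suc r *s w)"
        by (rule vanish_smult[OF vanish_power vanish_0_const])
      from vanish_add[OF vanish_mono[OF s(2), of "Suc r"] this[simplified add_0_right]]
      show ?thesis by simp
    qed
    have s1: "vanish 1 \<sigma>" using vanish_add[OF vanish_mono[OF sr, of 1] vanish_line[of u]] by simp
    define \<sigma>' where "\<sigma>' = (\<lambda>t. G (\<sigma> t))"
    have h: "hol_curve \<sigma>'" unfolding \<sigma>'_def by (rule hol_curve_compose[OF G(1) s(1) s0])
    have FG: "\<forall>\<^sub>F t in nhds 0. F (\<sigma>' t) = \<sigma> t"
      unfolding \<sigma>'_def by (rule eventually_hol_curve[OF s(1) s0 G(3)])
    have d: "vanish (Suc r) (\<lambda>t. \<sigma>' t - t *s u)"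
      using vanish_add[OF vanish_compose[OF G(5)[OF F2] s1] sr] by (simp add: \<sigma>'_def)
    have "vanish (Suc (Suc r)) (\<lambda>t. Wv (\<sigma>' t) - t ^ Suc r *s Wv u)"
      unfolding vanish_vec_iff
    proof
      fix i
      have "vanish (Suc r + r) (\<lambda>t. W i (\<sigma>' t) - W i (t *s u))"
        by (rule vanish_hpoly_diff[OF W(1) vanish_line d])
      then have "vanish (Suc (Suc r)) (\<lambda>t. W i (\<sigma>' t) - W i (t *s u))" by (rule vanish_mono) (use r in simp)
      then show "vanish (Suc (Suc r)) (\<lambda>t. (Wv (\<sigma>' t) - t ^ Suc r *s Wv u) $ i)"
        by (simp add: Wv_def hpoly_scale[OF W(1)])
    qed
    from vanish_diff[OF s(2) this]
    have "vanish (Suc (Suc r)) (\<lambda>t. \<sigma> t - Wv (\<sigma>' t) - t *s u)" by (simp add: w algebra_simps)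
    moreover have "\<forall>\<^sub>F t in nhds 0. \<sigma> t - Wv (\<sigma>' t) - t *s u = \<sigma>' t - t *s u"
      using FG by eventually_elim (simp add: F_def algebra_simps)
    ultimately have "vanish (Suc (Suc r)) (\<lambda>t. \<sigma>' t - t *s u)" by (rule vanish_cong_imp)
    moreover have "\<forall>\<^sub>F t in nhds 0. \<gamma> (F (\<sigma>' t)) \<in> A" using FG s(5) by eventually_elim simp
    ultimately show "\<exists>\<sigma> A. hol_curve \<sigma> \<and> vanish (Suc (Suc r)) (\<lambda>t. \<sigma> t - t *s u) \<and>
      vec.subspace A \<and> vec.dim A = q \<and> (\<forall>\<^sub>F t in nhds 0. \<gamma> (F (\<sigma> t)) \<in> A)"
      using h s(3,4) by blast
  qed
  with F F0 G(1-4) show ?thesis by (rule that)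
qed

lemma param_linear:
  fixes T :: "complex^'m::finite^'m"
  assumes "param \<gamma> X" "invertible T" shows "param (\<lambda>s. T *v \<gamma> s) ((*v) T ` X)"
proof -
  obtain T' where T': "T' ** T = mat 1" "T ** T' = mat 1" using assms(2) unfolding invertible_def by blast
  have h: "hol_map (\<lambda>x. A *v x)" for A :: "complex^'m^'m" by (rule hol_map_matrix[OF hol_map_id])
  have TT': "T' *v (T *v x) = x" "T *v (T' *v x) = x" for x by (simp_all add: matrix_vector_mul_assoc T')
  show ?thesis
  proof (rule param_image[OF assms(1) h _ h[of T']])
    show "\<forall>\<^sub>F y in nhds 0. y \<in> (*v) T ` X \<longrightarrow> T' *v y \<in> X"
      by (rule always_eventually) (auto simp: TT')
  qed (simp_all add: TT')
qed

lemma param_hol: "param \<gamma> X \<Longrightarrow> hol_map \<gamma>" "param \<gamma> X \<Longrightarrow> \<gamma> 0 = 0"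
  by (auto simp: param_def)

text \<open>Each change of parameter destroys the normalization of the jets; a further linear map
  restores it, and \<open>T\<close> collects these maps. At r = q the flat curves agree with lines
  up to an error of order q + 1.\<close>

theorem straighten_flat_curves:
  fixes idx :: "'m::finite \<Rightarrow> 'n::finite \<Rightarrow> nat" and \<gamma> :: "complex^'n \<Rightarrow> complex^'m"
  assumes idx: "bij_betw idx UNIV (multi_indices q)" and n: "2 \<le> CARD('n)"
    and par: "param \<gamma> X" and R: "jet_regular q \<gamma>" and flat: "has_flat_curves q 2 \<gamma>"
    and r: "1 \<le> r" "r \<le> q"
  shows "\<exists>T \<delta>. invertible T \<and> param \<delta> ((*v) T ` X) \<and> normal_jet idx q (\<delta> :: complex^'n \<Rightarrow> complex^'m)
     \<and> has_flat_curves q (Suc r) \<delta>"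
  using r
proof (induction r rule: nat_induct_at_least)
  case base
  obtain T where T: "invertible T" "normal_jet idx q (\<lambda>s. T *v \<gamma> s)"
    by (rule jet_regular_normalize[OF idx param_hol[OF par] R]) (rule that)
  have "has_flat_curves q (Suc 1) (\<lambda>s. T *v \<gamma> s)"
    by (rule has_flat_curves_linear[OF _ T(1)]) (use flat in \<open>simp add: numeral_2_eq_2\<close>)
  then show ?case using T param_linear[OF par T(1)] by blast
next
  case (Suc r)
  then obtain T and \<delta> :: "complex^'n \<Rightarrow> complex^'m" where T: "invertible T" "param \<delta> ((*v) T ` X)"
    "normal_jet idx q \<delta>" "has_flat_curves q (Suc r) \<delta>" by auto
  note d = param_hol[OF T(2)]
  \<comment> \<open>Here k = q - r - 1, so the coordinates exploited have degree q + 1 - r, running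
    down from q to 2 in the course of the induction.\<close>
  have qr: "q = Suc (q - Suc r) + r" using Suc.prems by simp
  obtain F G :: "complex^'n \<Rightarrow> complex^'n" where F: "hol_map F" "F 0 = 0" "hol_map G" "G 0 = 0"
    "\<forall>\<^sub>F z in nhds 0. F (G z) = z" "\<forall>\<^sub>F z in nhds 0. G (F z) = z"
    "has_flat_curves q (Suc (Suc r)) (\<lambda>s. \<delta> (F s))"
    by (rule straighten_step[OF idx n qr Suc.hyps(1) d T(3,4)]) (rule that)
  have par1: "param (\<lambda>s. \<delta> (F s)) ((*v) T ` X)" by (rule param_reparam[OF T(2) F(1-6)])
  have "jet_regular q (\<lambda>s. \<delta> (F s))"
    by (rule jet_regular_reparam[OF jet_regular_normal_jet[OF idx T(3)] F(3,4,5)])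
  then obtain T1 where T1: "invertible T1" "normal_jet idx q (\<lambda>s. T1 *v \<delta> (F s))"
    by (rule jet_regular_normalize[OF idx param_hol[OF par1]]) (rule that)
  have "param (\<lambda>s. T1 *v \<delta> (F s)) ((*v) T1 ` (*v) T ` X)" by (rule param_linear[OF par1 T1(1)])
  moreover have "(*v) T1 ` (*v) T ` X = (*v) (T1 ** T) ` X"
    by (simp add: image_image matrix_vector_mul_assoc)
  moreover have "invertible (T1 ** T)" using T1(1) T(1) by (rule invertible_mult)
  moreover have "has_flat_curves q (Suc (Suc r)) (\<lambda>s. T1 *v \<delta> (F s))"
    by (rule has_flat_curves_linear[OF F(7) T1(1)])
  ultimately show ?case using T1(2) by metis
qed

section \<open>Flat curves along lines\<close>

text \<open>If g starts with c t^K, then so does its composition with \<mu>, because \<mu> is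
  tangent to the identity; hence c = 0 at every stage.\<close>

lemma analytic_zero_reparam:
  assumes g: "g analytic_on {0}" and m: "vanish 2 (\<lambda>t. \<mu> t - t)" and z: "\<forall>\<^sub>F t in nhds 0. g (\<mu> t) = 0"
  shows "\<forall>\<^sub>F z in nhds 0. g z = 0"
proof (rule analytic_flat_zero[OF g])
  have m1: "vanish 1 \<mu>" using vanish_add[OF vanish_mono[OF m, of 1] vanish_id[folded One_nat_def]] by simp
  have m2: "vanish (Suc 1) (\<lambda>t. \<mu> t - t)" using m by (simp add: numeral_2_eq_2)
  fix K show "vanish K g"
  proof (induction K)
    case 0
    show ?case by (rule vanish_0_isCont[OF analytic_isCont[OF g]])
  next
    case (Suc K)
    define c where "c = (deriv ^^ K) g 0 / fact K"
    have v: "vanish (Suc K) (\<lambda>t. g t - c * t ^ K)" unfolding c_def by (rule analytic_leading_term[OF g Suc.IH])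
    have "vanish (Suc K) (\<lambda>t. g (\<mu> t) - c * \<mu> t ^ K)" by (rule vanish_compose[OF v m1])
    moreover have "\<forall>\<^sub>F t in nhds 0. g (\<mu> t) - c * \<mu> t ^ K = - (c * \<mu> t ^ K)"
      using z by eventually_elim simp
    ultimately have "vanish (Suc K) (\<lambda>t. - (c * \<mu> t ^ K))" by (rule vanish_cong_imp)
    moreover have "vanish (Suc K) (\<lambda>t. c * (\<mu> t ^ K - t ^ K))"
      using vanish_cmult[OF vanish_power_diff[OF _ m2, of K]] by simp
    ultimately have "vanish (Suc K) (\<lambda>t. - (c * \<mu> t ^ K) + c * (\<mu> t ^ K - t ^ K))" by (rule vanish_add)
    then have "vanish (Suc K) (\<lambda>t. (- c) * t ^ K)" by (simp add: algebra_simps)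
    then have "- c = 0" by (rule vanish_monomial_zero)
    then show ?case using v by simp
  qed
qed

text \<open>With the coordinates of degree 1 as parameters, the relations of degree 1 say that the
  curve in the parameter space stays on the line through u: the flat curve is a reparametrized line.
  The relations of higher degree then hold along the line itself, and the lines through 0 determine
  a germ.\<close>

theorem flat_lines_relation:
  fixes idx :: "'m::finite \<Rightarrow> 'n::finite \<Rightarrow> nat" and \<gamma> :: "complex^'n \<Rightarrow> complex^'m"
  assumes idx: "bij_betw idx UNIV (multi_indices q)" and q: "1 \<le> q"
    and g: "hol_map \<gamma>" "\<gamma> 0 = 0" and nj: "normal_jet idx q \<gamma>" and flat: "has_flat_curves q (Suc q) \<gamma>"
    and id: "\<forall>\<^sub>F s in nhds 0. \<forall>i. \<gamma> s $ inv idx (msingle i 1) = s $ i"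
    and ab: "mdeg (idx a) = mdeg (idx b)"
  shows "\<forall>\<^sub>F s in nhds 0. mpow s (idx b) * \<gamma> s $ a = mpow s (idx a) * \<gamma> s $ b"
proof -
  let ?F = "\<lambda>s. mpow s (idx b) * \<gamma> s $ a - mpow s (idx a) * \<gamma> s $ b"
  have hF: "holomorphic_germ ?F" using g(1) by (auto simp: hol_map_def intro!: hol_intros)
  have F0: "?F 0 = 0" by (simp add: g(2))
  have "jet ?F u = 0" for u
  proof (rule jetI)
    show "(\<lambda>t. ?F (t *s u)) has_fps_expansion 0"
    proof (cases "u = 0")
      case True
      then show ?thesis using F0 by (simp add: has_fps_expansion_0_iff)
    next
      case False
      then obtain i0 where i0: "u $ i0 \<noteq> 0" by (auto simp: vec_eq_iff)
      obtain \<sigma> A where s: "hol_curve \<sigma>" "vanish (Suc q) (\<lambda>t. \<sigma> t - t *s u)"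
        "vec.subspace A" "vec.dim A = q" "\<forall>\<^sub>F t in nhds 0. \<gamma> (\<sigma> t) \<in> A"
        using flat False unfolding has_flat_curves_def by blast
      have s0: "\<sigma> 0 = 0" using vanish_at_0[OF s(2)] by simp
      have s1: "vanish 1 \<sigma>" using vanish_add[OF vanish_mono[OF s(2), of 1] vanish_line[of u]] by simp
      define e where "e = (\<lambda>t. \<gamma> (\<sigma> t))"
      have he: "hol_curve e" unfolding e_def by (rule hol_curve_compose[OF g(1) s(1) s0])
      have V: "vanish (Suc q) (\<lambda>t. e t $ j - mpow u (idx j) * t ^ mdeg (idx j))" for j
      proof -
        have d: "1 \<le> mdeg (idx j)" using idx by (auto simp: bij_betw_def multi_indices_def)
        have 1: "vanish (Suc q) (\<lambda>t. e t $ j - mpow (\<sigma> t) (idx j))"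
          unfolding e_def by (rule vanish_compose[OF _ s1]) (use nj in \<open>simp add: normal_jet_def\<close>)
        have "vanish (mdeg (idx j) + q) (\<lambda>t. mpow (\<sigma> t) (idx j) - mpow (t *s u) (idx j))"
          by (rule vanish_mpow_diff[OF vanish_line s(2)])
        then have "vanish (Suc q) (\<lambda>t. mpow (\<sigma> t) (idx j) - mpow (t *s u) (idx j))"
          by (rule vanish_mono) (use d in simp)
        from vanish_add[OF 1 this] show ?thesis by (simp add: mpow_scale mult.commute)
      qed
      have lead: "\<exists>a c. c \<noteq> 0 \<and> vanish (Suc n) (\<lambda>t. bform a (e t) - c * t ^ n)" if n: "1 \<le> n" "n \<le> q" for n
      proof (intro exI conjI)
        let ?j = "inv idx (msingle i0 n)"
        show "u $ i0 ^ n \<noteq> 0" using i0 by simp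
        have "idx ?j = msingle i0 n" by (rule idx_inv[OF idx]) (use n in auto)
        then show "vanish (Suc n) (\<lambda>t. bform (axis ?j 1) (e t) - u $ i0 ^ n * t ^ n)"
          using vanish_mono[OF V[of ?j], of "Suc n"] n by (simp add: bform_one)
      qed
      \<comment> \<open>Along the curve both coordinates agree with u^alpha t^k up to order q + 1,
        with the same k. The combination therefore has order q + 1 and vanishes by rigidity.\<close>
      have rel: "\<forall>\<^sub>F t in nhds 0. mpow u (idx b) * e t $ a - mpow u (idx a) * e t $ b = 0"
        if ab: "mdeg (idx a) = mdeg (idx b)" for a b
      proof -
        have "vanish (Suc q) (\<lambda>t. mpow u (idx b) * (e t $ a - mpow u (idx a) * t ^ mdeg (idx a))
            - mpow u (idx a) * (e t $ b - mpow u (idx b) * t ^ mdeg (idx b)))"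
          by (intro vanish_diff vanish_cmult V)
        then have "vanish (Suc q) (\<lambda>t. bform (mpow u (idx b) *s axis a 1 - mpow u (idx a) *s axis b 1) (e t))"
          by (simp add: bform_two ab algebra_simps)
        from flat_curve_relation[OF he s(3,4) _ lead this] s(5)
        show ?thesis by (simp add: bform_two e_def)
      qed
      \<comment> \<open>The position on the line is read off in a coordinate where \<open>u\<close>
        is nonzero.\<close>
      define \<mu> where "\<mu> = (\<lambda>t. \<sigma> t $ i0 / u $ i0)"
      have mu: "vanish 2 (\<lambda>t. \<mu> t - t)"
      proof -
        have "vanish (Suc q) (\<lambda>t. (1 / u $ i0) * (\<sigma> t $ i0 - t * u $ i0))"
          using s(2) by (intro vanish_cmult) (simp add: vanish_vec_iff)
        then have "vanish (Suc q) (\<lambda>t. \<mu> t - t)" using i0 by (simp add: \<mu>_def field_simps)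
        then show ?thesis by (rule vanish_mono) (use q in simp)
      qed
      have one: "idx (inv idx (msingle i 1)) = msingle i 1" for i by (rule idx_inv[OF idx]) (use q in auto)
      have "\<forall>\<^sub>F t in nhds 0. \<forall>i. u $ i0 * e t $ inv idx (msingle i 1) - u $ i * e t $ inv idx (msingle i0 1) = 0"
      proof (rule eventually_all_finite)
        show "\<forall>\<^sub>F t in nhds 0. u $ i0 * e t $ inv idx (msingle i 1) - u $ i * e t $ inv idx (msingle i0 1) = 0" for i
          using rel[of "inv idx (msingle i 1)" "inv idx (msingle i0 1)", unfolded one mpow_msingle] by simp
      qed
      with eventually_hol_curve[OF s(1) s0 id]
      have line: "\<forall>\<^sub>F t in nhds 0. \<sigma> t = \<mu> t *s u"
      proof eventually_elim
        case (elim t)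
        have "u $ i0 * \<sigma> t $ i = u $ i * \<sigma> t $ i0" for i
          using elim unfolding e_def by simp
        then show ?case using i0 by (simp add: vec_eq_iff \<mu>_def field_simps)
      qed
      let ?g = "\<lambda>z. mpow u (idx b) * \<gamma> (z *s u) $ a - mpow u (idx a) * \<gamma> (z *s u) $ b"
      have ev: "\<forall>\<^sub>F t in nhds 0. ?g (\<mu> t) = 0"
        using line rel[OF ab] by eventually_elim (simp add: e_def)
      have an: "(\<lambda>z. \<gamma> (z *s u) $ j) analytic_on {0}" for j
        by (rule analytic_line[where f="\<lambda>s. \<gamma> s $ j"]) (use g(1) in \<open>simp add: hol_map_def\<close>)
      have gan: "?g analytic_on {0}"
        by (intro analytic_on_diff analytic_on_mult analytic_on_const an)
      have "\<forall>\<^sub>F z in nhds 0. ?g z = 0" by (rule analytic_zero_reparam[OF gan mu ev])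
      then have "\<forall>\<^sub>F z in nhds 0. ?F (z *s u) = 0"
      proof eventually_elim
        case (elim z)
        have "?F (z *s u) = z ^ mdeg (idx b) * ?g z" by (simp add: mpow_scale ab algebra_simps)
        then show ?case using elim by simp
      qed
      then show ?thesis by (simp add: has_fps_expansion_0_iff)
    qed
  qed
  then have "\<forall>\<^sub>F s in nhds 0. ?F s = 0" by (intro jet_all_zero[OF hF]) simp
  then show ?thesis by eventually_elim simp
qed

text \<open>Taking the coordinates of degree 1 as parameters changes s only by terms of order q + 1,
  so neither the jets nor the contact with lines suffer. For two different coordinates, x_(k e_1)
  s_2^k = x_(k e_2) s_1^k makes x_(k e_1) divisible by s_1^k, and the quotient serves all indices of
  degree k.\<close>

theorem flat_lines_normal_form:
  fixes idx :: "'m::finite \<Rightarrow> 'n::finite \<Rightarrow> nat" and \<gamma> :: "complex^'n \<Rightarrow> complex^'m"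
  assumes idx: "bij_betw idx UNIV (multi_indices q)" and n: "2 \<le> CARD('n)" and q: "1 \<le> q"
    and par: "param \<gamma> X" and nj: "normal_jet idx q \<gamma>" and flat: "has_flat_curves q (Suc q) \<gamma>"
  obtains \<delta> f where "param \<delta> X" "\<And>k. 1 \<le> k \<Longrightarrow> k \<le> q \<Longrightarrow> holomorphic_germ (f k) \<and> f k 0 = 1"
    "\<forall>\<^sub>F s in nhds 0. \<forall>j. (\<delta> :: complex^'n \<Rightarrow> complex^'m) s $ j = mpow s (idx j) * f (mdeg (idx j)) s"
proof -
  note g = param_hol[OF par]
  have one: "idx (inv idx (msingle i 1)) = msingle i 1" for i by (rule idx_inv[OF idx]) (use q in auto)
  have dj: "1 \<le> mdeg (idx j)" "mdeg (idx j) \<le> q" for j using idx by (auto simp: bij_betw_def multi_indices_def)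
  define \<theta> where "\<theta> = (\<lambda>s. \<chi> i. \<gamma> s $ inv idx (msingle i 1))"
  have h\<theta>: "hol_map \<theta>" using g(1) by (simp add: hol_map_def \<theta>_def)
  have \<theta>0: "\<theta> 0 = 0" by (simp add: \<theta>_def g(2) vec_eq_iff)
  have v\<theta>: "vanish (Suc q) (\<lambda>s. \<theta> s - s)"
    unfolding vanish_vec_iff
  proof
    fix i
    have "vanish (Suc q) (\<lambda>s. \<gamma> s $ inv idx (msingle i 1) - mpow s (idx (inv idx (msingle i 1))))"
      using nj unfolding normal_jet_def by blast
    then show "vanish (Suc q) (\<lambda>s. (\<theta> s - s) $ i)" unfolding one by (simp add: \<theta>_def)
  qed
  have "vanish 2 (\<lambda>s. \<theta> s - s)" by (rule vanish_mono[OF v\<theta>]) (use q in simp)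
  then obtain \<tau> where t: "hol_map \<tau>" "\<tau> 0 = 0" "\<forall>\<^sub>F z in nhds 0. \<theta> (\<tau> z) = z" "\<forall>\<^sub>F z in nhds 0. \<tau> (\<theta> z) = z"
    "\<And>K. vanish K (\<lambda>s. \<theta> s - s) \<Longrightarrow> vanish K (\<lambda>s. \<tau> s - s)"
    by (rule hol_map_inverse_germ[OF h\<theta> \<theta>0]) (rule that)
  note vt = t(5)[OF v\<theta>] and t1 = vanish_1_hol_map[OF t(1,2)]
  define \<delta> where "\<delta> = (\<lambda>s. \<gamma> (\<tau> s))"
  have par': "param \<delta> X" unfolding \<delta>_def by (rule param_reparam[OF par t(1,2) h\<theta> \<theta>0 t(4,3)])
  note d = param_hol[OF par']
  have nj': "normal_jet idx q \<delta>"
    unfolding normal_jet_def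
  proof
    fix j
    have 1: "vanish (Suc q) (\<lambda>s. \<gamma> (\<tau> s) $ j - mpow (\<tau> s) (idx j))"
      by (rule vanish_compose[OF _ t1]) (use nj in \<open>simp add: normal_jet_def\<close>)
    have "vanish (mdeg (idx j) + q) (\<lambda>s. mpow (\<tau> s) (idx j) - mpow s (idx j))"
      by (rule vanish_mpow_diff[OF _ vt]) simp
    then have "vanish (Suc q) (\<lambda>s. mpow (\<tau> s) (idx j) - mpow s (idx j))" by (rule vanish_mono) (use dj[of j] in simp)
    from vanish_add[OF 1 this] show "vanish (Suc q) (\<lambda>s. \<delta> s $ j - mpow s (idx j))" by (simp add: \<delta>_def)
  qed
  have id: "\<forall>\<^sub>F s in nhds 0. \<forall>i. \<delta> s $ inv idx (msingle i 1) = s $ i"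
    using t(3) by eventually_elim (simp add: \<delta>_def \<theta>_def vec_eq_iff)
  have flat': "has_flat_curves q (Suc q) \<delta>"
    unfolding has_flat_curves_def
  proof (intro allI impI)
    fix u :: "complex^'n" assume "u \<noteq> 0"
    then obtain \<sigma> A where s: "hol_curve \<sigma>" "vanish (Suc q) (\<lambda>t. \<sigma> t - t *s u)"
      "vec.subspace A" "vec.dim A = q" "\<forall>\<^sub>F t in nhds 0. \<gamma> (\<sigma> t) \<in> A"
      using flat unfolding has_flat_curves_def by blast
    have s0: "\<sigma> 0 = 0" using vanish_at_0[OF s(2)] by simp
    have s1: "vanish 1 \<sigma>" using vanish_add[OF vanish_mono[OF s(2), of 1] vanish_line[of u]] by simp
    have "vanish (Suc q) (\<lambda>t. \<theta> (\<sigma> t) - t *s u)"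
      using vanish_add[OF vanish_compose[OF v\<theta> s1] s(2)] by simp
    moreover have "hol_curve (\<lambda>t. \<theta> (\<sigma> t))" by (rule hol_curve_compose[OF h\<theta> s(1) s0])
    moreover have "\<forall>\<^sub>F t in nhds 0. \<delta> (\<theta> (\<sigma> t)) \<in> A"
      using eventually_hol_curve[OF s(1) s0 t(4)] s(5) by eventually_elim (simp add: \<delta>_def)
    ultimately show "\<exists>\<sigma> A. hol_curve \<sigma> \<and> vanish (Suc q) (\<lambda>t. \<sigma> t - t *s u) \<and>
      vec.subspace A \<and> vec.dim A = q \<and> (\<forall>\<^sub>F t in nhds 0. \<delta> (\<sigma> t) \<in> A)"
      using s(3,4) by (intro exI[of _ "\<lambda>t. \<theta> (\<sigma> t)"] exI[of _ A]) simp
  qed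
  note rel = flat_lines_relation[OF idx q d nj' flat' id]
  have "\<exists>i1 i2 :: 'n. i1 \<noteq> i2"
  proof (rule ccontr)
    assume "\<nexists>i1 i2 :: 'n. i1 \<noteq> i2"
    then have "(UNIV :: 'n set) = {undefined}" by auto
    then have "CARD('n) = card {undefined :: 'n}" by simp
    then show False using n by simp
  qed
  then obtain i1 i2 :: 'n where i12: "i1 \<noteq> i2" by blast
  have dg: "holomorphic_germ (\<lambda>s. \<delta> s $ j)" for j using d(1) by (simp add: hol_map_def)
  have "\<exists>h. 1 \<le> k \<and> k \<le> q \<longrightarrow> holomorphic_germ h \<and> h 0 = 1 \<and>
      (\<forall>j. mdeg (idx j) = k \<longrightarrow> (\<forall>\<^sub>F s in nhds 0. \<delta> s $ j = mpow s (idx j) * h s))" for k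
  proof (cases "1 \<le> k \<and> k \<le> q")
    case False
    then show ?thesis by blast
  next
    case True
    let ?a = "inv idx (msingle i1 k)" and ?b = "inv idx (msingle i2 k)"
    have a: "idx ?a = msingle i1 k" and b: "idx ?b = msingle i2 k"
      using True by (auto intro!: idx_inv[OF idx])
    have "\<forall>\<^sub>F s in nhds 0. \<delta> s $ ?a * s $ i2 ^ k = \<delta> s $ ?b * s $ i1 ^ k"
      using rel[of ?a ?b] unfolding a b by (auto elim!: eventually_mono simp: mult.commute)
    then obtain h where h: "holomorphic_germ h" "\<forall>\<^sub>F s in nhds 0. \<delta> s $ ?a = s $ i1 ^ k * h s"
      by (rule hg_divide_power[OF dg dg i12[symmetric]]) (rule that)
    have "\<forall>\<^sub>F s in nhds 0. \<delta> s $ j = mpow s (idx j) * h s" if j: "mdeg (idx j) = k" for j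
    proof (rule hg_cancel[where i=i1 and k=k])
      have "\<forall>\<^sub>F s in nhds 0. s $ i1 ^ k * \<delta> s $ j = mpow s (idx j) * \<delta> s $ ?a"
        using rel[of j ?a] j unfolding a by simp
      with h(2) show "\<forall>\<^sub>F s in nhds 0. s $ i1 ^ k * \<delta> s $ j = s $ i1 ^ k * (mpow s (idx j) * h s)"
        by eventually_elim simp
    qed (intro dg hol_intros h)+
    \<comment> \<open>The jets are normalized beyond degree k, so the part of degree k of s_i1^k (h
      - 1), namely (h(0) - 1) s_i1^k, is zero.\<close>
    moreover have "h 0 = 1"
    proof -
      have "vanish (Suc k) (\<lambda>s. \<delta> s $ ?a - mpow s (idx ?a))"
        using nj' True unfolding normal_jet_def by (auto intro: vanish_mono)
      moreover have "\<forall>\<^sub>F s in nhds 0. \<delta> s $ ?a - mpow s (idx ?a) = s $ i1 ^ k * h s - s $ i1 ^ k"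
        using h(2) unfolding a by eventually_elim simp
      ultimately have v1: "vanish (Suc k) (\<lambda>s. s $ i1 ^ k * h s - s $ i1 ^ k)" by (rule vanish_cong_imp)
      have hp: "hpoly (k * Suc 0) (\<lambda>s. s $ i1 ^ k)" by (rule hpoly_power[OF hpoly_nth])
      have "cdiff_at (\<lambda>s. h s - h 0) 0"
        using hg_diff[OF h(1) hg_const] unfolding holomorphic_germ_iff by (rule eventually_nhds_x_imp_x)
      then have "vanish 1 (\<lambda>s. h s - h 0)" by (rule vanish_1_cdiff) simp
      from vanish_mult[OF hpoly_vanish[OF hp] this]
      have v2: "vanish (Suc k) (\<lambda>s. s $ i1 ^ k * (h s - h 0))" by simp
      have "vanish (Suc k) (\<lambda>s. (h 0 - 1) * s $ i1 ^ k)"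
        using vanish_diff[OF v1 v2] by (simp add: algebra_simps)
      moreover have "hpoly k (\<lambda>s. (h 0 - 1) * s $ i1 ^ k)" using hpoly_cmult[OF hp] by simp
      ultimately have "(h 0 - 1) * axis i1 1 $ i1 ^ k = 0" by (intro hpoly_vanish_zero)
      then show ?thesis by simp
    qed
    ultimately show ?thesis using h(1) by blast
  qed
  then have "\<forall>k. \<exists>h. 1 \<le> k \<and> k \<le> q \<longrightarrow> holomorphic_germ h \<and> h 0 = 1 \<and>
      (\<forall>j. mdeg (idx j) = k \<longrightarrow> (\<forall>\<^sub>F s in nhds 0. \<delta> s $ j = mpow s (idx j) * h s))" by blast
  from choice[OF this] obtain f where f: "\<And>k. 1 \<le> k \<Longrightarrow> k \<le> q \<Longrightarrow> holomorphic_germ (f k) \<and> f k 0 = 1 \<and>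
      (\<forall>j. mdeg (idx j) = k \<longrightarrow> (\<forall>\<^sub>F s in nhds 0. \<delta> s $ j = mpow s (idx j) * f k s))" by blast
  have "\<forall>\<^sub>F s in nhds 0. \<forall>j. \<delta> s $ j = mpow s (idx j) * f (mdeg (idx j)) s"
    by (rule eventually_all_finite) (use f dj in blast)
  moreover have "holomorphic_germ (f k) \<and> f k 0 = 1" if "1 \<le> k" "k \<le> q" for k using f[OF that] by simp
  ultimately show ?thesis by (intro that[OF par'])
qed

section \<open>Projective normalization of the factors f_k\<close>

section \<open>The projective normalization\<close>

text \<open>Formal power series in several variables, written along lines so that the exponent of
  the series variable is the degree. Coefficients of expressions in such families are again
  homogeneous polynomials, which the unknowns Q_(k,i) have to be.\<close>

definition graded :: "(complex^'n::finite \<Rightarrow> complex fps) \<Rightarrow> bool" where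
  "graded \<phi> \<longleftrightarrow> (\<forall>d. hpoly d (\<lambda>s. fps_nth (\<phi> s) d))"

lemma graded_add: "graded \<phi> \<Longrightarrow> graded \<psi> \<Longrightarrow> graded (\<lambda>s. \<phi> s + \<psi> s)"
  unfolding graded_def by (simp add: hpoly_add)

lemma graded_diff: "graded \<phi> \<Longrightarrow> graded \<psi> \<Longrightarrow> graded (\<lambda>s. \<phi> s - \<psi> s)"
  unfolding graded_def by (simp add: hpoly_diff)

lemma graded_mult: assumes "graded \<phi>" "graded \<psi>" shows "graded (\<lambda>s. \<phi> s * \<psi> s)"
  unfolding graded_def fps_mult_nth
proof (intro allI hpoly_sum)
  fix d i :: nat assume "i \<in> {0..d}"
  moreover have "hpoly (i + (d - i)) (\<lambda>s. fps_nth (\<phi> s) i * fps_nth (\<psi> s) (d - i))"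
    by (rule hpoly_mult) (use assms in \<open>auto simp: graded_def\<close>)
  ultimately show "hpoly d (\<lambda>s. fps_nth (\<phi> s) i * fps_nth (\<psi> s) (d - i))" by simp
qed

lemma graded_monomial: assumes "hpoly i P" shows "graded (\<lambda>s. fps_const (P s) * fps_X ^ i)"
  unfolding graded_def
proof
  fix d show "hpoly d (\<lambda>s. fps_nth (fps_const (P s) * fps_X ^ i) d)"
    by (cases "d = i") (simp_all add: fps_X_power_nth assms hpoly_zero)
qed

lemma graded_one: "graded (\<lambda>s. 1)"
  using graded_monomial[OF hpoly_const[of 1]] by simp

lemma graded_zero: "graded (\<lambda>s. 0)"
  by (simp add: graded_def hpoly_zero)

lemma graded_power: "graded \<phi> \<Longrightarrow> graded (\<lambda>s. \<phi> s ^ k)"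
  by (induction k) (auto intro: graded_one graded_mult)

lemma graded_sum: "(\<And>i. i \<in> I \<Longrightarrow> graded (\<phi> i)) \<Longrightarrow> graded (\<lambda>s. \<Sum>i\<in>I. \<phi> i s)"
  by (induction I rule: infinite_finite_induct) (auto intro: graded_zero graded_add)

lemma graded_jet: "holomorphic_germ f \<Longrightarrow> graded (jet f)"
  unfolding graded_def by (simp add: hpoly_jet)

lemma fps_power_perturb:
  fixes F G :: "complex fps"
  assumes "fps_nth F 0 = 1" "1 \<le> D"
  shows "\<exists>R. (F + fps_X ^ D * G) ^ n = F ^ n + fps_X ^ D * R \<and> fps_nth R 0 = of_nat n * fps_nth G 0"
proof (induction n)
  case 0 then show ?case by (intro exI[of _ 0]) simp
next
  case (Suc n)
  then obtain R where R: "(F + fps_X ^ D * G) ^ n = F ^ n + fps_X ^ D * R" "fps_nth R 0 = of_nat n * fps_nth G 0" by blast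
  have "fps_nth (fps_X ^ D :: complex fps) 0 = 0" using assms(2) by simp
  then have "fps_nth (F * R + G * F ^ n + fps_X ^ D * (G * R)) 0 = of_nat (Suc n) * fps_nth G 0"
    using R(2) assms by (simp add: fps_power_zeroth_eq_one algebra_simps)
  moreover have "(F + fps_X ^ D * G) ^ Suc n = F ^ Suc n + fps_X ^ D * (F * R + G * F ^ n + fps_X ^ D * (G * R))"
    unfolding power_Suc R(1) by (simp add: algebra_simps)
  ultimately show ?case by blast
qed

text \<open>The defect of the component of degree \<open>k\<close> after dividing by \<open>F0\<close> and taking
  \<open>s * F1 / F0\<close> as the new parameter.\<close>

definition defect :: "nat \<Rightarrow> complex fps \<Rightarrow> complex fps \<Rightarrow> complex fps \<Rightarrow> complex fps" where
  "defect k F F0 F1 = F * F0 ^ (k - 1) - F1 ^ k"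

text \<open>A perturbation of order \<open>D\<close> leaves lower coefficients alone and changes the
  coefficient of degree \<open>D\<close> by the differential of the defect at F = F0 = F1 = 1,
  applied to the constant terms of the perturbations. The normalization can therefore be solved
  degree by degree through linear equations.\<close>

lemma defect_perturb:
  fixes F F0 F1 G G0 G1 :: "complex fps"
  assumes "fps_nth F 0 = 1" "fps_nth F0 0 = 1" "fps_nth F1 0 = 1" "1 \<le> D" "1 \<le> k"
  defines "E \<equiv> defect k F F0 F1"
    and "E' \<equiv> defect k (F + fps_X ^ D * G) (F0 + fps_X ^ D * G0) (F1 + fps_X ^ D * G1)"
  shows "d < D \<Longrightarrow> fps_nth E' d = fps_nth E d"
    "fps_nth E' D = fps_nth E D + (fps_nth G 0 + of_nat (k - 1) * fps_nth G0 0 - of_nat k * fps_nth G1 0)"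
proof -
  obtain R0 where R0: "(F0 + fps_X ^ D * G0) ^ (k - 1) = F0 ^ (k - 1) + fps_X ^ D * R0"
    "fps_nth R0 0 = of_nat (k - 1) * fps_nth G0 0" using fps_power_perturb[OF assms(2,4)] by blast
  obtain R1 where R1: "(F1 + fps_X ^ D * G1) ^ k = F1 ^ k + fps_X ^ D * R1"
    "fps_nth R1 0 = of_nat k * fps_nth G1 0" using fps_power_perturb[OF assms(3,4)] by blast
  let ?S = "F * R0 + G * F0 ^ (k - 1) + fps_X ^ D * (G * R0) - R1"
  have E': "E' = E + fps_X ^ D * ?S"
    unfolding E'_def E_def defect_def R0(1) R1(1) by (simp add: algebra_simps)
  show "d < D \<Longrightarrow> fps_nth E' d = fps_nth E d" unfolding E' by (simp add: fps_X_power_mult_nth)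
  have "fps_nth (fps_X ^ D :: complex fps) 0 = 0" using assms(4) by simp
  then have "fps_nth ?S 0 = fps_nth G 0 + of_nat (k - 1) * fps_nth G0 0 - of_nat k * fps_nth G1 0"
    using R0(2) R1(2) assms by (simp add: fps_power_zeroth_eq_one)
  then show "fps_nth E' D = fps_nth E D + (fps_nth G 0 + of_nat (k - 1) * fps_nth G0 0 - of_nat k * fps_nth G1 0)"
    unfolding E' by (simp add: fps_X_power_mult_nth)
qed

text \<open>The expansion of f_k + Q_(k,1) f_(k+1) + ..., where \<open>fps_X ^ i\<close> records the
  degree of \<open>Q k i\<close>. The sum ends at f_q, the last available component.\<close>

definition mixed_series ::
    "nat \<Rightarrow> (nat \<Rightarrow> complex^'n::finite \<Rightarrow> complex fps) \<Rightarrow> (nat \<Rightarrow> nat \<Rightarrow> complex^'n \<Rightarrow> complex) \<Rightarrow> nat \<Rightarrow> complex^'n \<Rightarrow> complex fps" where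
  "mixed_series q \<phi> Q k s = (\<Sum>i\<le>q - k. fps_const (Q k i s) * fps_X ^ i * \<phi> (k + i) s)"

lemma mixed_series_nth_0:
  assumes "Q k 0 s = 1" "fps_nth (\<phi> k s) 0 = 1" shows "fps_nth (mixed_series q \<phi> Q k s) 0 = 1"
proof -
  have "fps_nth (mixed_series q \<phi> Q k s) 0 = (\<Sum>i\<le>q - k. if i = 0 then 1 else 0)"
    unfolding mixed_series_def fps_sum_nth by (rule sum.cong) (use assms in auto)
  then show ?thesis by simp
qed

lemma mixed_series_perturb:
  assumes "k \<le> q" "k + D \<le> q"
  shows "mixed_series q \<phi> (\<lambda>k i s. if i = D then Q k i s + a k s else Q k i s) k s
     = mixed_series q \<phi> Q k s + fps_X ^ D * (fps_const (a k s) * \<phi> (k + D) s)"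
proof -
  have D: "D \<in> {..q - k}" using assms by auto
  let ?t = "\<lambda>Q i. fps_const (Q k i s) * fps_X ^ i * \<phi> (k + i) s"
  let ?Q = "\<lambda>k i s. if i = D then Q k i s + a k s else Q k i s"
  have "mixed_series q \<phi> ?Q k s = ?t ?Q D + (\<Sum>i\<in>{..q - k} - {D}. ?t ?Q i)"
    unfolding mixed_series_def by (rule sum.remove[OF _ D]) simp
  also have "(\<Sum>i\<in>{..q - k} - {D}. ?t ?Q i) = (\<Sum>i\<in>{..q - k} - {D}. ?t Q i)"
    by (rule sum.cong) auto
  also have "?t ?Q D + (\<Sum>i\<in>{..q - k} - {D}. ?t Q i) = (?t Q D + (\<Sum>i\<in>{..q - k} - {D}. ?t Q i)) + fps_X ^ D * (fps_const (a k s) * \<phi> (k + D) s)"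
    by (simp add: fps_const_add[symmetric] algebra_simps del: fps_const_add)
  also have "?t Q D + (\<Sum>i\<in>{..q - k} - {D}. ?t Q i) = mixed_series q \<phi> Q k s"
    unfolding mixed_series_def by (rule sum.remove[OF _ D, symmetric]) simp
  finally show ?thesis .
qed

lemma mixed_series_unperturbed:
  assumes "k \<le> q" "\<not> k + D \<le> q"
  shows "mixed_series q \<phi> (\<lambda>k i s. if i = D then Q k i s + a k s else Q k i s) k s = mixed_series q \<phi> Q k s"
  unfolding mixed_series_def by (rule sum.cong) (use assms in auto)

text \<open>In degree \<open>D\<close> the coefficients with \<open>2 \<le> k \<le> q - D\<close> absorb their own defect; the two remaining
  conditions, for \<open>k = q + 1 - D\<close> and \<open>k = q + 2 - D\<close>, form a unimodular linear system for the
  coefficients with \<open>k = 0\<close> and \<open>k = 1\<close>.\<close>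

theorem mixed_series_normalization:
  fixes \<phi> :: "nat \<Rightarrow> complex^'n::finite \<Rightarrow> complex fps"
  assumes q: "2 \<le> q" and gr: "\<And>k. graded (\<phi> k)" and one: "\<And>k s. k \<le> q \<Longrightarrow> fps_nth (\<phi> k s) 0 = 1"
  shows "\<exists>Q. (\<forall>k i. hpoly i (Q k i)) \<and> (\<forall>k s. Q k 0 s = 1) \<and>
     (\<forall>s k d. 2 \<le> k \<longrightarrow> k \<le> q \<longrightarrow> d + k \<le> q + 2 \<longrightarrow>
       fps_nth (defect k (mixed_series q \<phi> Q k s) (mixed_series q \<phi> Q 0 s) (mixed_series q \<phi> Q 1 s)) d = 0)"
proof -
  let ?E = "\<lambda>Q k s. defect k (mixed_series q \<phi> Q k s) (mixed_series q \<phi> Q 0 s) (mixed_series q \<phi> Q 1 s)"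
  have "\<exists>Q. (\<forall>k i. hpoly i (Q k i)) \<and> (\<forall>k s. Q k 0 s = 1) \<and>
     (\<forall>s k d. 2 \<le> k \<longrightarrow> k \<le> q \<longrightarrow> d + k \<le> q + 2 \<longrightarrow> d < D \<longrightarrow> fps_nth (?E Q k s) d = 0)" for D
  proof (induction D)
    case 0
    show ?case
      by (rule exI[of _ "\<lambda>k i s. if i = 0 then 1 else 0"]) (simp add: hpoly_const hpoly_zero)
  next
    case (Suc D)
    then obtain Q where Q: "\<And>k i. hpoly i (Q k i)" "\<And>k s. Q k 0 s = 1"
      "\<And>s k d. 2 \<le> k \<Longrightarrow> k \<le> q \<Longrightarrow> d + k \<le> q + 2 \<Longrightarrow> d < D \<Longrightarrow> fps_nth (?E Q k s) d = 0" by blast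
    have F1: "fps_nth (mixed_series q \<phi> Q k s) 0 = 1" if "k \<le> q" for k s
      by (rule mixed_series_nth_0) (use Q(2) one that in auto)
    consider "D = 0" | "q < D" | "1 \<le> D" "D \<le> q" by linarith
    then show ?case
    proof cases
      case 1
      have "fps_nth (?E Q k s) 0 = 0" if "2 \<le> k" "k \<le> q" for k s
        using F1[of k s] F1[of 0 s] F1[of 1 s] that by (simp add: defect_def fps_power_zeroth_eq_one)
      then show ?thesis using Q(1,2) 1 by (intro exI[of _ Q]) auto
    next
      case 2
      then show ?thesis using Q by (intro exI[of _ Q]) auto
    next
      case 3
      define K where "K = q + 1 - D"
      have K: "1 \<le> K" "K \<le> q" "K + D = q + 1" using 3 by (auto simp: K_def)
      define r where "r = (\<lambda>k s. fps_nth (?E Q k s) D)"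
      have gF: "graded (mixed_series q \<phi> Q k)" for k
        unfolding mixed_series_def[abs_def] by (intro graded_sum graded_mult graded_monomial Q gr)
      have hr: "hpoly D (r k)" for k
      proof -
        have "graded (\<lambda>s. ?E Q k s)" unfolding defect_def by (intro graded_diff graded_mult graded_power gF)
        then show ?thesis by (simp add: graded_def r_def)
      qed
      define a0 where "a0 = (\<lambda>s. if K = 1 then - r 2 s else of_nat (K + 1) * r K s - of_nat K * r (K + 1) s)"
      define a1 where "a1 = (\<lambda>s. if K = 1 then 0 else of_nat K * r K s - of_nat (K - 1) * r (K + 1) s)"
      have "hpoly D (\<lambda>s. of_nat (K + 1) * r K s - of_nat K * r (K + 1) s)"
        by (intro hpoly_diff hpoly_cmult hr)
      then have h0: "hpoly D a0" unfolding a0_def using hpoly_uminus[OF hr] by (cases "K = 1") simp_all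
      have "hpoly D (\<lambda>s. of_nat K * r K s - of_nat (K - 1) * r (K + 1) s)"
        by (intro hpoly_diff hpoly_cmult hr)
      then have h1: "hpoly D a1" unfolding a1_def using hpoly_zero by (cases "K = 1") simp_all
      define a where "a = (\<lambda>k. if k = 0 then a0 else if k = 1 then a1
          else (\<lambda>s. (of_nat k * a1 s - of_nat (k - 1) * a0 s) - r k s))"
      have ha: "hpoly D (a k)" for k
        by (simp add: a_def h0 h1 hpoly_diff hpoly_cmult hr)
      define Q' where "Q' = (\<lambda>k i s. if i = D then Q k i s + a k s else Q k i s)"
      define G where "G = (\<lambda>k s. if k + D \<le> q then fps_const (a k s) * \<phi> (k + D) s else 0)"
      have G0: "fps_nth (G k s) 0 = (if k + D \<le> q then a k s else 0)" for k s
        by (simp add: G_def one)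
      have F': "mixed_series q \<phi> Q' k s = mixed_series q \<phi> Q k s + fps_X ^ D * G k s" if "k \<le> q" for k s
      proof (cases "k + D \<le> q")
        case True
        show ?thesis unfolding Q'_def G_def if_P[OF True] by (rule mixed_series_perturb[OF that True])
      next
        case False
        show ?thesis unfolding Q'_def G_def if_not_P[OF False] mult_zero_right add_0_right
          by (rule mixed_series_unperturbed[OF that False])
      qed
      have "fps_nth (?E Q' k s) d = 0" if k: "2 \<le> k" "k \<le> q" "d + k \<le> q + 2" "d < Suc D" for s k d
      proof -
        have q01: "0 \<le> q" "1 \<le> q" and k1: "1 \<le> k" using q k by auto
        note pert = defect_perturb[OF F1[OF k(2), of s] F1[OF q01(1), of s] F1[OF q01(2), of s] 3(1) k1,
            where G="G k s" and ?G0.0="G 0 s" and ?G1.0="G 1 s",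
            folded F'[OF k(2), of s] F'[OF q01(1), of s] F'[OF q01(2), of s]]
        show ?thesis
        proof (cases "d < D")
          case True
          then show ?thesis using pert(1)[OF True] Q(3)[OF k(1-3) True, of s] by simp
        next
          case False
          then have d: "d = D" using k(4) by simp
          have e: "fps_nth (?E Q' k s) D = r k s + ((if k + D \<le> q then a k s else 0) + of_nat (k - 1) * a0 s
              - of_nat k * (if 1 + D \<le> q then a1 s else 0))"
            unfolding pert(2) G0 r_def using 3 by (simp add: a_def)
          have kK: "k \<le> K + 1" using k(3) K(3) d by simp
          have ak: "a k s = (of_nat k * a1 s - of_nat (k - 1) * a0 s) - r k s" using k(1) by (simp add: a_def)
          consider "k < K" | "k = K" | "k = K + 1" using kK by linarith
          then have "r k s + ((if k + D \<le> q then a k s else 0) + of_nat (k - 1) * a0 s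
              - of_nat k * (if 1 + D \<le> q then a1 s else 0)) = 0"
          proof cases
            case 1
            then have "k + D \<le> q" "1 + D \<le> q" using K k by auto
            then show ?thesis by (simp add: ak)
          next
            case 2
            then have c: "\<not> k + D \<le> q" "1 + D \<le> q" "K \<noteq> 1" using K k by auto
            obtain K' where K': "K = Suc K'" using K(1) by (cases K) auto
            show ?thesis using c unfolding 2 a0_def a1_def by (simp add: K' algebra_simps)
          next
            case 3
            then have c: "\<not> k + D \<le> q" using K by auto
            show ?thesis
            proof (cases "K = 1")
              case True
              then have "\<not> 1 + D \<le> q" using K by auto
              then show ?thesis using True c 3 by (simp add: a0_def numeral_2_eq_2)
            next
              case False
              then have "1 + D \<le> q" using K by auto
              obtain K' where K': "K = Suc K'" using K(1) by (cases K) auto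
              show ?thesis using c \<open>1 + D \<le> q\<close> False unfolding 3 a0_def a1_def by (simp add: K' algebra_simps)
            qed
          qed
          then show ?thesis unfolding d e .
        qed
      qed
      moreover have "hpoly i (Q' k i)" for k i
        using hpoly_add[OF Q(1)[of D k] ha[of k]] Q(1)[of i k] unfolding Q'_def by (cases "i = D") simp_all
      moreover have "Q' k 0 s = 1" for k s using Q(2) 3 by (simp add: Q'_def)
      ultimately show ?thesis by (intro exI[of _ Q']) blast
    qed
  qed
  \<comment> \<open>Every degree d with d + k <= q + 2 lies below q + 3, so this stage covers all
    conditions.\<close>
  from this[of "Suc (q + 2)"] show ?thesis by (elim exE conjE, intro exI conjI) auto
qed

text \<open>The homogeneous coordinate \<open>None\<close> stands for the monomial 1; with it all
  monomials of degree at most \<open>q\<close> are treated alike.\<close>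

definition hidx :: "('m \<Rightarrow> 'n \<Rightarrow> nat) \<Rightarrow> 'm option \<Rightarrow> 'n \<Rightarrow> nat" where
  "hidx idx a = (case a of None \<Rightarrow> (\<lambda>_. 0) | Some j \<Rightarrow> idx j)"

lemma hidx_simps [simp]: "hidx idx None = (\<lambda>_. 0)" "hidx idx (Some j) = idx j"
  by (simp_all add: hidx_def)

lemma bij_hidx:
  fixes idx :: "'m::finite \<Rightarrow> 'n::finite \<Rightarrow> nat"
  assumes "bij_betw idx UNIV (multi_indices q)"
  shows "bij_betw (hidx idx) UNIV {\<alpha>. mdeg \<alpha> \<le> q}"
proof -
  have inj: "inj idx" and im: "range idx = multi_indices q" using assms by (auto simp: bij_betw_def)
  have pos: "idx j \<noteq> (\<lambda>_. 0)" for j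
  proof
    assume "idx j = (\<lambda>_. 0)"
    then have "mdeg (idx j) = 0" by simp
    moreover have "idx j \<in> multi_indices q" using im by auto
    ultimately show False by (simp add: multi_indices_def)
  qed
  have "inj (hidx idx)"
  proof (rule injI)
    fix a b assume "hidx idx a = hidx idx b"
    then show "a = b" using pos pos[symmetric] injD[OF inj] by (cases a; cases b) auto
  qed
  moreover have "range (hidx idx) = insert (\<lambda>_. 0) (range idx)"
    unfolding UNIV_option_conv by (auto simp: image_image)
  moreover have "insert (\<lambda>_. 0) (multi_indices q) = {\<alpha>::'n \<Rightarrow> nat. mdeg \<alpha> \<le> q}"
  proof
    show "{\<alpha>::'n \<Rightarrow> nat. mdeg \<alpha> \<le> q} \<subseteq> insert (\<lambda>_. 0) (multi_indices q)"
    proof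
      fix \<alpha> :: "'n \<Rightarrow> nat" assume "\<alpha> \<in> {\<alpha>. mdeg \<alpha> \<le> q}"
      then show "\<alpha> \<in> insert (\<lambda>_. 0) (multi_indices q)"
        using mdeg_0_iff[of \<alpha>] by (cases "mdeg \<alpha> = 0") (auto simp: multi_indices_def)
    qed
  qed (auto simp: multi_indices_def)
  ultimately show ?thesis unfolding bij_betw_def im by simp
qed

lemma mdeg_less:
  fixes \<alpha> \<beta> :: "'n::finite \<Rightarrow> nat"
  assumes "\<And>i. \<alpha> i \<le> \<beta> i" "\<alpha> \<noteq> \<beta>" shows "mdeg \<alpha> < mdeg \<beta>"
proof -
  obtain i where "\<alpha> i \<noteq> \<beta> i" using assms(2) by auto
  then have "\<alpha> i < \<beta> i" using assms(1)[of i] by simp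
  then show ?thesis unfolding mdeg_def using assms(1) by (intro sum_strict_mono_ex1) auto
qed

lemma sum_shifted_monomials:
  fixes \<alpha> :: "'n::finite \<Rightarrow> nat" and g :: "('n \<Rightarrow> nat) \<Rightarrow> complex"
  assumes "mdeg \<alpha> \<le> q"
  shows "(\<Sum>\<beta>\<in>{\<beta>. mdeg \<beta> \<le> q}. if \<forall>i. \<alpha> i \<le> \<beta> i then g \<beta> else 0)
    = (\<Sum>i\<le>q - mdeg \<alpha>. \<Sum>\<delta>\<in>{\<delta>. mdeg \<delta> = i}. g (madd \<alpha> \<delta>))"
proof -
  let ?B = "{\<beta>. mdeg \<beta> \<le> q \<and> (\<forall>i. \<alpha> i \<le> \<beta> i)}" and ?C = "{\<delta>::'n \<Rightarrow> nat. mdeg \<delta> \<le> q - mdeg \<alpha>}"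
  have bij: "bij_betw (madd \<alpha>) ?C ?B"
    unfolding bij_betw_def
  proof
    show "inj_on (madd \<alpha>) ?C" by (rule inj_onI) (auto simp: madd_def fun_eq_iff)
    show "madd \<alpha> ` ?C = ?B"
    proof
      show "madd \<alpha> ` ?C \<subseteq> ?B"
      proof (rule image_subsetI)
        fix \<delta> assume "\<delta> \<in> ?C"
        then have "mdeg (madd \<alpha> \<delta>) \<le> q" using assms by simp
        then show "madd \<alpha> \<delta> \<in> ?B" by (simp add: madd_def)
      qed
      show "?B \<subseteq> madd \<alpha> ` ?C"
      proof
        fix \<beta> assume b: "\<beta> \<in> ?B"
        define \<delta> where "\<delta> = (\<lambda>i. \<beta> i - \<alpha> i)"
        have e: "\<beta> = madd \<alpha> \<delta>" using b by (auto simp: madd_def \<delta>_def fun_eq_iff)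
        then have "mdeg \<beta> = mdeg \<alpha> + mdeg \<delta>" by simp
        then have "\<delta> \<in> ?C" using b by auto
        then show "\<beta> \<in> madd \<alpha> ` ?C" using e by blast
      qed
    qed
  qed
  have "(\<Sum>\<beta>\<in>{\<beta>. mdeg \<beta> \<le> q}. if \<forall>i. \<alpha> i \<le> \<beta> i then g \<beta> else 0) = (\<Sum>\<beta>\<in>?B. g \<beta>)"
    by (subst sum.inter_filter[symmetric]) (auto simp: finite_mdeg_le)
  also have "\<dots> = (\<Sum>\<delta>\<in>?C. g (madd \<alpha> \<delta>))" by (rule sum.reindex_bij_betw[OF bij, symmetric])
  also have "\<dots> = (\<Sum>i\<le>q - mdeg \<alpha>. \<Sum>\<delta>\<in>{\<delta>\<in>?C. mdeg \<delta> = i}. g (madd \<alpha> \<delta>))"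
    by (rule sum.group[symmetric]) (auto simp: finite_mdeg_le)
  also have "\<dots> = (\<Sum>i\<le>q - mdeg \<alpha>. \<Sum>\<delta>\<in>{\<delta>. mdeg \<delta> = i}. g (madd \<alpha> \<delta>))"
    by (intro sum.cong refl) auto
  finally show ?thesis .
qed

text \<open>Among the nonzero entries of a kernel vector take one with the largest \<open>d\<close>:
  in its row all other terms vanish, so the entry itself is zero.\<close>

lemma invertible_unipotent:
  fixes M :: "complex^'k::finite^'k" and d :: "'k \<Rightarrow> nat"
  assumes diag: "\<And>a. M $ a $ a = 1" and upper: "\<And>a b. a \<noteq> b \<Longrightarrow> M $ a $ b \<noteq> 0 \<Longrightarrow> d a < d b"
  shows "invertible M"
  unfolding invertible_left_inverse matrix_left_invertible_ker
proof (intro allI impI, rule ccontr)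
  fix X assume MX: "M *v X = 0" and "X \<noteq> 0"
  let ?A = "d ` {a. X $ a \<noteq> 0}"
  have "?A \<noteq> {}" using \<open>X \<noteq> 0\<close> by (auto simp: vec_eq_iff)
  then have "Max ?A \<in> ?A" by (intro Max_in) auto
  then obtain a where a: "X $ a \<noteq> 0" "d a = Max ?A" by auto
  have mx: "d b \<le> d a" if "X $ b \<noteq> 0" for b unfolding a(2) by (rule Max_ge) (use that in auto)
  have "(M *v X) $ a = M $ a $ a * X $ a + (\<Sum>b\<in>UNIV - {a}. M $ a $ b * X $ b)"
    unfolding matrix_vector_mult_def vec_lambda_beta by (rule sum.remove) auto
  also have "(\<Sum>b\<in>UNIV - {a}. M $ a $ b * X $ b) = 0"
  proof (rule sum.neutral, rule ballI)
    fix b assume "b \<in> UNIV - {a}"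
    then show "M $ a $ b * X $ b = 0" using upper[of a b] mx[of b] by force
  qed
  finally show False using MX a(1) diag by simp
qed

text \<open>A matrix carrying the coefficients of Q_(|alpha|,i) at the places (alpha, alpha + delta)
  with |delta| = i turns s^alpha f_|alpha| into s^alpha F_|alpha|. After division by F_0 and with
  the parameter z = s F_1 / F_0 this is z^alpha F_k F_0^(k-1) / F_1^k, so R_k is the defect divided
  by F_1^k.\<close>

theorem projective_normal_form:
  fixes idx :: "'m::finite \<Rightarrow> 'n::finite \<Rightarrow> nat" and \<delta> :: "complex^'n \<Rightarrow> complex^'m"
  assumes idx: "bij_betw idx UNIV (multi_indices q)" and q: "2 \<le> q"
    and f: "\<And>k. 1 \<le> k \<Longrightarrow> k \<le> q \<Longrightarrow> holomorphic_germ (f k) \<and> f k 0 = 1"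
    and d: "\<forall>\<^sub>F s in nhds 0. \<forall>j. \<delta> s $ j = mpow s (idx j) * f (mdeg (idx j)) s"
  obtains M \<tau> \<sigma> R where "invertible M" "homography_defined_at M 0" "homography M 0 = 0"
    "hol_map \<tau>" "\<tau> 0 = 0" "hol_map \<sigma>" "\<sigma> 0 = 0" "\<forall>\<^sub>F z in nhds 0. \<tau> (\<sigma> z) = z" "\<forall>\<^sub>F z in nhds 0. \<sigma> (\<tau> z) = z"
    "admissible_remainders q R" "R 1 = (\<lambda>s. 0)"
    "\<And>\<alpha>. 2 \<le> mdeg \<alpha> \<Longrightarrow> mdeg \<alpha> \<le> q \<Longrightarrow> vanish (q + 3) (\<lambda>s. mpow s \<alpha> * R (mdeg \<alpha>) s)"
    "\<forall>\<^sub>F s in nhds 0. homography M (\<delta> (\<tau> s)) = normal_form_param idx R s"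
proof -
  have dj: "1 \<le> mdeg (idx j)" "mdeg (idx j) \<le> q" for j using idx by (auto simp: bij_betw_def multi_indices_def)
  \<comment> \<open>The value 1 at index 0 represents the homogeneous coordinate
    \<open>None\<close>, which is 1 on the affine chart.\<close>
  define f' where "f' = (\<lambda>k. if 1 \<le> k \<and> k \<le> q then f k else (\<lambda>s. 1))"
  have hf: "holomorphic_germ (f' k)" and f1: "f' k 0 = 1" for k using f[of k] by (auto simp: f'_def hg_const)
  have gj: "graded (jet (f' k))" for k by (rule graded_jet[OF hf])
  have fj: "fps_nth (jet (f' k) s) 0 = 1" for k s by (simp add: jet_nth f1)
  obtain Q where Q: "\<And>k i. hpoly i (Q k i)" "\<And>k s. Q k 0 s = 1"
    "\<And>s k d. 2 \<le> k \<Longrightarrow> k \<le> q \<Longrightarrow> d + k \<le> q + 2 \<Longrightarrow>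
       fps_nth (defect k (mixed_series q (\<lambda>k. jet (f' k)) Q k s) (mixed_series q (\<lambda>k. jet (f' k)) Q 0 s) (mixed_series q (\<lambda>k. jet (f' k)) Q 1 s)) d = 0"
    using mixed_series_normalization[OF q, of "\<lambda>k. jet (f' k)", OF gj fj] by blast
  define F where "F = (\<lambda>k s. \<Sum>i\<le>q - k. Q k i s * f' (k + i) s)"
  have hF: "holomorphic_germ (F k)" for k unfolding F_def by (intro hg_sum hg_mult[OF hpoly_hg[OF Q(1)] hf])
  have F0: "F k 0 = 1" for k
  proof -
    have "F k 0 = (\<Sum>i\<le>q - k. if i = 0 then 1 else 0)"
      unfolding F_def
    proof (rule sum.cong)
      fix i assume "i \<in> {..q - k}"
      show "Q k i 0 * f' (k + i) 0 = (if i = 0 then 1 else 0)"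
      proof (cases i)
        case 0 then show ?thesis by (simp add: Q(2) f1)
      next
        case (Suc i')
        then show ?thesis using vanish_at_0[of i' "Q k i"] hpoly_vanish[OF Q(1)[of i k]] by simp
      qed
    qed simp
    then show ?thesis by simp
  qed
  have jF: "jet (F k) s = mixed_series q (\<lambda>k. jet (f' k)) Q k s" for k s
  proof -
    have "holomorphic_germ (\<lambda>s. Q k i s * f' (k + i) s)" for i by (rule hg_mult[OF hpoly_hg[OF Q(1)] hf])
    from jet_sum[of "{..q - k}", OF this] show ?thesis
      unfolding F_def mixed_series_def by (simp add: jet_mult[OF hpoly_hg[OF Q(1)] hf] jet_hpoly[OF Q(1)])
  qed
  \<comment> \<open>The condition d + k <= q + 2 on the vanishing coefficients of the defect means d
    < q + 3 - k; the factor s^alpha will supply the missing order k.\<close>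
  have small: "vanish (q + 3 - k) (\<lambda>s. F k s * F 0 s ^ (k - 1) - F 1 s ^ k)" if k: "2 \<le> k" "k \<le> q" for k
  proof -
    have hol: "holomorphic_germ (\<lambda>s. F k s * F 0 s ^ (k - 1) - F 1 s ^ k)" by (intro hol_intros hF)
    have "jet (\<lambda>s. F k s * F 0 s ^ (k - 1) - F 1 s ^ k) s = defect k (jet (F k) s) (jet (F 0) s) (jet (F 1) s)" for s
      unfolding defect_def by (simp add: jet_diff jet_mult jet_power hol_intros hF)
    then show ?thesis
      unfolding vanish_iff_jet[OF hol] using Q(3)[OF k] k unfolding jF by simp
  qed
  have "\<forall>k. \<exists>c. \<forall>i s. Q k i s = (\<Sum>\<alpha>\<in>{\<alpha>. mdeg \<alpha> = i}. c i \<alpha> * mpow s \<alpha>)"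
    using Q(1) unfolding hpoly_def by (intro allI choice) blast
  from choice[OF this] obtain c where c: "\<And>k i s. Q k i s = (\<Sum>\<alpha>\<in>{\<alpha>. mdeg \<alpha> = i}. c k i \<alpha> * mpow s \<alpha>)" by blast
  \<comment> \<open>One family holds the coefficients of \<open>Q k i\<close> for all
    \<open>i\<close>, because the degree of the multi-index already tells which \<open>i\<close> is
    meant.\<close>
  define co where "co = (\<lambda>k \<alpha>. c k (mdeg \<alpha>) \<alpha>)"
  have co: "Q k i s = (\<Sum>\<alpha>\<in>{\<alpha>. mdeg \<alpha> = i}. co k \<alpha> * mpow s \<alpha>)" for k i s
    unfolding c co_def by (rule sum.cong) auto
  have co0: "co k (\<lambda>_. 0) = 1" for k using co[of k 0 0] Q(2)[of k 0] by (simp add: mdeg_0_iff)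
  let ?ix = "hidx idx"
  note bx = bij_hidx[OF idx]
  have dx: "mdeg (?ix a) \<le> q" for a using bx by (auto simp: bij_betw_def)
  define M where "M = (\<chi> a b. if \<forall>i. ?ix a i \<le> ?ix b i then co (mdeg (?ix a)) (\<lambda>i. ?ix b i - ?ix a i) else 0)"
  have invM: "invertible M"
  proof (rule invertible_unipotent[where d="\<lambda>a. mdeg (?ix a)"])
    show "M $ a $ a = 1" for a by (simp add: M_def co0)
    fix a b assume ab: "a \<noteq> b" "M $ a $ b \<noteq> 0"
    then have "?ix a \<noteq> ?ix b" using bx by (auto simp: bij_betw_def dest: injD)
    moreover have "\<forall>i. ?ix a i \<le> ?ix b i" using ab(2) by (auto simp: M_def split: if_splits)
    ultimately show "mdeg (?ix a) < mdeg (?ix b)" by (intro mdeg_less) auto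
  qed
  have MX: "(M *v X) $ a = mpow s (?ix a) * F (mdeg (?ix a)) s"
    if X: "\<And>b. X $ b = mpow s (?ix b) * f' (mdeg (?ix b)) s" for X s a
  proof -
    let ?g = "\<lambda>\<beta>. co (mdeg (?ix a)) (\<lambda>i. \<beta> i - ?ix a i) * (mpow s \<beta> * f' (mdeg \<beta>) s)"
    have "(M *v X) $ a = (\<Sum>b\<in>UNIV. if \<forall>i. ?ix a i \<le> ?ix b i then ?g (?ix b) else 0)"
      unfolding matrix_vector_mult_def vec_lambda_beta by (rule sum.cong) (auto simp: M_def X)
    also have "\<dots> = (\<Sum>\<beta>\<in>{\<beta>. mdeg \<beta> \<le> q}. if \<forall>i. ?ix a i \<le> \<beta> i then ?g \<beta> else 0)"
      by (rule sum.reindex_bij_betw[OF bx])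
    also have "\<dots> = (\<Sum>i\<le>q - mdeg (?ix a). \<Sum>\<delta>\<in>{\<delta>. mdeg \<delta> = i}. ?g (madd (?ix a) \<delta>))"
      by (rule sum_shifted_monomials[OF dx])
    also have "\<dots> = (\<Sum>i\<le>q - mdeg (?ix a). mpow s (?ix a) * (Q (mdeg (?ix a)) i s * f' (mdeg (?ix a) + i) s))"
    proof (rule sum.cong[OF refl])
      fix i
      have "?g (madd (?ix a) \<delta>) = mpow s (?ix a) * ((co (mdeg (?ix a)) \<delta> * mpow s \<delta>) * f' (mdeg (?ix a) + i) s)"
        if "mdeg \<delta> = i" for \<delta>
      proof -
        have "(\<lambda>i. madd (?ix a) \<delta> i - ?ix a i) = \<delta>" by (simp add: madd_def)
        then show ?thesis using that by (simp add: mpow_madd mult_ac)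
      qed
      then show "(\<Sum>\<delta>\<in>{\<delta>. mdeg \<delta> = i}. ?g (madd (?ix a) \<delta>)) = mpow s (?ix a) * (Q (mdeg (?ix a)) i s * f' (mdeg (?ix a) + i) s)"
        unfolding co sum_distrib_left sum_distrib_right by (intro sum.cong refl) auto
    qed
    also have "\<dots> = mpow s (?ix a) * F (mdeg (?ix a)) s" by (simp add: F_def sum_distrib_left)
    finally show ?thesis .
  qed
  have hom: "\<forall>\<^sub>F s in nhds 0. \<forall>a. (M *v homogenize (\<delta> s)) $ a = mpow s (?ix a) * F (mdeg (?ix a)) s"
    using d
  proof eventually_elim
    case (elim s)
    show ?case
    proof (rule allI, rule MX)
      fix b show "homogenize (\<delta> s) $ b = mpow s (?ix b) * f' (mdeg (?ix b)) s"
        using elim dj by (cases b) (auto simp: f'_def)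
    qed
  qed
  have mp0: "mpow 0 (idx j) = 0" for j using vanish_at_0[of "mdeg (idx j) - 1" "\<lambda>s. mpow s (idx j)"] vanish_mpow[of "idx j"] dj(1)[of j] by simp
  have d0: "\<delta> 0 = 0" using eventually_nhds_x_imp_x[OF d] by (simp add: vec_eq_iff mp0)
  have M0: "(M *v homogenize 0) $ a = mpow 0 (?ix a)" for a
    using eventually_nhds_x_imp_x[OF hom] by (simp add: d0 F0)
  have def0: "homography_defined_at M 0" by (simp add: homography_defined_at_def M0)
  have fix0: "homography M 0 = 0" by (simp add: vec_eq_iff homography_nth M0 mp0)
  \<comment> \<open>The coordinates of degree 1 after division by F_0. As F_0 and F_1 are 1 at the
    origin, this change of parameter is tangent to the identity.\<close>
  define \<sigma> where "\<sigma> = (\<lambda>s::complex^'n. (F 1 s / F 0 s) *s s)"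
  have hq: "holomorphic_germ (\<lambda>s. F 1 s / F 0 s)" by (intro hol_intros hF) (simp add: F0)
  have hs: "hol_map \<sigma>" unfolding \<sigma>_def
    by (rule hol_mapI) (simp only: vector_smult_component, rule hg_mult[OF hq hg_nth])
  have s0: "\<sigma> 0 = 0" by (simp add: \<sigma>_def)
  have "cdiff_at (\<lambda>s. F 1 s / F 0 s - 1) 0"
    using hg_diff[OF hq hg_const] unfolding holomorphic_germ_iff by (rule eventually_nhds_x_imp_x)
  then have "vanish 1 (\<lambda>s. F 1 s / F 0 s - 1)" by (rule vanish_1_cdiff) (simp add: F0)
  from vanish_smult[OF this vanish_id] have "vanish 2 (\<lambda>s. \<sigma> s - s)"
    by (simp add: \<sigma>_def numeral_2_eq_2 vector_sub_rdistrib)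
  then obtain \<tau> where t: "hol_map \<tau>" "\<tau> 0 = 0" "\<forall>\<^sub>F z in nhds 0. \<sigma> (\<tau> z) = z" "\<forall>\<^sub>F z in nhds 0. \<tau> (\<sigma> z) = z"
    by (rule hol_map_inverse_germ[OF hs s0]) (rule that)
  \<comment> \<open>For k = 1 the quotient is 1 near the origin; prescribing 0 makes
    \<open>R 1\<close> the zero function and not only the zero germ.\<close>
  define R where "R = (\<lambda>k s. if k = 1 then 0 else F k (\<tau> s) * F 0 (\<tau> s) ^ (k - 1) / F 1 (\<tau> s) ^ k - 1)"
  have hFt: "holomorphic_germ (\<lambda>s. F k (\<tau> s))" for k by (rule hg_compose[OF hF t(1,2)])
  have nz: "\<forall>\<^sub>F s in nhds 0. F k (\<tau> s) \<noteq> 0" for k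
    by (rule hg_eventually_nonzero[OF hFt]) (simp add: t(2) F0)
  have adm: "admissible_remainders q R"
    unfolding admissible_remainders_def
  proof
    fix k
    have "holomorphic_germ (\<lambda>s. F k (\<tau> s) * F 0 (\<tau> s) ^ (k - 1) / F 1 (\<tau> s) ^ k - 1)"
      by (intro hol_intros hFt) (simp add: t(2) F0)
    then show "holomorphic_germ (R k) \<and> R k 0 = 0"
      unfolding R_def by (cases "k = 1") (auto simp: hg_const t(2) F0)
  qed
  have small_R: "vanish (q + 3) (\<lambda>s. mpow s \<alpha> * R (mdeg \<alpha>) s)" if k: "2 \<le> mdeg \<alpha>" "mdeg \<alpha> \<le> q" for \<alpha>
  proof -
    define k where "k = mdeg \<alpha>"
    have k2: "2 \<le> k" "k \<le> q" using k by (auto simp: k_def)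
    have "vanish (q + 3 - k) (\<lambda>s. F k (\<tau> s) * F 0 (\<tau> s) ^ (k - 1) - F 1 (\<tau> s) ^ k)"
      by (rule vanish_compose[OF small[OF k2] vanish_1_hol_map[OF t(1,2)]])
    moreover have "vanish 0 (\<lambda>s. 1 / F 1 (\<tau> s) ^ k)"
      by (rule vanish_0_hg, intro hol_intros hFt) (simp add: t(2) F0)
    ultimately have "vanish (q + 3 - k) (\<lambda>s. (F k (\<tau> s) * F 0 (\<tau> s) ^ (k - 1) - F 1 (\<tau> s) ^ k) * (1 / F 1 (\<tau> s) ^ k))"
      by (rule vanish_mult0)
    moreover have "\<forall>\<^sub>F s in nhds 0. (F k (\<tau> s) * F 0 (\<tau> s) ^ (k - 1) - F 1 (\<tau> s) ^ k) * (1 / F 1 (\<tau> s) ^ k) = R k s"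
      using nz[of 1] by eventually_elim (use k2 in \<open>simp add: R_def field_simps\<close>)
    ultimately have "vanish (q + 3 - k) (R k)" by (rule vanish_cong_imp)
    from vanish_mult[OF vanish_mpow[of \<alpha>] this] show ?thesis using k2 by (simp add: k_def)
  qed
  have nf: "\<forall>\<^sub>F s in nhds 0. homography M (\<delta> (\<tau> s)) = normal_form_param idx R s"
    using eventually_hol_map[OF t(1,2) hom] nz[of 0] nz[of 1] t(3)
  proof eventually_elim
    case (elim s)
    have "homography M (\<delta> (\<tau> s)) $ j = normal_form_param idx R s $ j" for j
    proof -
      define k where "k = mdeg (idx j)"
      obtain k' where k': "k = Suc k'" using dj(1)[of j] unfolding k_def by (cases "mdeg (idx j)") auto
      have "mpow s (idx j) = mpow (\<sigma> (\<tau> s)) (idx j)" using elim(4) by simp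
      also have "\<dots> = (F 1 (\<tau> s) / F 0 (\<tau> s)) ^ k * mpow (\<tau> s) (idx j)"
        by (simp add: \<sigma>_def mpow_scale k_def)
      finally have m: "mpow s (idx j) = (F 1 (\<tau> s) / F 0 (\<tau> s)) ^ k * mpow (\<tau> s) (idx j)" .
      have r: "1 + R k s = F k (\<tau> s) * F 0 (\<tau> s) ^ (k - 1) / F 1 (\<tau> s) ^ k"
        using elim(2,3) by (auto simp: R_def)
      have "normal_form_param idx R s $ j = mpow s (idx j) * (1 + R k s)"
        by (simp add: normal_form_param_def k_def algebra_simps)
      also have "\<dots> = mpow (\<tau> s) (idx j) * F k (\<tau> s) / F 0 (\<tau> s)"
        unfolding m r using elim(2,3) by (simp add: k' power_divide)
      also have "\<dots> = homography M (\<delta> (\<tau> s)) $ j"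
        using elim(1) by (simp add: homography_nth k_def)
      finally show ?thesis ..
    qed
    then show ?case by (simp add: vec_eq_iff)
  qed
  have "R 1 = (\<lambda>s. 0)" by (simp add: R_def)
  from that[OF invM def0 fix0 t(1,2) hs s0 t(4,3) adm this small_R nf] show ?thesis .
qed

section \<open>The converse, the count of multi-indices and the final equivalences\<close>

section \<open>Normal forms have property (P)\<close>

text \<open>The factor 1 + R_k depends only on the degree, so the image of the line t u is a
  combination of \<open>q\<close> fixed vectors, the homogeneous parts of (u^alpha): lines
  themselves give flat curves. The left inverse required by \<open>param\<close> is the projection
  to the coordinates of degree 1 followed by a local inverse.\<close>

theorem normal_form_regular_flat:
  fixes idx :: "'m::finite \<Rightarrow> 'n::finite \<Rightarrow> nat"
  assumes idx: "bij_betw idx UNIV (multi_indices q)" and q: "2 \<le> q"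
    and R: "admissible_remainders q R" and Y: "parametrizes (normal_form_param idx R) Y"
  shows "param (normal_form_param idx R) Y" "jet_regular q (normal_form_param idx R)"
    "has_flat_curves q 2 (normal_form_param idx R)"
proof -
  let ?g = "normal_form_param idx R :: complex^'n \<Rightarrow> complex^'m"
  have dj: "1 \<le> mdeg (idx j)" "mdeg (idx j) \<le> q" for j using idx by (auto simp: bij_betw_def multi_indices_def)
  have hR: "holomorphic_germ (R k)" "R k 0 = 0" if "1 \<le> k" "k \<le> q" for k
    using R that by (auto simp: admissible_remainders_def)
  have R1: "vanish 1 (R k)" if "1 \<le> k" "k \<le> q" for k
    by (rule vanish_1_cdiff) (use hR[OF that] eventually_nhds_x_imp_x in \<open>auto simp: holomorphic_germ_iff\<close>)
  have hg: "hol_map ?g"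
    by (rule hol_mapI) (simp only: normal_form_param_def vec_lambda_beta, intro hg_add hg_mult hg_mpow hR dj)
  have v: "vanish (Suc (mdeg (idx j))) (\<lambda>s. ?g s $ j - mpow s (idx j))" for j
    using vanish_mult[OF vanish_mpow R1[OF dj], of "idx j" j] by (simp add: normal_form_param_def)
  have g0: "?g 0 = 0"
  proof -
    have "mpow 0 (idx j) = 0" for j
      using vanish_at_0[of "mdeg (idx j) - 1" "\<lambda>s. mpow s (idx j)"] vanish_mpow[of "idx j"] dj(1)[of j] by simp
    then show ?thesis by (simp add: normal_form_param_def vec_eq_iff)
  qed
  show "jet_regular q ?g" by (rule jet_regular_triangular[OF idx v])
  have one: "idx (inv idx (msingle i 1)) = msingle i 1" for i by (rule idx_inv[OF idx]) (use q in auto)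
  define \<theta> where "\<theta> = (\<lambda>y :: complex^'m. \<chi> i. y $ inv idx (msingle i 1)) \<circ> ?g"
  have h\<theta>: "hol_map \<theta>" using hg by (simp add: hol_map_def \<theta>_def)
  have \<theta>0: "\<theta> 0 = 0" by (simp add: \<theta>_def g0 vec_eq_iff)
  have "vanish 2 (\<lambda>s. \<theta> s - s)"
    unfolding vanish_vec_iff
  proof
    fix i
    show "vanish 2 (\<lambda>s. (\<theta> s - s) $ i)"
      using v[of "inv idx (msingle i 1)"] unfolding one by (simp add: \<theta>_def numeral_2_eq_2)
  qed
  then obtain \<rho> where rho: "hol_map \<rho>" "\<rho> 0 = 0" "\<forall>\<^sub>F z in nhds 0. \<rho> (\<theta> z) = z"
    by (rule hol_map_inverse_germ[OF h\<theta> \<theta>0]) (rule that)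
  show "param ?g Y"
  proof (rule parametrizes_param[OF hg g0 _ _ _ Y])
    have hp: "hol_map (\<lambda>y::complex^'m. (\<chi> i. y $ inv idx (msingle i 1)) :: complex^'n)"
      by (rule hol_mapI) (simp add: hg_nth)
    show "hol_map (\<lambda>y. \<rho> (\<chi> i. y $ inv idx (msingle i 1)))"
      by (rule hol_map_compose[OF rho(1) hp]) (simp add: vec_eq_iff)
    have "(\<chi> i. (0::complex^'m) $ inv idx (msingle i 1)) = 0" by (simp add: vec_eq_iff)
    then show "\<rho> (\<chi> i. (0::complex^'m) $ inv idx (msingle i 1)) = 0" using rho(2) by simp
    show "\<forall>\<^sub>F s in nhds 0. \<rho> (\<chi> i. ?g s $ inv idx (msingle i 1)) = s"
      using rho(3) by (simp add: \<theta>_def)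
  qed
  show "has_flat_curves q 2 ?g"
    unfolding has_flat_curves_def
  proof (intro allI impI)
    fix u :: "complex^'n" assume "u \<noteq> 0"
    then obtain i0 where i0: "u $ i0 \<noteq> 0" by (auto simp: vec_eq_iff)
    define E where "E = (\<lambda>k. (\<chi> j. if mdeg (idx j) = k then mpow u (idx j) else 0) :: complex^'m)"
    \<comment> \<open>The pure k-th power of a coordinate in which \<open>u\<close> is nonzero is
      seen by \<open>E k\<close> and by no other of these vectors.\<close>
    have "vec.dim (E ` {1..q}) = q"
    proof (rule dim_triangular)
      fix k assume k: "1 \<le> k" "k \<le> q"
      have "idx (inv idx (msingle i0 k)) = msingle i0 k" by (rule idx_inv[OF idx]) (use k in auto)
      then show "\<exists>a. bform a (E k) \<noteq> 0 \<and> (\<forall>d. 1 \<le> d \<longrightarrow> d < k \<longrightarrow> bform a (E d) = 0)"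
        using i0 by (intro exI[of _ "axis (inv idx (msingle i0 k)) 1"]) (simp add: bform_one E_def)
    qed
    then have dim: "vec.dim (vec.span (E ` {1..q})) = q" by simp
    have g: "?g (t *s u) = (\<Sum>k\<in>{1..q}. (t ^ k * (1 + R k (t *s u))) *s E k)" for t
    proof (simp only: vec_eq_iff, rule allI)
      fix j
      have "(\<Sum>k\<in>{1..q}. (t ^ k * (1 + R k (t *s u))) *s E k) $ j
        = (\<Sum>k\<in>{1..q}. if k = mdeg (idx j) then t ^ k * (1 + R k (t *s u)) * mpow u (idx j) else 0)"
        unfolding sum_component by (rule sum.cong) (auto simp: E_def)
      also have "\<dots> = t ^ mdeg (idx j) * (1 + R (mdeg (idx j)) (t *s u)) * mpow u (idx j)"
        using dj[of j] by simp
      finally show "?g (t *s u) $ j = (\<Sum>k\<in>{1..q}. (t ^ k * (1 + R k (t *s u))) *s E k) $ j"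
        by (simp add: normal_form_param_def mpow_scale algebra_simps)
    qed
    have "\<forall>\<^sub>F t in nhds 0. ?g (t *s u) \<in> vec.span (E ` {1..q})"
      unfolding g by (intro always_eventually allI vec.span_sum vec.span_scale vec.span_base imageI)
    then show "\<exists>\<sigma> A. hol_curve \<sigma> \<and> vanish 2 (\<lambda>t. \<sigma> t - t *s u) \<and>
       vec.subspace A \<and> vec.dim A = q \<and> (\<forall>\<^sub>F t in nhds 0. ?g (\<sigma> t) \<in> A)"
      using dim by (intro exI[of _ "\<lambda>t. t *s u"] exI[of _ "vec.span (E ` {1..q})"]) simp
  qed
qed

section \<open>Counting multi-indices\<close>

text \<open>Stars and bars: an enumeration of the variables turns multi-indices into lists of given
  length and sum.\<close>

lemma card_mdeg_eq: "card {\<alpha>::'n::finite \<Rightarrow> nat. mdeg \<alpha> = k} = (k + CARD('n) - 1) choose k"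
proof -
  obtain e :: "nat \<Rightarrow> 'n" where e: "bij_betw e {..<CARD('n)} UNIV"
    using finite_same_card_bij[of "{..<CARD('n)}" "UNIV :: 'n set"] by auto
  let ?l = "\<lambda>\<alpha>::'n \<Rightarrow> nat. map (\<alpha> \<circ> e) [0..<CARD('n)]"
  have sl: "sum_list (?l \<alpha>) = mdeg \<alpha>" for \<alpha>
  proof -
    have "sum_list (?l \<alpha>) = (\<Sum>i<CARD('n). \<alpha> (e i))"
      by (simp add: interv_sum_list_conv_sum_set_nat lessThan_atLeast0)
    also have "\<dots> = mdeg \<alpha>" unfolding mdeg_def by (rule sum.reindex_bij_betw[OF e])
    finally show ?thesis .
  qed
  have "bij_betw ?l {\<alpha>. mdeg \<alpha> = k} {l. length l = CARD('n) \<and> sum_list l = k}"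
    unfolding bij_betw_def
  proof
    show "inj_on ?l {\<alpha>. mdeg \<alpha> = k}"
    proof (rule inj_onI, rule ext)
      fix \<alpha> \<beta> and i :: 'n assume "?l \<alpha> = ?l \<beta>"
      moreover obtain m where "m < CARD('n)" "i = e m" using e by (metis UNIV_I bij_betw_def imageE lessThan_iff)
      ultimately show "\<alpha> i = \<beta> i" by simp
    qed
    show "?l ` {\<alpha>. mdeg \<alpha> = k} = {l. length l = CARD('n) \<and> sum_list l = k}"
    proof
      show "?l ` {\<alpha>. mdeg \<alpha> = k} \<subseteq> {l. length l = CARD('n) \<and> sum_list l = k}"
        by (rule image_subsetI) (simp only: mem_Collect_eq sl, simp)
      show "{l. length l = CARD('n) \<and> sum_list l = k} \<subseteq> ?l ` {\<alpha>. mdeg \<alpha> = k}"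
      proof
        fix l :: "nat list" assume l: "l \<in> {l. length l = CARD('n) \<and> sum_list l = k}"
        define \<alpha> where "\<alpha> = (\<lambda>i. l ! inv_into {..<CARD('n)} e i)"
        have "?l \<alpha> = l"
          by (rule nth_equalityI) (use l e in \<open>auto simp: \<alpha>_def bij_betw_def\<close>)
        moreover have "mdeg \<alpha> = k" using sl[of \<alpha>] calculation l by simp
        ultimately show "l \<in> ?l ` {\<alpha>. mdeg \<alpha> = k}" by (intro image_eqI[of _ _ \<alpha>]) auto
      qed
    qed
  qed
  then show ?thesis using card_length_sum_list[of "CARD('n)" k] by (simp add: bij_betw_same_card)
qed

lemma card_multi_indices: "card (multi_indices q :: ('n::finite \<Rightarrow> nat) set) = ((CARD('n) + q) choose q) - 1"
proof -
  have n: "CARD('n) = Suc (CARD('n) - 1)" by simp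
  have "card {\<alpha>::'n \<Rightarrow> nat. mdeg \<alpha> \<le> q} = card (\<Union>k\<in>{..q}. {\<alpha>::'n \<Rightarrow> nat. mdeg \<alpha> = k})"
    by (rule arg_cong[where f=card]) auto
  also have "\<dots> = (\<Sum>k\<le>q. card {\<alpha>::'n \<Rightarrow> nat. mdeg \<alpha> = k})"
    by (rule card_UN_disjoint) auto
  also have "\<dots> = (\<Sum>k\<le>q. (CARD('n) - 1 + k) choose k)"
    unfolding card_mdeg_eq by (rule sum.cong) (auto simp: add.commute)
  also have "\<dots> = (CARD('n) + q) choose q"
    by (subst sum_choose_lower) (simp flip: n)
  finally have c: "card {\<alpha>::'n \<Rightarrow> nat. mdeg \<alpha> \<le> q} = (CARD('n) + q) choose q" .
  have "multi_indices q = {\<alpha>::'n \<Rightarrow> nat. mdeg \<alpha> \<le> q} - {\<lambda>_. 0}"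
    using mdeg_0_iff by (fastforce simp: multi_indices_def Suc_le_eq)
  then show ?thesis using c by (simp add: card_Diff_singleton)
qed

section \<open>The characterization\<close>

definition lin_hom :: "complex^'m::finite^'m \<Rightarrow> complex^('m option)^('m option)" where
  "lin_hom T = (\<chi> a b. case a of None \<Rightarrow> (case b of None \<Rightarrow> 1 | Some j \<Rightarrow> 0)
     | Some i \<Rightarrow> (case b of None \<Rightarrow> 0 | Some j \<Rightarrow> T $ i $ j))"

lemma lin_hom_mult: "(lin_hom T *v X) $ None = X $ None" "(lin_hom T *v X) $ Some i = (T *v (\<chi> j. X $ Some j)) $ i"
  by (simp_all add: lin_hom_def matrix_vector_mult_def sum_option)

lemma homogenize_linear: "lin_hom T *v homogenize x = homogenize (T *v x)"
proof (simp only: vec_eq_iff, rule allI)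
  fix a
  have "(\<chi> j. homogenize x $ Some j) = x" by (simp add: vec_eq_iff)
  then show "(lin_hom T *v homogenize x) $ a = homogenize (T *v x) $ a" by (cases a) (simp_all add: lin_hom_mult)
qed

lemma invertible_lin_hom: assumes "invertible T" shows "invertible (lin_hom T)"
  unfolding invertible_left_inverse matrix_left_invertible_ker
proof (intro allI impI)
  fix X assume X: "lin_hom T *v X = 0"
  have "(lin_hom T *v X) $ a = 0" for a using X by simp
  then have 1: "X $ None = 0" and "T *v (\<chi> j. X $ Some j) = 0"
    using lin_hom_mult[of T X] by (simp_all add: vec_eq_iff)
  then have "(\<chi> j. X $ Some j) = 0"
    using assms unfolding invertible_left_inverse matrix_left_invertible_ker by blast
  then have "X $ Some j = 0" for j by (simp add: vec_eq_iff)
  then show "X = 0" using 1 by (simp add: vec_eq_iff split_option_all)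
qed

lemma homography_linear: "homography (M ** lin_hom T) x = homography M (T *v x)"
  by (simp add: homography_def homogenize_linear flip: matrix_vector_mul_assoc)

lemma vanish_bigo:
  fixes f :: "complex^'n::finite \<Rightarrow> complex"
  assumes "vanish K f" shows "f \<in> O[at 0](\<lambda>s. complex_of_real (norm s ^ K))"
proof -
  obtain C where "\<forall>\<^sub>F s in nhds 0. norm (f s) \<le> C * norm s ^ K" using assms unfolding vanish_def by blast
  then have "\<forall>\<^sub>F s in at 0. norm (f s) \<le> C * norm (complex_of_real (norm s ^ K))"
    unfolding eventually_at_filter by eventually_elim (simp add: norm_power)
  then show ?thesis by (rule bigoI)
qed

text \<open>The linear normalization lives on the image of \<open>X\<close> under \<open>T\<close>.
  Its parametrization is carried back to \<open>X\<close> by the inverse of \<open>T\<close>; on the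
  result the homography \<open>M ** lin_hom T\<close> takes the values of \<open>M\<close> on the
  normalized parametrization, and \<open>Y\<close> is the image germ.\<close>

lemma property_P_normal_form:
  fixes X :: "(complex^'m::finite) set" and idx :: "'m \<Rightarrow> ('n::finite \<Rightarrow> nat)"
  assumes n: "CARD('n) \<ge> 2" and q: "q \<ge> 2" and idx: "bij_betw idx UNIV (multi_indices q)"
    and X: "smooth_germ CARD('n) X" and P: "property_P CARD('n) q X"
  obtains R Y where "admissible_remainders q R" "R 1 = (\<lambda>s::complex^'n. 0)"
    "\<And>\<alpha>. 2 \<le> mdeg \<alpha> \<Longrightarrow> mdeg \<alpha> \<le> q \<Longrightarrow> vanish (q + 3) (\<lambda>s. mpow s \<alpha> * R (mdeg \<alpha>) s)"
    "parametrizes (normal_form_param idx R) Y" "projectively_equivalent X Y"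
proof -
  have N: "CARD('m) = ((CARD('n) + q) choose q) - 1"
    using bij_betw_same_card[OF idx] by (simp add: card_multi_indices)
  obtain \<gamma> :: "complex^'n \<Rightarrow> complex^'m" where par: "param \<gamma> X" by (rule smooth_germ_param[OF X]) (rule that)
  have R: "jet_regular q \<gamma>" and flat: "has_flat_curves q 2 \<gamma>"
    using P property_P_iff_param[OF par N] by auto
  have q1: "1 \<le> q" using q by simp
  obtain T and \<delta>0 :: "complex^'n \<Rightarrow> complex^'m" where T: "invertible T" "param \<delta>0 ((*v) T ` X)"
    "normal_jet idx q \<delta>0" "has_flat_curves q (Suc q) \<delta>0"
    using straighten_flat_curves[OF idx n par R flat q1 order_refl] by blast
  obtain \<delta> :: "complex^'n \<Rightarrow> complex^'m" and f where d: "param \<delta> ((*v) T ` X)"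
    "\<And>k. 1 \<le> k \<Longrightarrow> k \<le> q \<Longrightarrow> holomorphic_germ (f k) \<and> f k 0 = 1"
    "\<forall>\<^sub>F s in nhds 0. \<forall>j. \<delta> s $ j = mpow s (idx j) * f (mdeg (idx j)) s"
    by (rule flat_lines_normal_form[OF idx n q1 T(2-4)]) (rule that)
  obtain M and \<tau> \<sigma> :: "complex^'n \<Rightarrow> complex^'n" and R where M: "invertible M" "homography_defined_at M 0" "homography M 0 = 0"
    "hol_map \<tau>" "\<tau> 0 = 0" "hol_map \<sigma>" "\<sigma> 0 = 0" "\<forall>\<^sub>F z in nhds 0. \<tau> (\<sigma> z) = z" "\<forall>\<^sub>F z in nhds 0. \<sigma> (\<tau> z) = z"
    "admissible_remainders q R" "R 1 = (\<lambda>s. 0)"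
    "\<And>\<alpha>. 2 \<le> mdeg \<alpha> \<Longrightarrow> mdeg \<alpha> \<le> q \<Longrightarrow> vanish (q + 3) (\<lambda>s. mpow s \<alpha> * R (mdeg \<alpha>) s)"
    "\<forall>\<^sub>F s in nhds 0. homography M (\<delta> (\<tau> s)) = normal_form_param idx R s"
    by (rule projective_normal_form[OF idx q d(2,3)]) (assumption | rule that)+
  obtain T' where T': "T' ** T = mat 1" "T ** T' = mat 1" using T(1) unfolding invertible_def by blast
  have "param (\<lambda>s. T' *v \<delta> s) ((*v) T' ` (*v) T ` X)"
    by (rule param_linear[OF d(1)]) (use T' in \<open>auto simp: invertible_def\<close>)
  moreover have "(*v) T' ` (*v) T ` X = X" by (simp add: image_image matrix_vector_mul_assoc T')
  ultimately have "param (\<lambda>s. T' *v \<delta> s) X" by simp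
  then have par1: "param (\<lambda>s. T' *v \<delta> (\<tau> s)) X" by (rule param_reparam[OF _ M(4-9)])
  let ?N = "M ** lin_hom T"
  have N1: "invertible ?N" by (rule invertible_mult[OF M(1) invertible_lin_hom[OF T(1)]])
  have N2: "homography_defined_at ?N 0"
    using M(2) by (simp add: homography_defined_at_def homogenize_linear flip: matrix_vector_mul_assoc)
  have N3: "homography ?N 0 = 0" using M(3) by (simp add: homography_linear)
  obtain Y where Y: "param (\<lambda>s. homography ?N (T' *v \<delta> (\<tau> s))) Y" "projectively_equivalent X Y"
    by (rule param_projectively_equivalent[OF N1 N2 N3 par1]) (rule that)
  have "homography ?N (T' *v x) = homography M x" for x
    by (simp add: homography_linear matrix_vector_mul_assoc T')
  then have "param (\<lambda>s. homography M (\<delta> (\<tau> s))) Y" using Y(1) by simp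
  then have "param (normal_form_param idx R) Y" by (rule param_cong[OF _ M(13)])
  then have "parametrizes (normal_form_param idx R) Y" by (rule param_parametrizes)
  from that[OF M(10,11,12) this Y(2)] show ?thesis .
qed

text \<open>The homography from \<open>Y\<close> back to \<open>X\<close> turns the normal form into
  a parametrization of \<open>X\<close> itself; regularity and flat curves are invariant under
  homographies.\<close>

lemma normal_form_property_P:
  fixes X :: "(complex^'m::finite) set" and idx :: "'m \<Rightarrow> ('n::finite \<Rightarrow> nat)"
  assumes q: "q \<ge> 2" and idx: "bij_betw idx UNIV (multi_indices q)"
    and R: "admissible_remainders q R" "parametrizes (normal_form_param idx R) Y" "projectively_equivalent X Y"
  shows "property_P CARD('n) q X"
proof -
  have N: "CARD('m) = ((CARD('n) + q) choose q) - 1"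
    using bij_betw_same_card[OF idx] by (simp add: card_multi_indices)
  note nf = normal_form_regular_flat[OF idx q R(1,2)]
  obtain M where M: "invertible M" "homography_defined_at M 0" "homography M 0 = 0"
    "param (\<lambda>s. homography M (normal_form_param idx R s)) X"
    by (rule projectively_equivalent_param[OF R(3) nf(1)]) (rule that)
  have f: "has_flat_curves q (Suc 1) (normal_form_param idx R)" using nf(3) by (simp add: numeral_2_eq_2)
  note rf = regular_flat_homography[OF M(1-3) param_hol[OF nf(1)]]
  show ?thesis
    unfolding property_P_iff_param[OF M(4) N] using rf(1)[OF nf(2)] rf(2)[OF f] by (simp add: numeral_2_eq_2)
qed

theorem mainTheorem3:
  fixes X :: "(complex^'m::finite) set"
    and idx :: "'m \<Rightarrow> ('n::finite \<Rightarrow> nat)"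
    and q :: nat
  assumes "CARD('n) \<ge> 2" and "q \<ge> 2"
    and "bij_betw idx UNIV (multi_indices q)"
    and "smooth_germ CARD('n) X"
  shows "(property_P CARD('n) q X \<longleftrightarrow>
           (\<exists>R Y. admissible_remainders q R \<and>
              parametrizes (normal_form_param idx R) Y \<and> projectively_equivalent X Y))
       \<and> (property_P CARD('n) q X \<longleftrightarrow>
           (\<exists>R Y. admissible_remainders q R \<and>
              (\<forall>\<^sub>F s in nhds 0. R 1 s = 0) \<and>
              (\<forall>\<alpha>. 2 \<le> mdeg \<alpha> \<and> mdeg \<alpha> \<le> q \<longrightarrow>
                 (\<lambda>s. mpow s \<alpha> * R (mdeg \<alpha>) s) \<in> O[at 0](\<lambda>s. complex_of_real (norm s ^ (q + 3)))) \<and>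
              parametrizes (normal_form_param idx R) Y \<and> projectively_equivalent X Y))"
    (is "(?P \<longleftrightarrow> ?A) \<and> (?P \<longleftrightarrow> ?B)")
proof -
  \<comment> \<open>Both equivalences follow from one cycle: property (P) gives the refined form,
    which contains the plain form, which gives back property (P).\<close>
  have "?B" if P: ?P
  proof -
    obtain R Y where R: "admissible_remainders q R" "R 1 = (\<lambda>s::complex^'n. 0)"
      "\<And>\<alpha>. 2 \<le> mdeg \<alpha> \<Longrightarrow> mdeg \<alpha> \<le> q \<Longrightarrow> vanish (q + 3) (\<lambda>s. mpow s \<alpha> * R (mdeg \<alpha>) s)"
      "parametrizes (normal_form_param idx R) Y" "projectively_equivalent X Y"
      by (rule property_P_normal_form[OF assms P]) (rule that)
    have "\<forall>\<^sub>F s in nhds 0. R 1 s = 0" unfolding R(2) by simp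
    moreover have "\<forall>\<alpha>. 2 \<le> mdeg \<alpha> \<and> mdeg \<alpha> \<le> q \<longrightarrow>
        (\<lambda>s. mpow s \<alpha> * R (mdeg \<alpha>) s) \<in> O[at 0](\<lambda>s. complex_of_real (norm s ^ (q + 3)))"
      using vanish_bigo[OF R(3)] by blast
    ultimately show ?B using R(1,4,5) by blast
  qed
  moreover have ?A if ?B using that by blast
  moreover have ?P if ?A using that normal_form_property_P[OF assms(2,3)] by blast
  ultimately show ?thesis by blast
qed

end
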